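(* Let $n\ge 2$ and let $A$ be an associative $n$-ary algebra over a field $k$, with $n$-ary product written $(a_1a_2\cdots a_n)$. Let $\mathcal{O}(A)=T(A)/I$, where $T(A)$ is the tensor algebra of the vector space $A$ and $I$ is the two-sided ideal generated by all elements $a_1\otimes\cdots\otimes a_n-(a_1a_2\cdots a_n)$ with $a_1,\dots,a_n\in A$. Then $\mathcal{O}(A)$ is a $\mathbb{Z}_{n-1}$-graded associative algebra (with the grading induced by the tensor degree modulo $n-1$), and the subspace of its elements of degree $1$, with the $n$-fold product of $\mathcal{O}(A)$, is isomorphic to $A$ as an $n$-ary algebra.
   Context: An $n$-ary algebra over a field $k$ is a $k$-vector space $A$ with a linear map $m:A^{\otimes n}\to A$, written $m(a_1\otimes\cdots\otimes a_n)=(a_1a_2\cdots a_n)$. It is called associative if the product of any $2n-1$ elements is uniquely defined: for all $1\le i,j\le n$, $m\circ(\mathrm{id}\otimes\cdots\otimes m_{(i)}\otimes\cdots\otimes\mathrm{id})=m\circ(\mathrm{id}\otimes\cdots\otimes m_{(j)}\otimes\cdots\otimes\mathrm{id})$ as maps $A^{\otimes(2n-1)}\to A$, where $m_{(i)}$ means that $m$ stands in the $i$-th of the $n$ positions. Here $T(A)=\bigoplus_{k\ge1}A^{\otimes k}$ is the (non-unital) tensor algebra, and $A$ is identified with $A^{\otimes 1}$. Algebras are not required to have a unit. $\mathbb{Z}_{n-1}=\mathbb{Z}/(n-1)\mathbb{Z}$. In a $\mathbb{Z}_{n-1}$-graded algebra, the subspace of elements of degree $1$ is stable under the $n$-fold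 product and is thus an $n$-ary algebra. *)

theory Defs
  imports "HOL-Algebra.Module" "HOL-Algebra.QuotRing" "HOL-Algebra.Elementary_Groups"
begin

section \<open>Linear algebra over a field\<close>

text \<open>
  A vector space over a field \<open>K\<close> is a \<^locale>\<open>module\<close> over \<open>K\<close>.  The record type of modules extends
  that of rings; the fields \<open>mult\<close> and \<open>one\<close> play no role for a mere vector space, and
  \<open>one\<close> plays no role for a non-unital algebra.
\<close>

definition linear_maps ::
  "('k, 'x) ring_scheme \<Rightarrow> ('k, 'a, 'y) module_scheme \<Rightarrow> ('k, 'b, 'z) module_scheme \<Rightarrow> ('a \<Rightarrow> 'b) set" where
  "linear_maps K V W = {f \<in> carrier V \<rightarrow> carrier W.
     (\<forall>x\<in>carrier V. \<forall>y\<in>carrier V. f (x \<oplus>\<^bsub>V\<^esub> y) = f x \<oplus>\<^bsub>W\<^esub> f y) \<and>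
     (\<forall>c\<in>carrier K. \<forall>x\<in>carrier V. f (c \<odot>\<^bsub>V\<^esub> x) = c \<odot>\<^bsub>W\<^esub> f x)}"

definition submodule_generated ::
  "('k, 'x) ring_scheme \<Rightarrow> ('k, 'a, 'y) module_scheme \<Rightarrow> 'a set \<Rightarrow> 'a set" where
  "submodule_generated K V S = \<Inter>{N. submodule N K V \<and> S \<subseteq> N}"

text \<open>Quotient by a subspace; the product is meaningful only when \<open>N\<close> is a two-sided ideal.\<close>

definition quotient_module ::
  "('k, 'a, 'y) module_scheme \<Rightarrow> 'a set \<Rightarrow> ('k, 'a set) module" where
  "quotient_module V N =
     \<lparr>carrier = a_rcosets\<^bsub>V\<^esub> N, monoid.mult = rcoset_mult V N, one = N +>\<^bsub>V\<^esub> \<one>\<^bsub>V\<^esub>,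
      ring.zero = N, ring.add = set_add V, smult = (\<lambda>c U. \<Union>x\<in>U. N +>\<^bsub>V\<^esub> (c \<odot>\<^bsub>V\<^esub> x))\<rparr>"

definition free_module :: "('k, 'x) ring_scheme \<Rightarrow> 's set \<Rightarrow> ('k, 's \<Rightarrow> 'k) module" where
  "free_module K S =
     \<lparr>carrier = {f. range f \<subseteq> carrier K \<and> finite {s. f s \<noteq> \<zero>\<^bsub>K\<^esub>} \<and> {s. f s \<noteq> \<zero>\<^bsub>K\<^esub>} \<subseteq> S},
      monoid.mult = undefined, one = undefined,
      ring.zero = (\<lambda>s. \<zero>\<^bsub>K\<^esub>), ring.add = (\<lambda>f g s. f s \<oplus>\<^bsub>K\<^esub> g s), smult = (\<lambda>c f s. c \<otimes>\<^bsub>K\<^esub> f s)\<rparr>"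

definition basis_vector :: "('k, 'x) ring_scheme \<Rightarrow> 's \<Rightarrow> 's \<Rightarrow> 'k" where
  "basis_vector K s = (\<lambda>t. if t = s then \<one>\<^bsub>K\<^esub> else \<zero>\<^bsub>K\<^esub>)"

definition direct_sum_module ::
  "'i set \<Rightarrow> ('i \<Rightarrow> ('k, 'a, 'y) module_scheme) \<Rightarrow> ('k, 'i \<Rightarrow> 'a) module" where
  "direct_sum_module J V =
     \<lparr>carrier = {t \<in> \<Pi>\<^sub>E j\<in>J. carrier (V j). finite {j \<in> J. t j \<noteq> \<zero>\<^bsub>V j\<^esub>}},
      monoid.mult = undefined, one = undefined,
      ring.zero = (\<lambda>j\<in>J. \<zero>\<^bsub>V j\<^esub>), ring.add = (\<lambda>s t. \<lambda>j\<in>J. s j \<oplus>\<^bsub>V j\<^esub> t j),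
      smult = (\<lambda>c t. \<lambda>j\<in>J. c \<odot>\<^bsub>V j\<^esub> t j)\<rparr>"


section \<open>Tensor powers\<close>

text \<open>
  The \<open>k\<close>-th tensor power of \<open>A\<close> is the free vector space on the words of length \<open>k\<close> over \<open>A\<close>,
  modulo the relations expressing linearity in each letter.
\<close>

definition words :: "('a, 'x) partial_object_scheme \<Rightarrow> nat \<Rightarrow> 'a list set" where
  "words A k = {w. set w \<subseteq> carrier A \<and> length w = k}"

definition tensor_relators ::
  "('k, 'x) ring_scheme \<Rightarrow> ('k, 'a, 'y) module_scheme \<Rightarrow> nat \<Rightarrow> ('a list \<Rightarrow> 'k) set" where
  "tensor_relators K A k = (let F = free_module K (words A k); e = basis_vector K in
     {e (u @ [a \<oplus>\<^bsub>A\<^esub> b] @ v) \<ominus>\<^bsub>F\<^esub> (e (u @ [a] @ v) \<oplus>\<^bsub>F\<^esub> e (u @ [b] @ v)) | u v a b.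
        set u \<subseteq> carrier A \<and> set v \<subseteq> carrier A \<and> length u + 1 + length v = k \<and>
        a \<in> carrier A \<and> b \<in> carrier A} \<union>
     {e (u @ [c \<odot>\<^bsub>A\<^esub> a] @ v) \<ominus>\<^bsub>F\<^esub> (c \<odot>\<^bsub>F\<^esub> e (u @ [a] @ v)) | u v a c.
        set u \<subseteq> carrier A \<and> set v \<subseteq> carrier A \<and> length u + 1 + length v = k \<and>
        a \<in> carrier A \<and> c \<in> carrier K})"

definition tensor_relations ::
  "('k, 'x) ring_scheme \<Rightarrow> ('k, 'a, 'y) module_scheme \<Rightarrow> nat \<Rightarrow> ('a list \<Rightarrow> 'k) set" where
  "tensor_relations K A k =
     submodule_generated K (free_module K (words A k)) (tensor_relators K A k)"

definition tensor_power ::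
  "('k, 'x) ring_scheme \<Rightarrow> ('k, 'a, 'y) module_scheme \<Rightarrow> nat \<Rightarrow> ('k, ('a list \<Rightarrow> 'k) set) module" where
  "tensor_power K A k = quotient_module (free_module K (words A k)) (tensor_relations K A k)"

text \<open>\<open>pure_tensor K A [a\<^sub>1, \<dots>, a\<^sub>k]\<close> is \<open>a\<^sub>1 \<otimes> \<dots> \<otimes> a\<^sub>k\<close>.\<close>

definition pure_tensor ::
  "('k, 'x) ring_scheme \<Rightarrow> ('k, 'a, 'y) module_scheme \<Rightarrow> 'a list \<Rightarrow> ('a list \<Rightarrow> 'k) set" where
  "pure_tensor K A w =
     tensor_relations K A (length w) +>\<^bsub>free_module K (words A (length w))\<^esub> basis_vector K w"

text \<open>
  The linear map on the \<open>k\<close>-th tensor power that sends \<open>a\<^sub>1 \<otimes> \<dots> \<otimes> a\<^sub>k\<close> to \<open>\<mu> [a\<^sub>1, \<dots>, a\<^sub>k]\<close>, for \<open>\<mu>\<close>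
  multilinear: the value does not depend on the chosen representative of the coset.
\<close>

definition tensor_lift ::
  "('k, 'x) ring_scheme \<Rightarrow> ('k, 'b, 'y) module_scheme \<Rightarrow> ('a list \<Rightarrow> 'b) \<Rightarrow> ('a list \<Rightarrow> 'k) set \<Rightarrow> 'b" where
  "tensor_lift K W \<mu> U =
     (let f = (SOME f. f \<in> U) in \<Oplus>\<^bsub>W\<^esub>w\<in>{w. f w \<noteq> \<zero>\<^bsub>K\<^esub>}. f w \<odot>\<^bsub>W\<^esub> \<mu> w)"

text \<open>
  The bilinear map from the \<open>i\<close>-th times the \<open>j\<close>-th to the \<open>(i + j)\<close>-th tensor power that
  concatenates pure tensors.  On the level of the free vector spaces, the coefficient of the
  product at a word of length \<open>i + j\<close> is the product of the coefficients at its two parts; at all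
  other words the formula below gives zero.
\<close>

definition tensor_concat ::
  "('k, 'x) ring_scheme \<Rightarrow> ('k, 'a, 'y) module_scheme \<Rightarrow> nat \<Rightarrow> nat \<Rightarrow>
   ('a list \<Rightarrow> 'k) set \<Rightarrow> ('a list \<Rightarrow> 'k) set \<Rightarrow> ('a list \<Rightarrow> 'k) set" where
  "tensor_concat K A i j U V = (\<Union>x\<in>U. \<Union>y\<in>V.
     tensor_relations K A (i + j) +>\<^bsub>free_module K (words A (i + j))\<^esub>
       (\<lambda>w. x (take i w) \<otimes>\<^bsub>K\<^esub> y (drop i w)))"


section \<open>Associative algebras, ideals, gradings\<close>

locale nonunital_algebra = module +
  assumes mult_closed: "\<lbrakk>x \<in> carrier M; y \<in> carrier M\<rbrakk> \<Longrightarrow> x \<otimes>\<^bsub>M\<^esub> y \<in> carrier M"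
    and mult_assoc: "\<lbrakk>x \<in> carrier M; y \<in> carrier M; z \<in> carrier M\<rbrakk> \<Longrightarrow>
      (x \<otimes>\<^bsub>M\<^esub> y) \<otimes>\<^bsub>M\<^esub> z = x \<otimes>\<^bsub>M\<^esub> (y \<otimes>\<^bsub>M\<^esub> z)"
    and mult_l_distr: "\<lbrakk>x \<in> carrier M; y \<in> carrier M; z \<in> carrier M\<rbrakk> \<Longrightarrow>
      (x \<oplus>\<^bsub>M\<^esub> y) \<otimes>\<^bsub>M\<^esub> z = (x \<otimes>\<^bsub>M\<^esub> z) \<oplus>\<^bsub>M\<^esub> (y \<otimes>\<^bsub>M\<^esub> z)"
    and mult_r_distr: "\<lbrakk>x \<in> carrier M; y \<in> carrier M; z \<in> carrier M\<rbrakk> \<Longrightarrow>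
      x \<otimes>\<^bsub>M\<^esub> (y \<oplus>\<^bsub>M\<^esub> z) = (x \<otimes>\<^bsub>M\<^esub> y) \<oplus>\<^bsub>M\<^esub> (x \<otimes>\<^bsub>M\<^esub> z)"
    and smult_mult_l: "\<lbrakk>c \<in> carrier R; x \<in> carrier M; y \<in> carrier M\<rbrakk> \<Longrightarrow>
      (c \<odot>\<^bsub>M\<^esub> x) \<otimes>\<^bsub>M\<^esub> y = c \<odot>\<^bsub>M\<^esub> (x \<otimes>\<^bsub>M\<^esub> y)"
    and smult_mult_r: "\<lbrakk>c \<in> carrier R; x \<in> carrier M; y \<in> carrier M\<rbrakk> \<Longrightarrow>
      x \<otimes>\<^bsub>M\<^esub> (c \<odot>\<^bsub>M\<^esub> y) = c \<odot>\<^bsub>M\<^esub> (x \<otimes>\<^bsub>M\<^esub> y)"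

text \<open>The library's \<^locale>\<open>ideal\<close> presupposes a unital ring.\<close>

definition algebra_ideal ::
  "('k, 'x) ring_scheme \<Rightarrow> ('k, 'a, 'y) module_scheme \<Rightarrow> 'a set \<Rightarrow> bool" where
  "algebra_ideal K B I \<longleftrightarrow> submodule I K B \<and>
     (\<forall>x\<in>I. \<forall>b\<in>carrier B. b \<otimes>\<^bsub>B\<^esub> x \<in> I \<and> x \<otimes>\<^bsub>B\<^esub> b \<in> I)"

definition algebra_ideal_generated ::
  "('k, 'x) ring_scheme \<Rightarrow> ('k, 'a, 'y) module_scheme \<Rightarrow> 'a set \<Rightarrow> 'a set" where
  "algebra_ideal_generated K B S = \<Inter>{I. algebra_ideal K B I \<and> S \<subseteq> I}"

text \<open>
  \<open>D\<close> is a grading of the algebra \<open>B\<close> by the group \<open>G\<close>: \<open>B\<close> is the direct sum of the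
  subspaces \<open>D g\<close>, and \<open>D g \<cdot> D h \<subseteq> D (g h)\<close>.
\<close>

definition graded_algebra ::
  "('g, 'w) monoid_scheme \<Rightarrow> ('k, 'x) ring_scheme \<Rightarrow> ('k, 'a, 'y) module_scheme \<Rightarrow> ('g \<Rightarrow> 'a set) \<Rightarrow> bool" where
  "graded_algebra G K B D \<longleftrightarrow> nonunital_algebra K B \<and>
     (\<forall>g\<in>carrier G. submodule (D g) K B) \<and>
     (\<forall>b\<in>carrier B. \<exists>!x. x \<in> (\<Pi>\<^sub>E g\<in>carrier G. D g) \<and>
        finite {g \<in> carrier G. x g \<noteq> \<zero>\<^bsub>B\<^esub>} \<and>
        b = (\<Oplus>\<^bsub>B\<^esub>g\<in>{g \<in> carrier G. x g \<noteq> \<zero>\<^bsub>B\<^esub>}. x g)) \<and>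
     (\<forall>g\<in>carrier G. \<forall>h\<in>carrier G. \<forall>x\<in>D g. \<forall>y\<in>D h. x \<otimes>\<^bsub>B\<^esub> y \<in> D (g \<otimes>\<^bsub>G\<^esub> h))"


section \<open>The non-unital tensor algebra\<close>

definition tensor_algebra ::
  "('k, 'x) ring_scheme \<Rightarrow> ('k, 'a, 'y) module_scheme \<Rightarrow> ('k, nat \<Rightarrow> ('a list \<Rightarrow> 'k) set) module" where
  "tensor_algebra K A = (direct_sum_module {1..} (tensor_power K A))
     \<lparr>monoid.mult := (\<lambda>s t. \<lambda>k\<in>{1..}.
        \<Oplus>\<^bsub>tensor_power K A k\<^esub>i\<in>{1..<k}. tensor_concat K A i (k - i) (s i) (t (k - i)))\<rparr>"

definition tensor_inclusion ::
  "('k, 'x) ring_scheme \<Rightarrow> ('k, 'a, 'y) module_scheme \<Rightarrow> nat \<Rightarrow> ('a list \<Rightarrow> 'k) set \<Rightarrow>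
   nat \<Rightarrow> ('a list \<Rightarrow> 'k) set" where
  "tensor_inclusion K A k U = (\<lambda>j\<in>{1..}. if j = k then U else \<zero>\<^bsub>tensor_power K A j\<^esub>)"


section \<open>Associative n-ary algebras\<close>

text \<open>
  The map \<open>id \<otimes> \<dots> \<otimes> m \<otimes> \<dots> \<otimes> id\<close> from the \<open>(2n - 1)\<close>-st to the \<open>n\<close>-th tensor power, where \<open>m\<close> is
  preceded by \<open>i\<close> identities.  Positions are thus counted from 0.
\<close>

definition nary_insert ::
  "('k, 'x) ring_scheme \<Rightarrow> ('k, 'a, 'y) module_scheme \<Rightarrow> nat \<Rightarrow> (('a list \<Rightarrow> 'k) set \<Rightarrow> 'a) \<Rightarrow> nat \<Rightarrow>
   ('a list \<Rightarrow> 'k) set \<Rightarrow> ('a list \<Rightarrow> 'k) set" where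
  "nary_insert K A n m i = tensor_lift K (tensor_power K A n)
     (\<lambda>w. pure_tensor K A
        (take i w @ [m (pure_tensor K A (take n (drop i w)))] @ drop (i + n) w))"

definition assoc_nary_algebra ::
  "('k, 'x) ring_scheme \<Rightarrow> ('k, 'a, 'y) module_scheme \<Rightarrow> nat \<Rightarrow> (('a list \<Rightarrow> 'k) set \<Rightarrow> 'a) \<Rightarrow> bool" where
  "assoc_nary_algebra K A n m \<longleftrightarrow> module K A \<and> m \<in> linear_maps K (tensor_power K A n) A \<and>
     (\<forall>i<n. \<forall>j<n. \<forall>U\<in>carrier (tensor_power K A (2 * n - 1)).
        m (nary_insert K A n m i U) = m (nary_insert K A n m j U))"

definition nary_algebra_iso ::
  "('k, 'x) ring_scheme \<Rightarrow> nat \<Rightarrow>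
   ('k, 'a, 'y) module_scheme \<Rightarrow> (('a list \<Rightarrow> 'k) set \<Rightarrow> 'a) \<Rightarrow>
   ('k, 'b, 'z) module_scheme \<Rightarrow> (('b list \<Rightarrow> 'k) set \<Rightarrow> 'b) \<Rightarrow> ('a \<Rightarrow> 'b) set" where
  "nary_algebra_iso K n A m B m' = {f \<in> linear_maps K A B.
     bij_betw f (carrier A) (carrier B) \<and>
     (\<forall>w\<in>words A n. f (m (pure_tensor K A w)) = m' (pure_tensor K B (map f w)))}"

text \<open>
  The subspace \<open>S\<close> of an associative algebra \<open>B\<close> with the \<open>n\<close>-fold product
  \<open>b\<^sub>1 \<otimes> \<dots> \<otimes> b\<^sub>n \<mapsto> b\<^sub>1 \<cdots> b\<^sub>n\<close> of \<open>B\<close>.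
\<close>

definition subspace_module :: "('k, 'b) module \<Rightarrow> 'b set \<Rightarrow> ('k, 'b) module" where
  "subspace_module B S = B\<lparr>carrier := S\<rparr>"

definition nfold_product ::
  "('k, 'x) ring_scheme \<Rightarrow> ('k, 'b) module \<Rightarrow> 'b set \<Rightarrow> ('b list \<Rightarrow> 'k) set \<Rightarrow> 'b" where
  "nfold_product K B S =
     tensor_lift K (subspace_module B S) (\<lambda>w. foldl (monoid.mult B) (hd w) (tl w))"


section \<open>The algebra O(A)\<close>

definition env_ideal ::
  "('k, 'x) ring_scheme \<Rightarrow> ('k, 'a, 'y) module_scheme \<Rightarrow> nat \<Rightarrow> (('a list \<Rightarrow> 'k) set \<Rightarrow> 'a) \<Rightarrow>
   (nat \<Rightarrow> ('a list \<Rightarrow> 'k) set) set" where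
  "env_ideal K A n m = algebra_ideal_generated K (tensor_algebra K A)
     {tensor_inclusion K A n (pure_tensor K A w) \<ominus>\<^bsub>tensor_algebra K A\<^esub>
      tensor_inclusion K A 1 (pure_tensor K A [m (pure_tensor K A w)]) | w. w \<in> words A n}"

definition env_algebra ::
  "('k, 'x) ring_scheme \<Rightarrow> ('k, 'a, 'y) module_scheme \<Rightarrow> nat \<Rightarrow> (('a list \<Rightarrow> 'k) set \<Rightarrow> 'a) \<Rightarrow>
   ('k, (nat \<Rightarrow> ('a list \<Rightarrow> 'k) set) set) module" where
  "env_algebra K A n m = quotient_module (tensor_algebra K A) (env_ideal K A n m)"

text \<open>
  The classes of the tensors all of whose components have degree congruent to \<open>r\<close> modulo \<open>n - 1\<close>,
  for \<open>r\<close> in the carrier \<open>{0..<n - 1}\<close> of \<^term>\<open>integer_mod_group (n - 1)\<close>.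
\<close>

definition env_component ::
  "('k, 'x) ring_scheme \<Rightarrow> ('k, 'a, 'y) module_scheme \<Rightarrow> nat \<Rightarrow> (('a list \<Rightarrow> 'k) set \<Rightarrow> 'a) \<Rightarrow>
   int \<Rightarrow> (nat \<Rightarrow> ('a list \<Rightarrow> 'k) set) set set" where
  "env_component K A n m r = {env_ideal K A n m +>\<^bsub>tensor_algebra K A\<^esub> t | t.
     t \<in> carrier (tensor_algebra K A) \<and>
     (\<forall>k\<ge>1. t k \<noteq> \<zero>\<^bsub>tensor_power K A k\<^esub> \<longrightarrow> int k mod int (n - 1) = r)}"

text \<open>For \<open>n = 2\<close> the residue class of 1 is the only element 0 of the trivial group.\<close>

definition env_degree_one ::
  "('k, 'x) ring_scheme \<Rightarrow> ('k, 'a, 'y) module_scheme \<Rightarrow> nat \<Rightarrow> (('a list \<Rightarrow> 'k) set \<Rightarrow> 'a) \<Rightarrow>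
   (nat \<Rightarrow> ('a list \<Rightarrow> 'k) set) set set" where
  "env_degree_one K A n m = env_component K A n m (1 mod int (n - 1))"

end

(*
  A word of length 1 + s (n - 1) over A has an iterated n-ary product in A, obtained by always
  multiplying the first n letters.  Associativity makes it invariant under replacing any n consecutive
  letters by their product, and it is multilinear, so it defines a linear map T(A) -> A (zero in the
  degrees not congruent to 1) which vanishes on b g c for every generator g of I.  Hence A embeds in
  O(A); conversely the relations reduce every word of degree congruent to 1 to a single letter, so A is
  all of the degree one part.  The generators are homogeneous modulo n - 1, so the projections of T(A)
  onto the residue classes of degrees preserve I and descend to the grading of O(A).
*)

theory Submission
  imports Defs
begin

section \<open>Linear maps and quotient modules\<close>

text \<open>The delicate point is that \<open>A\<close> does not collapse in the quotient. The ideal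
  is an intersection, so membership gives no expression to compute with; a statement about its
  elements is proved by exhibiting another ideal that contains the generators. The kernel of the
  evaluation map is in general no such ideal: for \<open>n > 2\<close> it contains every tensor of
  degree not congruent to 1, and multiplication by a word can move such a tensor to a degree where
  its value is nonzero. It is replaced by the elements all of whose two-sided multiples are killed.
  The same device, with another ideal, shows that the ideal is stable under the projections onto
  residues. Associativity is given on tensors but used on words, and it is decisive only when the
  leftmost block of \<open>n\<close> letters overlaps the place where a product is inserted. The
  resulting retraction onto \<open>A\<close> is inverse to the canonical map on the part of degree
  one. This one map yields injectivity, closure of that part under \<open>n\<close>-fold products,
  and the isomorphism. For \<open>n = 2\<close> the modulus is 1 and the part of degree one is the
  whole algebra; the arguments are uniform in \<open>n\<close>.\<close>

lemma linear_mapsI: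
  assumes "\<And>x. x \<in> carrier V \<Longrightarrow> f x \<in> carrier W"
    and "\<And>x y. x \<in> carrier V \<Longrightarrow> y \<in> carrier V \<Longrightarrow> f (x \<oplus>\<^bsub>V\<^esub> y) = f x \<oplus>\<^bsub>W\<^esub> f y"
    and "\<And>c x. c \<in> carrier K \<Longrightarrow> x \<in> carrier V \<Longrightarrow> f (c \<odot>\<^bsub>V\<^esub> x) = c \<odot>\<^bsub>W\<^esub> f x"
  shows "f \<in> linear_maps K V W"
  using assms by (auto simp: linear_maps_def)

lemma linear_mapsD:
  assumes "f \<in> linear_maps K V W"
  shows "\<And>x. x \<in> carrier V \<Longrightarrow> f x \<in> carrier W"
    and "\<And>x y. x \<in> carrier V \<Longrightarrow> y \<in> carrier V \<Longrightarrow> f (x \<oplus>\<^bsub>V\<^esub> y) = f x \<oplus>\<^bsub>W\<^esub> f y"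
    and "\<And>c x. c \<in> carrier K \<Longrightarrow> x \<in> carrier V \<Longrightarrow> f (c \<odot>\<^bsub>V\<^esub> x) = c \<odot>\<^bsub>W\<^esub> f x"
  using assms by (auto simp: linear_maps_def)

lemma linear_maps_comp:
  assumes "f \<in> linear_maps K V W" "g \<in> linear_maps K W X"
  shows "(\<lambda>x. g (f x)) \<in> linear_maps K V X"
  using assms by (auto simp: linear_maps_def Pi_iff)

lemma (in abelian_group) diff_eq_zero_iff:
  assumes "x \<in> carrier G" "y \<in> carrier G"
  shows "x \<ominus> y = \<zero> \<longleftrightarrow> x = y"
  unfolding a_minus_def using assms minus_equality[of x "\<ominus> y"] by (auto simp: r_neg)

lemma (in abelian_group) diff_zero: "x \<in> carrier G \<Longrightarrow> x \<ominus> \<zero> = x"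
  unfolding a_minus_def by simp

lemma linear_maps_zero:
  assumes "module K V" "module K W" "f \<in> linear_maps K V W"
  shows "f \<zero>\<^bsub>V\<^esub> = \<zero>\<^bsub>W\<^esub>"
proof -
  interpret V: module K V by fact
  interpret W: module K W by fact
  have "f (\<zero>\<^bsub>K\<^esub> \<odot>\<^bsub>V\<^esub> \<zero>\<^bsub>V\<^esub>) = \<zero>\<^bsub>K\<^esub> \<odot>\<^bsub>W\<^esub> f \<zero>\<^bsub>V\<^esub>"
    by (intro linear_mapsD(3)[OF assms(3)]) auto
  then show ?thesis using linear_mapsD(1)[OF assms(3)] by simp
qed

lemma (in module) uminus_eq_smult:
  "x \<in> carrier M \<Longrightarrow> \<ominus>\<^bsub>M\<^esub> x = (\<ominus>\<^bsub>R\<^esub> \<one>\<^bsub>R\<^esub>) \<odot>\<^bsub>M\<^esub> x"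
  by (simp add: smult_l_minus)

lemma linear_maps_diff:
  assumes "module K V" "module K W" "f \<in> linear_maps K V W" "x \<in> carrier V" "y \<in> carrier V"
  shows "f (x \<ominus>\<^bsub>V\<^esub> y) = f x \<ominus>\<^bsub>W\<^esub> f y"
proof -
  interpret V: module K V by fact
  interpret W: module K W by fact
  show ?thesis
    using assms(4,5) linear_mapsD[OF assms(3)]
    by (simp add: a_minus_def V.uminus_eq_smult W.uminus_eq_smult)
qed

text \<open>Closure under negatives is the case of the scalar -1.\<close>

lemma (in module) submoduleI':
  assumes "H \<subseteq> carrier M" "\<zero>\<^bsub>M\<^esub> \<in> H"
    and "\<And>a b. a \<in> H \<Longrightarrow> b \<in> H \<Longrightarrow> a \<oplus>\<^bsub>M\<^esub> b \<in> H"
    and smult: "\<And>a x. a \<in> carrier R \<Longrightarrow> x \<in> H \<Longrightarrow> a \<odot>\<^bsub>M\<^esub> x \<in> H"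
  shows "submodule H R M"
proof (rule submoduleI)
  fix a assume "a \<in> H"
  then show "\<ominus>\<^bsub>M\<^esub> a \<in> H"
    using smult[of "\<ominus>\<^bsub>R\<^esub> \<one>\<^bsub>R\<^esub>" a] assms(1) by (auto simp: uminus_eq_smult)
qed (use assms in auto)

lemma (in module) submodule_zero_mem: "submodule H R M \<Longrightarrow> \<zero>\<^bsub>M\<^esub> \<in> H"
  using subgroup.one_closed[OF submodule.axioms(1), of H R M] by simp

lemma (in module) submodule_singleton_zero: "submodule {\<zero>\<^bsub>M\<^esub>} R M"
  by (rule submoduleI') auto

text \<open>Generated submodules are intersections, so an inclusion of \<open>rel k\<close> in some
  set is proved by presenting that set as a preimage: of the zero submodule for a kernel, of another
  relation module for a map between free modules on words.\<close>

lemma submodule_vimage: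
  assumes "module K V" "module K W" "f \<in> linear_maps K V W" "submodule N K W"
  shows "submodule {x \<in> carrier V. f x \<in> N} K V"
proof -
  interpret V: module K V by fact
  interpret W: module K W by fact
  note N = W.submoduleE[OF assms(4)] W.submodule_zero_mem[OF assms(4)]
  show ?thesis
    by (rule V.submoduleI')
      (use N linear_maps_zero[OF assms(1-3)] linear_mapsD[OF assms(3)] in auto)
qed

lemma (in module) submodule_generated_submodule:
  assumes "S \<subseteq> carrier M"
  shows "submodule (submodule_generated R M S) R M"
proof (rule submoduleI')
  show "submodule_generated R M S \<subseteq> carrier M"
    using assms carrier_is_submodule by (auto simp: submodule_generated_def)
  show "\<zero>\<^bsub>M\<^esub> \<in> submodule_generated R M S"
    using submodule_zero_mem by (auto simp: submodule_generated_def)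
qed (auto simp: submodule_generated_def dest: submoduleE)

lemma submodule_generated_superset: "S \<subseteq> submodule_generated K V S"
  by (auto simp: submodule_generated_def)

lemma submodule_generated_minimal:
  "submodule N K V \<Longrightarrow> S \<subseteq> N \<Longrightarrow> submodule_generated K V S \<subseteq> N"
  by (auto simp: submodule_generated_def)

text \<open>\<open>W\<close> is a bare record at first; a map onto it that respects the operations
  carries over all the axioms, which are equations together with the existence of negatives. With a
  coset map this gives quotients, with the identity it moves the axioms between records that agree
  on the module operations.\<close>

lemma module_image:
  assumes "module K V" and carr: "carrier W = f ` carrier V" and zero: "\<zero>\<^bsub>W\<^esub> = f \<zero>\<^bsub>V\<^esub>"
    and add: "\<And>x y. x \<in> carrier V \<Longrightarrow> y \<in> carrier V \<Longrightarrow> f x \<oplus>\<^bsub>W\<^esub> f y = f (x \<oplus>\<^bsub>V\<^esub> y)"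
    and smult: "\<And>c x. c \<in> carrier K \<Longrightarrow> x \<in> carrier V \<Longrightarrow> c \<odot>\<^bsub>W\<^esub> f x = f (c \<odot>\<^bsub>V\<^esub> x)"
  shows "module K W"
proof -
  interpret V: module K V by fact
  show ?thesis
  proof (rule moduleI)
    show "cring K" ..
    show "abelian_group W"
    proof (rule abelian_groupI)
      fix x assume "x \<in> carrier W"
      then obtain x' where "x' \<in> carrier V" "x = f x'" by (auto simp: carr)
      then show "\<exists>y\<in>carrier W. y \<oplus>\<^bsub>W\<^esub> x = \<zero>\<^bsub>W\<^esub>"
        by (intro bexI[of _ "f (\<ominus>\<^bsub>V\<^esub> x')"]) (auto simp: carr zero add V.l_neg)
    qed (auto simp: carr zero add V.a_ac)
  qed (auto simp: carr add smult V.smult_l_distr V.smult_r_distr V.smult_assoc1)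
qed

lemma nonunital_algebra_image:
  assumes "nonunital_algebra K V" and carr: "carrier W = f ` carrier V"
    and zero: "\<zero>\<^bsub>W\<^esub> = f \<zero>\<^bsub>V\<^esub>"
    and add: "\<And>x y. x \<in> carrier V \<Longrightarrow> y \<in> carrier V \<Longrightarrow> f x \<oplus>\<^bsub>W\<^esub> f y = f (x \<oplus>\<^bsub>V\<^esub> y)"
    and smult: "\<And>c x. c \<in> carrier K \<Longrightarrow> x \<in> carrier V \<Longrightarrow> c \<odot>\<^bsub>W\<^esub> f x = f (c \<odot>\<^bsub>V\<^esub> x)"
    and mult: "\<And>x y. x \<in> carrier V \<Longrightarrow> y \<in> carrier V \<Longrightarrow> f x \<otimes>\<^bsub>W\<^esub> f y = f (x \<otimes>\<^bsub>V\<^esub> y)"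
  shows "nonunital_algebra K W"
proof -
  interpret V: nonunital_algebra K V by fact
  interpret W: module K W
    by (rule module_image[OF V.module_axioms carr zero add smult])
  show ?thesis
    by unfold_locales
      (auto simp: carr add smult mult V.mult_closed V.mult_assoc V.mult_l_distr V.mult_r_distr
        V.smult_mult_l V.smult_mult_r)
qed

section \<open>Quotients by submodules\<close>

locale submodule_quotient = module +
  fixes N
  assumes N: "submodule N R M"
begin

abbreviation "Q \<equiv> quotient_module M N"
abbreviation "q \<equiv> \<lambda>x. N +>\<^bsub>M\<^esub> x"

sublocale N: abelian_subgroup N M
  by (intro abelian_subgroupI3 additive_subgroup.intro submodule.axioms(1)[OF N] M.abelian_group_axioms)

lemma quotient_carrier: "carrier Q = q ` carrier M"
  by (auto simp: quotient_module_def A_RCOSETS_def' a_r_coset_def')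

lemma quotient_zero: "\<zero>\<^bsub>Q\<^esub> = q \<zero>\<^bsub>M\<^esub>"
  using submoduleE(1)[OF N] by (simp add: quotient_module_def)

lemma quotient_eq_iff:
  assumes "x \<in> carrier M" "y \<in> carrier M"
  shows "q x = q y \<longleftrightarrow> x \<ominus>\<^bsub>M\<^esub> y \<in> N"
  unfolding a_minus_def
  using assms N.a_rcos_module[of y x] N.a_repr_independence'[of x y] N.a_repr_independenceD[of x y]
  by metis

lemma quotient_eq_zero_iff:
  assumes "x \<in> carrier M"
  shows "q x = \<zero>\<^bsub>Q\<^esub> \<longleftrightarrow> x \<in> N"
  using assms quotient_eq_iff[OF assms M.zero_closed] by (simp add: quotient_zero M.diff_zero)

lemma mem_quotient_class:
  assumes "x \<in> carrier M" "y \<in> q x"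
  shows "y \<in> carrier M" "q y = q x"
  using assms N.a_elemrcos_carrier N.a_repr_independence' by auto

lemma quotient_add:
  "x \<in> carrier M \<Longrightarrow> y \<in> carrier M \<Longrightarrow> q x \<oplus>\<^bsub>Q\<^esub> q y = q (x \<oplus>\<^bsub>M\<^esub> y)"
  by (simp add: quotient_module_def N.a_rcos_sum)

text \<open>\<open>smult\<close> of the quotient is a union over all representatives
  \<open>y\<close> of the coset. Its members coincide because \<open>c y - c x = c (y - x)\<close>
  lies in \<open>N\<close>.\<close>

lemma quotient_smult:
  assumes "c \<in> carrier R" "x \<in> carrier M"
  shows "c \<odot>\<^bsub>Q\<^esub> q x = q (c \<odot>\<^bsub>M\<^esub> x)"
proof -
  have "q (c \<odot>\<^bsub>M\<^esub> y) = q (c \<odot>\<^bsub>M\<^esub> x)" if "y \<in> q x" for y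
  proof -
    note y = mem_quotient_class[OF assms(2) that]
    then have "y \<ominus>\<^bsub>M\<^esub> x \<in> N" using assms quotient_eq_iff by blast
    then have "c \<odot>\<^bsub>M\<^esub> (y \<ominus>\<^bsub>M\<^esub> x) \<in> N" using submoduleE(4)[OF N] assms by blast
    also have "c \<odot>\<^bsub>M\<^esub> (y \<ominus>\<^bsub>M\<^esub> x) = c \<odot>\<^bsub>M\<^esub> y \<ominus>\<^bsub>M\<^esub> c \<odot>\<^bsub>M\<^esub> x"
      using assms y by (simp add: a_minus_def smult_r_distr smult_r_minus)
    finally show ?thesis using assms y quotient_eq_iff by simp
  qed
  then have "(\<Union>y\<in>q x. q (c \<odot>\<^bsub>M\<^esub> y)) = q (c \<odot>\<^bsub>M\<^esub> x)"
    using N.a_rcos_self[OF assms(2)] by (intro UN_constant_eq ballI)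
  then show ?thesis by (simp add: quotient_module_def)
qed

lemma quotient_module_axioms: "module R Q"
  by (rule module_image[OF module_axioms quotient_carrier quotient_zero quotient_add quotient_smult])

lemma quotient_map_linear: "q \<in> linear_maps R M Q"
  by (rule linear_mapsI) (auto simp: quotient_carrier quotient_add quotient_smult)

text \<open>All that is asked of \<open>g\<close> is that on each coset it evaluates
  \<open>f\<close> at some member, which may vary with the coset. This fits functions that pick a
  representative by \<open>SOME\<close>, such as \<open>tensor_lift\<close> and
  \<open>env_part\<close>.\<close>

lemma quotient_lift_linear:
  assumes W: "module R W" and f: "f \<in> linear_maps R M W" and ker: "\<And>x. x \<in> N \<Longrightarrow> f x = \<zero>\<^bsub>W\<^esub>"
    and g: "\<And>x. x \<in> carrier M \<Longrightarrow> \<exists>y \<in> q x. g (q x) = f y"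
  shows "g \<in> linear_maps R Q W" "\<And>x. x \<in> carrier M \<Longrightarrow> g (q x) = f x"
proof -
  interpret W: module R W by fact
  show *: "g (q x) = f x" if x: "x \<in> carrier M" for x
  proof -
    obtain y where y: "y \<in> q x" "g (q x) = f y" using g[OF x] by blast
    note y' = mem_quotient_class[OF x y(1)]
    have "f (y \<ominus>\<^bsub>M\<^esub> x) = \<zero>\<^bsub>W\<^esub>"
      using y' x ker quotient_eq_iff by blast
    then have "f y \<ominus>\<^bsub>W\<^esub> f x = \<zero>\<^bsub>W\<^esub>"
      using y' x by (simp add: linear_maps_diff[OF module_axioms W f])
    then show ?thesis
      using y y' x linear_mapsD(1)[OF f] W.diff_eq_zero_iff[of "f y" "f x"] by simp
  qed
  show "g \<in> linear_maps R Q W"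
    by (rule linear_mapsI)
      (auto simp: quotient_carrier quotient_add quotient_smult * linear_mapsD[OF f])
qed

end

section \<open>Quotient algebras by two-sided ideals\<close>

locale ideal_quotient = nonunital_algebra +
  fixes N
  assumes ideal: "algebra_ideal R M N"

sublocale ideal_quotient \<subseteq> submodule_quotient
proof (intro submodule_quotient.intro submodule_quotient_axioms.intro)
  show "submodule N R M" using ideal by (simp add: algebra_ideal_def)
qed (rule module_axioms)

context nonunital_algebra
begin

text \<open>The absorbing zero comes from the scalars: the zero vector is 0 times a vector, and
  scalars move out of a product.\<close>

lemma mult_null [simp]:
  "x \<in> carrier M \<Longrightarrow> \<zero>\<^bsub>M\<^esub> \<otimes>\<^bsub>M\<^esub> x = \<zero>\<^bsub>M\<^esub>" "x \<in> carrier M \<Longrightarrow> x \<otimes>\<^bsub>M\<^esub> \<zero>\<^bsub>M\<^esub> = \<zero>\<^bsub>M\<^esub>"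
  using smult_mult_l[of "\<zero>\<^bsub>R\<^esub>" "\<zero>\<^bsub>M\<^esub>" x] smult_mult_r[of "\<zero>\<^bsub>R\<^esub>" x "\<zero>\<^bsub>M\<^esub>"] by (auto simp: mult_closed)

lemma mult_diff:
  assumes "x \<in> carrier M" "y \<in> carrier M" "z \<in> carrier M"
  shows "(x \<ominus>\<^bsub>M\<^esub> y) \<otimes>\<^bsub>M\<^esub> z = x \<otimes>\<^bsub>M\<^esub> z \<ominus>\<^bsub>M\<^esub> y \<otimes>\<^bsub>M\<^esub> z"
    and "z \<otimes>\<^bsub>M\<^esub> (x \<ominus>\<^bsub>M\<^esub> y) = z \<otimes>\<^bsub>M\<^esub> x \<ominus>\<^bsub>M\<^esub> z \<otimes>\<^bsub>M\<^esub> y"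
  using assms
  by (auto simp: a_minus_def uminus_eq_smult mult_l_distr mult_r_distr smult_mult_l smult_mult_r
      mult_closed)

end

context ideal_quotient
begin

lemma quotient_mult:
  assumes "x \<in> carrier M" "y \<in> carrier M"
  shows "q x \<otimes>\<^bsub>Q\<^esub> q y = q (x \<otimes>\<^bsub>M\<^esub> y)"
proof -
  have eq: "q (x' \<otimes>\<^bsub>M\<^esub> y') = q (x \<otimes>\<^bsub>M\<^esub> y)" if "x' \<in> q x" "y' \<in> q y" for x' y'
  proof -
    note x' = mem_quotient_class[OF assms(1) that(1)] and y' = mem_quotient_class[OF assms(2) that(2)]
    \<comment> \<open>One factor is changed at a time:
      \<open>x' y' - x y = (x' - x) y' + x (y' - y)\<close>, and each summand lies in the
      ideal.\<close>
    have "(x' \<ominus>\<^bsub>M\<^esub> x) \<otimes>\<^bsub>M\<^esub> y' \<in> N" "x \<otimes>\<^bsub>M\<^esub> (y' \<ominus>\<^bsub>M\<^esub> y) \<in> N"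
      using quotient_eq_iff assms x' y' ideal by (auto simp: algebra_ideal_def)
    then have "q (x' \<otimes>\<^bsub>M\<^esub> y') = q (x \<otimes>\<^bsub>M\<^esub> y')" "q (x \<otimes>\<^bsub>M\<^esub> y') = q (x \<otimes>\<^bsub>M\<^esub> y)"
      using assms x' y' by (auto simp: quotient_eq_iff mult_closed mult_diff)
    then show ?thesis by simp
  qed
  have "(\<Union>x'\<in>q x. \<Union>y'\<in>q y. q (x' \<otimes>\<^bsub>M\<^esub> y')) = q (x \<otimes>\<^bsub>M\<^esub> y)"
    by (intro UN_constant_eq[OF N.a_rcos_self[OF assms(1)]]
        UN_constant_eq[OF N.a_rcos_self[OF assms(2)]] ballI eq)
  then show ?thesis by (simp add: quotient_module_def rcoset_mult_def)
qed

lemma quotient_algebra: "nonunital_algebra R Q"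
  by (rule nonunital_algebra_image[OF nonunital_algebra_axioms quotient_carrier quotient_zero
        quotient_add quotient_smult quotient_mult])

end


section \<open>Free modules\<close>

lemma free_module_simps [simp]:
  "\<zero>\<^bsub>free_module K S\<^esub> = (\<lambda>s. \<zero>\<^bsub>K\<^esub>)"
  "f \<oplus>\<^bsub>free_module K S\<^esub> g = (\<lambda>s. f s \<oplus>\<^bsub>K\<^esub> g s)"
  "c \<odot>\<^bsub>free_module K S\<^esub> f = (\<lambda>s. c \<otimes>\<^bsub>K\<^esub> f s)"
  by (simp_all add: free_module_def)

lemma free_module_carrierI:
  assumes "\<And>s. f s \<in> carrier K" "finite B" "B \<subseteq> S" "\<And>s. s \<notin> B \<Longrightarrow> f s = \<zero>\<^bsub>K\<^esub>"
  shows "f \<in> carrier (free_module K S)"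
proof -
  have "{s. f s \<noteq> \<zero>\<^bsub>K\<^esub>} \<subseteq> B" using assms by blast
  then show ?thesis using assms by (auto simp: free_module_def intro: finite_subset)
qed

lemma free_module_carrierD:
  assumes "f \<in> carrier (free_module K S)"
  shows "f s \<in> carrier K" "finite {s. f s \<noteq> \<zero>\<^bsub>K\<^esub>}" "{s. f s \<noteq> \<zero>\<^bsub>K\<^esub>} \<subseteq> S"
    "s \<notin> S \<Longrightarrow> f s = \<zero>\<^bsub>K\<^esub>"
  using assms by (auto simp: free_module_def)

lemma free_module_module:
  assumes "cring K"
  shows "module K (free_module K S)"
proof -
  interpret K: cring K by fact
  have add: "f \<oplus>\<^bsub>free_module K S\<^esub> g \<in> carrier (free_module K S)"
    if "f \<in> carrier (free_module K S)" "g \<in> carrier (free_module K S)" for f g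
    using free_module_carrierD[OF that(1)] free_module_carrierD[OF that(2)]
    by (intro free_module_carrierI[where B = "{s. f s \<noteq> \<zero>\<^bsub>K\<^esub>} \<union> {s. g s \<noteq> \<zero>\<^bsub>K\<^esub>}"]) auto
  have smult: "c \<odot>\<^bsub>free_module K S\<^esub> f \<in> carrier (free_module K S)"
    if "c \<in> carrier K" "f \<in> carrier (free_module K S)" for c f
    using free_module_carrierD[OF that(2)] that(1)
    by (intro free_module_carrierI[where B = "{s. f s \<noteq> \<zero>\<^bsub>K\<^esub>}"]) auto
  have val: "f s \<in> carrier K" if "f \<in> carrier (free_module K S)" for f s
    using free_module_carrierD(1)[OF that] .
  show ?thesis
  proof (rule moduleI)
    show "abelian_group (free_module K S)"
    proof (rule abelian_groupI)
      fix f assume f: "f \<in> carrier (free_module K S)"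
      then show "\<exists>y\<in>carrier (free_module K S). y \<oplus>\<^bsub>free_module K S\<^esub> f = \<zero>\<^bsub>free_module K S\<^esub>"
        using smult[OF _ f, of "\<ominus>\<^bsub>K\<^esub> \<one>\<^bsub>K\<^esub>"] free_module_carrierD[OF f]
        by (intro bexI[of _ "(\<ominus>\<^bsub>K\<^esub> \<one>\<^bsub>K\<^esub>) \<odot>\<^bsub>free_module K S\<^esub> f"])
          (auto simp: K.l_minus K.l_neg)
    next
      show "\<zero>\<^bsub>free_module K S\<^esub> \<in> carrier (free_module K S)"
        by (intro free_module_carrierI[where B = "{}"]) auto
    qed (use add in \<open>auto simp: K.a_ac val fun_eq_iff\<close>)
  qed (use smult assms in \<open>auto simp: K.l_distr K.r_distr K.m_assoc val fun_eq_iff\<close>)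
qed

lemma basis_vector_carrier:
  assumes "cring K" "s \<in> S"
  shows "basis_vector K s \<in> carrier (free_module K S)"
proof -
  interpret K: cring K by fact
  show ?thesis
    by (rule free_module_carrierI[where B = "{s}"]) (use assms in \<open>auto simp: basis_vector_def\<close>)
qed

text \<open>The induction runs over a finite set containing the support rather than over the support
  itself: one point is removed by setting the value there to zero, whether or not it was zero
  already.\<close>

lemma free_module_induct [consumes 2, case_names zero scaled_basis add]:
  assumes "cring K" "f \<in> carrier (free_module K S)"
    and zero: "P (\<lambda>s. \<zero>\<^bsub>K\<^esub>)"
    and basis: "\<And>c s. c \<in> carrier K \<Longrightarrow> s \<in> S \<Longrightarrow> P (c \<odot>\<^bsub>free_module K S\<^esub> basis_vector K s)"
    and add: "\<And>f g. f \<in> carrier (free_module K S) \<Longrightarrow> g \<in> carrier (free_module K S) \<Longrightarrow>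
      P f \<Longrightarrow> P g \<Longrightarrow> P (f \<oplus>\<^bsub>free_module K S\<^esub> g)"
  shows "P f"
proof -
  interpret K: cring K by fact
  interpret F: module K "free_module K S" by (rule free_module_module) fact
  have "P f" if "finite B" "f \<in> carrier (free_module K S)" "B \<subseteq> S" "\<And>s. s \<notin> B \<Longrightarrow> f s = \<zero>\<^bsub>K\<^esub>" for B f
    using that
  proof (induction B arbitrary: f rule: finite_induct)
    case empty
    then have "f = (\<lambda>s. \<zero>\<^bsub>K\<^esub>)" by auto
    then show ?case using zero by simp
  next
    case (insert s B)
    note f = free_module_carrierD[OF insert.prems(1)]
    let ?g = "f(s := \<zero>\<^bsub>K\<^esub>)"
    have g: "?g \<in> carrier (free_module K S)"
      using f(1) insert.hyps insert.prems
      by (intro free_module_carrierI[where B = B]) auto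
    moreover have "B \<subseteq> S" "\<And>t. t \<notin> B \<Longrightarrow> ?g t = \<zero>\<^bsub>K\<^esub>" using insert.prems by auto
    ultimately have "P ?g" by (intro insert.IH)
    moreover have "f s \<odot>\<^bsub>free_module K S\<^esub> basis_vector K s \<in> carrier (free_module K S)"
      using f insert.prems by (intro F.smult_closed basis_vector_carrier) (auto intro: assms)
    ultimately have "P (?g \<oplus>\<^bsub>free_module K S\<^esub> (f s \<odot>\<^bsub>free_module K S\<^esub> basis_vector K s))"
      using f insert.prems g by (intro add basis) auto
    also have "?g \<oplus>\<^bsub>free_module K S\<^esub> (f s \<odot>\<^bsub>free_module K S\<^esub> basis_vector K s) = f"
      using f(1) by (auto simp: basis_vector_def fun_eq_iff)
    finally show ?case .
  qed
  from this[OF free_module_carrierD(2)[OF assms(2)] assms(2) free_module_carrierD(3)[OF assms(2)]]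
  show ?thesis by auto
qed

lemma free_module_submodule_eqI:
  assumes "cring K" "submodule H K (free_module K S)"
    and "\<And>s. s \<in> S \<Longrightarrow> basis_vector K s \<in> H" and "f \<in> carrier (free_module K S)"
  shows "f \<in> H"
proof -
  interpret F: module K "free_module K S" by (rule free_module_module) fact
  note H = F.submoduleE[OF assms(2)] F.submodule_zero_mem[OF assms(2)]
  show ?thesis
    using assms(1,4) by (induction rule: free_module_induct) (use H assms(3) in auto)
qed

text \<open>The linear extension of \<open>\<mu>\<close> from the basis. It is the sum inside
  \<open>tensor_lift\<close>, taken at a given function instead of a representative chosen from a
  coset.\<close>

definition free_lift ::
  "('k, 'x) ring_scheme \<Rightarrow> ('k, 'b, 'y) module_scheme \<Rightarrow> ('s \<Rightarrow> 'b) \<Rightarrow> ('s \<Rightarrow> 'k) \<Rightarrow> 'b" where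
  "free_lift K W \<mu> f = (\<Oplus>\<^bsub>W\<^esub>w\<in>{w. f w \<noteq> \<zero>\<^bsub>K\<^esub>}. f w \<odot>\<^bsub>W\<^esub> \<mu> w)"

text \<open>The supports of \<open>f\<close>, \<open>g\<close> and \<open>f + g\<close> differ, so
  additivity has to be checked over one finite set that contains them all.\<close>

lemma free_lift_superset:
  assumes "module K W" "f \<in> carrier (free_module K S)" "\<mu> \<in> S \<rightarrow> carrier W"
    and "finite B" "B \<subseteq> S" "{w. f w \<noteq> \<zero>\<^bsub>K\<^esub>} \<subseteq> B"
  shows "free_lift K W \<mu> f = (\<Oplus>\<^bsub>W\<^esub>w\<in>B. f w \<odot>\<^bsub>W\<^esub> \<mu> w)"
proof -
  interpret W: module K W by fact
  have carr: "f w \<odot>\<^bsub>W\<^esub> \<mu> w \<in> carrier W" if "w \<in> B" for w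
    using that assms free_module_carrierD(1)[OF assms(2)] by (intro W.smult_closed) auto
  show ?thesis unfolding free_lift_def
  proof (rule W.add.finprod_mono_neutral_cong_left)
    fix i assume "i \<in> B - {w. f w \<noteq> \<zero>\<^bsub>K\<^esub>}"
    then show "f i \<odot>\<^bsub>W\<^esub> \<mu> i = \<zero>\<^bsub>W\<^esub>" using assms(3,5) by (auto intro!: W.smult_l_null)
  qed (use assms carr in auto)
qed

lemma free_lift_linear:
  assumes "module K W" "\<mu> \<in> S \<rightarrow> carrier W"
  shows "free_lift K W \<mu> \<in> linear_maps K (free_module K S) W"
proof -
  interpret W: module K W by fact
  interpret F: module K "free_module K S" by (rule free_module_module) (rule W.R.cring_axioms)
  have carr: "f w \<odot>\<^bsub>W\<^esub> \<mu> w \<in> carrier W" if "f \<in> carrier (free_module K S)" "w \<in> S" for f w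
    using that assms free_module_carrierD(1)[OF that(1)] by (intro W.smult_closed) auto
  note lift = free_lift_superset[OF assms(1) _ assms(2)]
  show ?thesis
  proof (rule linear_mapsI)
    fix f assume f: "f \<in> carrier (free_module K S)"
    note f' = free_module_carrierD[OF f]
    show "free_lift K W \<mu> f \<in> carrier W"
      unfolding free_lift_def by (intro W.M.finsum_closed) (use f f' carr in auto)
  next
    fix f g assume f: "f \<in> carrier (free_module K S)" and g: "g \<in> carrier (free_module K S)"
    note f' = free_module_carrierD[OF f] and g' = free_module_carrierD[OF g]
    let ?B = "{w. f w \<noteq> \<zero>\<^bsub>K\<^esub>} \<union> {w. g w \<noteq> \<zero>\<^bsub>K\<^esub>}"
    have B: "finite ?B" "?B \<subseteq> S" using f' g' by auto
    have "free_lift K W \<mu> (f \<oplus>\<^bsub>free_module K S\<^esub> g) = (\<Oplus>\<^bsub>W\<^esub>w\<in>?B. (f w \<oplus>\<^bsub>K\<^esub> g w) \<odot>\<^bsub>W\<^esub> \<mu> w)"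
      by (subst lift[of _ ?B]) (use B f g F.a_closed[OF f g] in auto)
    also have "\<dots> = (\<Oplus>\<^bsub>W\<^esub>w\<in>?B. f w \<odot>\<^bsub>W\<^esub> \<mu> w \<oplus>\<^bsub>W\<^esub> g w \<odot>\<^bsub>W\<^esub> \<mu> w)"
      by (rule W.M.finsum_cong')
        (use B f g f' g' carr assms in \<open>auto simp: W.smult_l_distr Pi_iff\<close>)
    also have "\<dots> = (\<Oplus>\<^bsub>W\<^esub>w\<in>?B. f w \<odot>\<^bsub>W\<^esub> \<mu> w) \<oplus>\<^bsub>W\<^esub> (\<Oplus>\<^bsub>W\<^esub>w\<in>?B. g w \<odot>\<^bsub>W\<^esub> \<mu> w)"
      by (rule W.M.finsum_addf) (use B carr f g in auto)
    also have "\<dots> = free_lift K W \<mu> f \<oplus>\<^bsub>W\<^esub> free_lift K W \<mu> g"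
      using B f g by (simp add: lift[of f ?B] lift[of g ?B])
    finally show "free_lift K W \<mu> (f \<oplus>\<^bsub>free_module K S\<^esub> g) = free_lift K W \<mu> f \<oplus>\<^bsub>W\<^esub> free_lift K W \<mu> g" .
  next
    fix c f assume c: "c \<in> carrier K" and f: "f \<in> carrier (free_module K S)"
    note f' = free_module_carrierD[OF f]
    let ?B = "{w. f w \<noteq> \<zero>\<^bsub>K\<^esub>}"
    have "free_lift K W \<mu> (c \<odot>\<^bsub>free_module K S\<^esub> f) = (\<Oplus>\<^bsub>W\<^esub>w\<in>?B. (c \<otimes>\<^bsub>K\<^esub> f w) \<odot>\<^bsub>W\<^esub> \<mu> w)"
      by (subst lift[of _ ?B]) (use f' c F.smult_closed[OF c f] in auto)
    also have "\<dots> = (\<Oplus>\<^bsub>W\<^esub>w\<in>?B. c \<odot>\<^bsub>W\<^esub> (f w \<odot>\<^bsub>W\<^esub> \<mu> w))"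
      by (rule W.M.finsum_cong')
        (use f c f' carr assms in \<open>auto simp: W.smult_assoc1 Pi_iff\<close>)
    also have "\<dots> = c \<odot>\<^bsub>W\<^esub> free_lift K W \<mu> f" unfolding free_lift_def
      by (rule W.finsum_smult_ldistr[symmetric]) (use f f' carr c in auto)
    finally show "free_lift K W \<mu> (c \<odot>\<^bsub>free_module K S\<^esub> f) = c \<odot>\<^bsub>W\<^esub> free_lift K W \<mu> f" .
  qed
qed

lemma free_lift_basis:
  assumes "module K W" "\<mu> \<in> S \<rightarrow> carrier W" "s \<in> S"
  shows "free_lift K W \<mu> (basis_vector K s) = \<mu> s"
proof -
  interpret W: module K W by fact
  have "\<mu> s \<in> carrier W" using assms by auto
  moreover have "{w. basis_vector K s w \<noteq> \<zero>\<^bsub>K\<^esub>} \<subseteq> {s}" by (auto simp: basis_vector_def)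
  ultimately show ?thesis
    using free_lift_superset[OF assms(1) basis_vector_carrier[OF W.R.cring_axioms assms(3)] assms(2), of "{s}"]
      assms(3) by (simp add: basis_vector_def)
qed


section \<open>Tensor powers\<close>

text \<open>The splitting \<open>u @ [a] @ v\<close> at one letter is the one of
  \<open>tensor_relators\<close>, so the equations say that the linear extension of
  \<open>\<mu>\<close> kills the relators. At \<open>k = 0\<close> only the membership clause
  remains.\<close>

definition multilinear_words ::
  "('k, 'x) ring_scheme \<Rightarrow> ('k, 'a, 'y) module_scheme \<Rightarrow> nat \<Rightarrow> ('k, 'b, 'z) module_scheme \<Rightarrow>
   ('a list \<Rightarrow> 'b) \<Rightarrow> bool" where
  "multilinear_words K A k W \<mu> \<longleftrightarrow> \<mu> \<in> words A k \<rightarrow> carrier W \<and>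
     (\<forall>u v. set u \<subseteq> carrier A \<longrightarrow> set v \<subseteq> carrier A \<longrightarrow> length u + 1 + length v = k \<longrightarrow>
        (\<forall>a\<in>carrier A. \<forall>b\<in>carrier A. \<mu> (u @ [a \<oplus>\<^bsub>A\<^esub> b] @ v) = \<mu> (u @ [a] @ v) \<oplus>\<^bsub>W\<^esub> \<mu> (u @ [b] @ v)) \<and>
        (\<forall>c\<in>carrier K. \<forall>a\<in>carrier A. \<mu> (u @ [c \<odot>\<^bsub>A\<^esub> a] @ v) = c \<odot>\<^bsub>W\<^esub> \<mu> (u @ [a] @ v)))"

lemma multilinear_wordsI:
  assumes "\<And>w. set w \<subseteq> carrier A \<Longrightarrow> length w = k \<Longrightarrow> \<mu> w \<in> carrier W"
    and "\<And>u v a b. set u \<subseteq> carrier A \<Longrightarrow> set v \<subseteq> carrier A \<Longrightarrow> length u + 1 + length v = k \<Longrightarrow>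
       a \<in> carrier A \<Longrightarrow> b \<in> carrier A \<Longrightarrow>
       \<mu> (u @ [a \<oplus>\<^bsub>A\<^esub> b] @ v) = \<mu> (u @ [a] @ v) \<oplus>\<^bsub>W\<^esub> \<mu> (u @ [b] @ v)"
    and "\<And>u v c a. set u \<subseteq> carrier A \<Longrightarrow> set v \<subseteq> carrier A \<Longrightarrow> length u + 1 + length v = k \<Longrightarrow>
       c \<in> carrier K \<Longrightarrow> a \<in> carrier A \<Longrightarrow> \<mu> (u @ [c \<odot>\<^bsub>A\<^esub> a] @ v) = c \<odot>\<^bsub>W\<^esub> \<mu> (u @ [a] @ v)"
  shows "multilinear_words K A k W \<mu>"
  using assms unfolding multilinear_words_def words_def by blast

lemma multilinear_wordsD:
  assumes "multilinear_words K A k W \<mu>"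
  shows "\<And>w. set w \<subseteq> carrier A \<Longrightarrow> length w = k \<Longrightarrow> \<mu> w \<in> carrier W"
    and "\<And>u v a b. set u \<subseteq> carrier A \<Longrightarrow> set v \<subseteq> carrier A \<Longrightarrow> length u + 1 + length v = k \<Longrightarrow>
       a \<in> carrier A \<Longrightarrow> b \<in> carrier A \<Longrightarrow>
       \<mu> (u @ [a \<oplus>\<^bsub>A\<^esub> b] @ v) = \<mu> (u @ [a] @ v) \<oplus>\<^bsub>W\<^esub> \<mu> (u @ [b] @ v)"
    and "\<And>u v c a. set u \<subseteq> carrier A \<Longrightarrow> set v \<subseteq> carrier A \<Longrightarrow> length u + 1 + length v = k \<Longrightarrow>
       c \<in> carrier K \<Longrightarrow> a \<in> carrier A \<Longrightarrow> \<mu> (u @ [c \<odot>\<^bsub>A\<^esub> a] @ v) = c \<odot>\<^bsub>W\<^esub> \<mu> (u @ [a] @ v)"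
  using assms unfolding multilinear_words_def words_def by blast+

text \<open>A copy of \<^locale>\<open>module\<close>, so that interpreting \<^locale>\<open>module\<close> does not import the material on tensors.\<close>

locale tensor_module = module
begin

abbreviation "Fr k \<equiv> free_module R (words M k)"
abbreviation "rel k \<equiv> tensor_relations R M k"
abbreviation "TP k \<equiv> tensor_power R M k"
abbreviation "pt \<equiv> pure_tensor R M"

lemma word_basis_carrier: "set w \<subseteq> carrier M \<Longrightarrow> length w = k \<Longrightarrow> basis_vector R w \<in> carrier (Fr k)"
  by (rule basis_vector_carrier) (auto simp: words_def intro: R.cring_axioms)

lemma Fr_module: "module R (Fr k)"
  by (rule free_module_module) (rule R.cring_axioms)

lemma tensor_relators_carrier: "tensor_relators R M k \<subseteq> carrier (Fr k)"
proof -
  interpret F: module R "Fr k" for k by (rule Fr_module)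
  show ?thesis
    unfolding tensor_relators_def Let_def
    by (auto intro!: F.minus_closed F.a_closed F.smult_closed word_basis_carrier simp del: free_module_simps)
qed

lemma tensor_power_quotient: "submodule_quotient R (Fr k) (rel k)"
  unfolding tensor_relations_def
  by (intro submodule_quotient.intro submodule_quotient_axioms.intro
      module.submodule_generated_submodule Fr_module tensor_relators_carrier)

lemma tensor_relations_subsetI:
  assumes "submodule N R (Fr k)"
    and "\<And>u v a b. set u \<subseteq> carrier M \<Longrightarrow> set v \<subseteq> carrier M \<Longrightarrow> length u + 1 + length v = k \<Longrightarrow>
       a \<in> carrier M \<Longrightarrow> b \<in> carrier M \<Longrightarrow>
       basis_vector R (u @ [a \<oplus>\<^bsub>M\<^esub> b] @ v) \<ominus>\<^bsub>Fr k\<^esub>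
         (basis_vector R (u @ [a] @ v) \<oplus>\<^bsub>Fr k\<^esub> basis_vector R (u @ [b] @ v)) \<in> N"
    and "\<And>u v c a. set u \<subseteq> carrier M \<Longrightarrow> set v \<subseteq> carrier M \<Longrightarrow> length u + 1 + length v = k \<Longrightarrow>
       c \<in> carrier R \<Longrightarrow> a \<in> carrier M \<Longrightarrow>
       basis_vector R (u @ [c \<odot>\<^bsub>M\<^esub> a] @ v) \<ominus>\<^bsub>Fr k\<^esub> (c \<odot>\<^bsub>Fr k\<^esub> basis_vector R (u @ [a] @ v)) \<in> N"
  shows "rel k \<subseteq> N"
  unfolding tensor_relations_def
  by (rule submodule_generated_minimal[OF assms(1)])
    (use assms(2,3) in \<open>auto simp: tensor_relators_def Let_def simp del: free_module_simps\<close>)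

lemma tensor_power_module: "module R (TP k)"
proof -
  interpret q: submodule_quotient R "Fr k" "rel k" by (rule tensor_power_quotient)
  show ?thesis using q.quotient_module_axioms by (simp add: tensor_power_def)
qed

lemma pure_tensor_carrier:
  assumes "set w \<subseteq> carrier M" "length w = k"
  shows "pt w \<in> carrier (TP k)"
proof -
  interpret q: submodule_quotient R "Fr k" "rel k" by (rule tensor_power_quotient)
  show ?thesis
    using word_basis_carrier[OF assms] assms(2)
    by (auto simp: pure_tensor_def tensor_power_def q.quotient_carrier)
qed

lemma tensor_relations_superset: "tensor_relators R M k \<subseteq> rel k"
  unfolding tensor_relations_def by (rule submodule_generated_superset)

lemma tensor_relations_add:
  assumes "set u \<subseteq> carrier M" "set v \<subseteq> carrier M" "length u + 1 + length v = k"
    "a \<in> carrier M" "b \<in> carrier M"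
  shows "basis_vector R (u @ [a \<oplus>\<^bsub>M\<^esub> b] @ v) \<ominus>\<^bsub>Fr k\<^esub>
    (basis_vector R (u @ [a] @ v) \<oplus>\<^bsub>Fr k\<^esub> basis_vector R (u @ [b] @ v)) \<in> rel k"
  by (rule subsetD[OF tensor_relations_superset])
    (use assms in \<open>unfold tensor_relators_def Let_def, blast\<close>)

lemma tensor_relations_smult:
  assumes "set u \<subseteq> carrier M" "set v \<subseteq> carrier M" "length u + 1 + length v = k"
    "c \<in> carrier R" "a \<in> carrier M"
  shows "basis_vector R (u @ [c \<odot>\<^bsub>M\<^esub> a] @ v) \<ominus>\<^bsub>Fr k\<^esub>
    (c \<odot>\<^bsub>Fr k\<^esub> basis_vector R (u @ [a] @ v)) \<in> rel k"
  by (rule subsetD[OF tensor_relations_superset])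
    (use assms in \<open>unfold tensor_relators_def Let_def, blast\<close>)

lemma pure_tensor_multilinear: "multilinear_words R M k (TP k) pt"
proof (rule multilinear_wordsI)
  interpret q: submodule_quotient R "Fr k" "rel k" by (rule tensor_power_quotient)
  {
    fix u v a b assume uv: "set u \<subseteq> carrier M" "set v \<subseteq> carrier M" "length u + 1 + length v = k"
      and ab: "a \<in> carrier M" "b \<in> carrier M"
    let ?x = "basis_vector R (u @ [a \<oplus>\<^bsub>M\<^esub> b] @ v)" and ?y = "basis_vector R (u @ [a] @ v)"
      and ?z = "basis_vector R (u @ [b] @ v)"
    have c: "?x \<in> carrier (Fr k)" "?y \<in> carrier (Fr k)" "?z \<in> carrier (Fr k)"
      using uv ab by (auto intro!: word_basis_carrier)
    have "?x \<ominus>\<^bsub>Fr k\<^esub> (?y \<oplus>\<^bsub>Fr k\<^esub> ?z) \<in> rel k"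
      using uv ab by (rule tensor_relations_add)
    then have "q.q ?x = q.q (?y \<oplus>\<^bsub>Fr k\<^esub> ?z)"
      using c q.M.a_closed[OF c(2,3)] by (simp add: q.quotient_eq_iff del: free_module_simps)
    also have "\<dots> = q.q ?y \<oplus>\<^bsub>TP k\<^esub> q.q ?z"
      using c by (simp add: q.quotient_add tensor_power_def del: free_module_simps)
    finally show "pt (u @ [a \<oplus>\<^bsub>M\<^esub> b] @ v) = pt (u @ [a] @ v) \<oplus>\<^bsub>TP k\<^esub> pt (u @ [b] @ v)"
      using uv by (simp add: pure_tensor_def)
  }
  {
    fix u v c a assume uv: "set u \<subseteq> carrier M" "set v \<subseteq> carrier M" "length u + 1 + length v = k"
      and ca: "c \<in> carrier R" "a \<in> carrier M"
    let ?x = "basis_vector R (u @ [c \<odot>\<^bsub>M\<^esub> a] @ v)" and ?y = "basis_vector R (u @ [a] @ v)"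
    have c: "?x \<in> carrier (Fr k)" "?y \<in> carrier (Fr k)"
      using uv ca by (auto intro!: word_basis_carrier)
    have "?x \<ominus>\<^bsub>Fr k\<^esub> (c \<odot>\<^bsub>Fr k\<^esub> ?y) \<in> rel k"
      using uv ca by (rule tensor_relations_smult)
    then have "q.q ?x = q.q (c \<odot>\<^bsub>Fr k\<^esub> ?y)"
      using c q.smult_closed[OF ca(1) c(2)] by (simp add: q.quotient_eq_iff del: free_module_simps)
    also have "\<dots> = c \<odot>\<^bsub>TP k\<^esub> q.q ?y"
      using c ca by (simp add: q.quotient_smult tensor_power_def del: free_module_simps)
    finally show "pt (u @ [c \<odot>\<^bsub>M\<^esub> a] @ v) = c \<odot>\<^bsub>TP k\<^esub> pt (u @ [a] @ v)"
      using uv by (simp add: pure_tensor_def)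
  }
qed (auto intro: pure_tensor_carrier)

text \<open>Scalars occur because the length may be 0: the empty word has no letter to absorb
  them.\<close>

lemma tensor_power_induct [consumes 1, case_names zero scaled_pure add]:
  assumes "U \<in> carrier (TP k)"
    and zero: "P \<zero>\<^bsub>TP k\<^esub>"
    and pure: "\<And>c w. c \<in> carrier R \<Longrightarrow> set w \<subseteq> carrier M \<Longrightarrow> length w = k \<Longrightarrow> P (c \<odot>\<^bsub>TP k\<^esub> pt w)"
    and add: "\<And>U V. U \<in> carrier (TP k) \<Longrightarrow> V \<in> carrier (TP k) \<Longrightarrow> P U \<Longrightarrow> P V \<Longrightarrow> P (U \<oplus>\<^bsub>TP k\<^esub> V)"
  shows "P U"
proof -
  interpret q: submodule_quotient R "Fr k" "rel k" by (rule tensor_power_quotient)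
  note [simp del] = free_module_simps
  obtain f where f: "f \<in> carrier (Fr k)" "U = q.q f"
    using assms(1) by (auto simp: tensor_power_def q.quotient_carrier)
  have "P (q.q f)" using R.cring_axioms f(1)
  proof (induction rule: free_module_induct)
    case zero
    then show ?case using assms(2) by (simp add: tensor_power_def q.quotient_zero free_module_simps(1))
  next
    case (scaled_basis c s)
    then have s: "set s \<subseteq> carrier M" "length s = k" by (auto simp: words_def)
    then show ?case using pure[of c s] word_basis_carrier[OF s] scaled_basis(1)
      by (simp add: tensor_power_def pure_tensor_def q.quotient_smult)
  next
    case (add f g)
    then show ?case using assms(4)[of "q.q f" "q.q g"]
      by (simp add: tensor_power_def q.quotient_add q.quotient_carrier)
  qed
  then show ?thesis using f by simp
qed

text \<open>As \<open>k \<ge> 1\<close>, a scalar is absorbed by the first letter, and the zero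
  tensor is 0 times the pure tensor of a word of zeros. Pure tensors thus generate the tensor power
  additively.\<close>

lemma tensor_power_additive_induct [consumes 2, case_names pure add]:
  assumes "U \<in> carrier (TP k)" "k \<ge> 1"
    and pure: "\<And>w. set w \<subseteq> carrier M \<Longrightarrow> length w = k \<Longrightarrow> P (pt w)"
    and add: "\<And>U V. U \<in> carrier (TP k) \<Longrightarrow> V \<in> carrier (TP k) \<Longrightarrow> P U \<Longrightarrow> P V \<Longrightarrow> P (U \<oplus>\<^bsub>TP k\<^esub> V)"
  shows "P U"
proof -
  interpret T: module R "TP k" by (rule tensor_power_module)
  have scaled: "P (c \<odot>\<^bsub>TP k\<^esub> pt w)"
    if "c \<in> carrier R" "set w \<subseteq> carrier M" "length w = k" for c w
  proof -
    have "w \<noteq> []" using that(3) assms(2) by auto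
    then obtain a v where w: "w = a # v" by (cases w) auto
    then have "pt ([] @ [c \<odot>\<^bsub>M\<^esub> a] @ v) = c \<odot>\<^bsub>TP k\<^esub> pt ([] @ [a] @ v)"
      using that by (intro multilinear_wordsD(3)[OF pure_tensor_multilinear]) auto
    then show ?thesis using pure[of "(c \<odot>\<^bsub>M\<^esub> a) # v"] that w by simp
  qed
  have "P \<zero>\<^bsub>TP k\<^esub>"
    using scaled[of "\<zero>\<^bsub>R\<^esub>" "replicate k \<zero>\<^bsub>M\<^esub>"] pure_tensor_carrier[of "replicate k \<zero>\<^bsub>M\<^esub>" k]
    by (auto simp: set_replicate_conv_if)
  note zero = this
  from assms(1) show ?thesis
  proof (induction rule: tensor_power_induct)
    case (scaled_pure c w)
    then show ?case by (rule scaled)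
  next
    case (add U V)
    then show ?case by (rule assms(4))
  qed (rule zero)
qed

lemma tensor_lift_linear:
  assumes W: "module R W" and \<mu>: "multilinear_words R M k W \<mu>"
  shows "tensor_lift R W \<mu> \<in> linear_maps R (TP k) W"
    and "\<And>w. set w \<subseteq> carrier M \<Longrightarrow> length w = k \<Longrightarrow> tensor_lift R W \<mu> (pt w) = \<mu> w"
proof -
  interpret q: submodule_quotient R "Fr k" "rel k" by (rule tensor_power_quotient)
  interpret W: module R W by fact
  note [simp del] = free_module_simps
  let ?f = "free_lift R W \<mu>"
  have \<mu>': "\<mu> \<in> words M k \<rightarrow> carrier W" using \<mu> by (simp add: multilinear_words_def)
  note lin = free_lift_linear[OF W \<mu>']
  have basis: "?f (basis_vector R w) = \<mu> w" if "set w \<subseteq> carrier M" "length w = k" for w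
    using that by (intro free_lift_basis[OF W \<mu>']) (auto simp: words_def)
  note \<mu>D = multilinear_wordsD[OF \<mu>]
  \<comment> \<open>Written as the preimage of the zero submodule, the kernel is a submodule, so it
    contains all relations once it contains the relators; these vanish by multilinearity.\<close>
  have "rel k \<subseteq> {x \<in> carrier (Fr k). ?f x \<in> {\<zero>\<^bsub>W\<^esub>}}"
  proof (rule tensor_relations_subsetI)
    show "submodule {x \<in> carrier (Fr k). ?f x \<in> {\<zero>\<^bsub>W\<^esub>}} R (Fr k)"
      by (intro submodule_vimage[OF q.module_axioms W lin] W.submodule_singleton_zero)
  next
    fix u v a b assume uv: "set u \<subseteq> carrier M" "set v \<subseteq> carrier M" "length u + 1 + length v = k"
      and ab: "a \<in> carrier M" "b \<in> carrier M"
    let ?x = "basis_vector R (u @ [a \<oplus>\<^bsub>M\<^esub> b] @ v)" and ?y = "basis_vector R (u @ [a] @ v)"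
      and ?z = "basis_vector R (u @ [b] @ v)"
    have c: "?x \<in> carrier (Fr k)" "?y \<in> carrier (Fr k)" "?z \<in> carrier (Fr k)"
      using uv ab by (auto intro!: word_basis_carrier)
    have "?f (?x \<ominus>\<^bsub>Fr k\<^esub> (?y \<oplus>\<^bsub>Fr k\<^esub> ?z)) = ?f ?x \<ominus>\<^bsub>W\<^esub> (?f ?y \<oplus>\<^bsub>W\<^esub> ?f ?z)"
      using c by (simp add: linear_maps_diff[OF q.module_axioms W lin] linear_mapsD[OF lin])
    also have "\<dots> = \<zero>\<^bsub>W\<^esub>"
      using uv ab \<mu>D(2)[OF uv ab] linear_mapsD(1)[OF lin] c W.M.diff_eq_zero_iff[of "?f ?x" "?f ?x"] basis
        W.M.a_closed[OF \<mu>D(1) \<mu>D(1), of "u @ [a] @ v" "u @ [b] @ v"]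
      by simp
    finally show "?x \<ominus>\<^bsub>Fr k\<^esub> (?y \<oplus>\<^bsub>Fr k\<^esub> ?z) \<in> {x \<in> carrier (Fr k). ?f x \<in> {\<zero>\<^bsub>W\<^esub>}}"
      using c by simp
  next
    fix u v c a assume uv: "set u \<subseteq> carrier M" "set v \<subseteq> carrier M" "length u + 1 + length v = k"
      and ca: "c \<in> carrier R" "a \<in> carrier M"
    let ?x = "basis_vector R (u @ [c \<odot>\<^bsub>M\<^esub> a] @ v)" and ?y = "basis_vector R (u @ [a] @ v)"
    have c: "?x \<in> carrier (Fr k)" "?y \<in> carrier (Fr k)"
      using uv ca by (auto intro!: word_basis_carrier)
    have "?f (?x \<ominus>\<^bsub>Fr k\<^esub> (c \<odot>\<^bsub>Fr k\<^esub> ?y)) = ?f ?x \<ominus>\<^bsub>W\<^esub> (c \<odot>\<^bsub>W\<^esub> ?f ?y)"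
      using c ca by (simp add: linear_maps_diff[OF q.module_axioms W lin] linear_mapsD[OF lin])
    also have "\<dots> = \<zero>\<^bsub>W\<^esub>"
      using uv ca \<mu>D(3)[OF uv ca] linear_mapsD(1)[OF lin] c W.M.diff_eq_zero_iff[of "?f ?x" "?f ?x"] basis
        W.smult_closed[OF ca(1) \<mu>D(1), of "u @ [a] @ v"]
      by simp
    finally show "?x \<ominus>\<^bsub>Fr k\<^esub> (c \<odot>\<^bsub>Fr k\<^esub> ?y) \<in> {x \<in> carrier (Fr k). ?f x \<in> {\<zero>\<^bsub>W\<^esub>}}"
      using c ca by simp
  qed
  then have ker: "?f x = \<zero>\<^bsub>W\<^esub>" if "x \<in> rel k" for x using that by auto
  \<comment> \<open>The witness is the very representative that \<open>tensor_lift\<close>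
    chooses.\<close>
  have ex: "\<exists>y\<in>q.q x. tensor_lift R W \<mu> (q.q x) = ?f y" if "x \<in> carrier (Fr k)" for x
    by (rule bexI[of _ "SOME f. f \<in> q.q x"])
      (use someI[of "\<lambda>f. f \<in> q.q x", OF q.N.a_rcos_self[OF that]]
       in \<open>auto simp: tensor_lift_def Let_def free_lift_def\<close>)
  have lift: "tensor_lift R W \<mu> \<in> linear_maps R (quotient_module (Fr k) (rel k)) W"
      "\<And>x. x \<in> carrier (Fr k) \<Longrightarrow> tensor_lift R W \<mu> (q.q x) = ?f x"
    by (rule q.quotient_lift_linear[OF W lin]; use ker ex in blast)+
  show "tensor_lift R W \<mu> \<in> linear_maps R (TP k) W"
    using lift(1) by (simp add: tensor_power_def)
  show "tensor_lift R W \<mu> (pt w) = \<mu> w" if "set w \<subseteq> carrier M" "length w = k" for w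
    using lift(2)[OF word_basis_carrier[OF that]] basis[OF that] that by (simp add: pure_tensor_def)
qed

lemma tensor_power_linear_eqI:
  assumes W: "module R W" and f: "f \<in> linear_maps R (TP k) W" and g: "g \<in> linear_maps R (TP k) W"
    and pure: "\<And>w. set w \<subseteq> carrier M \<Longrightarrow> length w = k \<Longrightarrow> f (pt w) = g (pt w)"
    and "U \<in> carrier (TP k)"
  shows "f U = g U"
  using assms(5)
  by (induction rule: tensor_power_induct)
    (auto simp: linear_mapsD[OF f] linear_mapsD[OF g] pure pure_tensor_carrier
      linear_maps_zero[OF tensor_power_module W f] linear_maps_zero[OF tensor_power_module W g])

end


section \<open>Concatenation of tensors\<close>

definition free_concat ::
  "('k, 'x) ring_scheme \<Rightarrow> nat \<Rightarrow> ('a list \<Rightarrow> 'k) \<Rightarrow> ('a list \<Rightarrow> 'k) \<Rightarrow> 'a list \<Rightarrow> 'k" where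
  "free_concat K i x y = (\<lambda>w. x (take i w) \<otimes>\<^bsub>K\<^esub> y (drop i w))"

lemma (in cring) free_concat_basis:
  assumes "length u = i"
  shows "free_concat R i (basis_vector R u) (basis_vector R v) = basis_vector R (u @ v)"
proof
  fix w
  have "take i w = u \<and> drop i w = v \<longleftrightarrow> w = u @ v" using assms by (metis append_eq_conv_conj)
  then show "free_concat R i (basis_vector R u) (basis_vector R v) w = basis_vector R (u @ v) w"
    by (auto simp: free_concat_def basis_vector_def)
qed

context tensor_module
begin

lemma free_concat_carrier:
  assumes x: "x \<in> carrier (Fr i)" and y: "y \<in> carrier (Fr j)"
  shows "free_concat R i x y \<in> carrier (Fr (i + j))"
proof (rule free_module_carrierI)
  note x' = free_module_carrierD[OF x] and y' = free_module_carrierD[OF y]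
  let ?B = "(\<lambda>(u, v). u @ v) ` ({u. x u \<noteq> \<zero>\<^bsub>R\<^esub>} \<times> {v. y v \<noteq> \<zero>\<^bsub>R\<^esub>})"
  show "finite ?B" using x' y' by auto
  show "?B \<subseteq> words M (i + j)" using x'(3) y'(3) by (fastforce simp: words_def subset_eq)
  show "free_concat R i x y w \<in> carrier R" for w using x' y' by (simp add: free_concat_def)
  show "free_concat R i x y w = \<zero>\<^bsub>R\<^esub>" if "w \<notin> ?B" for w
  proof (rule ccontr)
    assume *: "free_concat R i x y w \<noteq> \<zero>\<^bsub>R\<^esub>"
    then have "x (take i w) \<noteq> \<zero>\<^bsub>R\<^esub>" "y (drop i w) \<noteq> \<zero>\<^bsub>R\<^esub>"
      using x' y' by (auto simp: free_concat_def)
    then have "w \<in> ?B" by (intro image_eqI[of _ _ "(take i w, drop i w)"]) auto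
    then show False using that by contradiction
  qed
qed

lemma free_concat_linear_left:
  assumes y: "y \<in> carrier (Fr j)"
  shows "(\<lambda>x. free_concat R i x y) \<in> linear_maps R (Fr i) (Fr (i + j))"
proof -
  have val: "z w \<in> carrier R" if "z \<in> carrier (Fr k)" for z w k
    using free_module_carrierD(1)[OF that] .
  show ?thesis
    by (rule linear_mapsI)
      (auto simp: free_concat_def R.l_distr R.m_assoc val[of _ i] val[of _ j] fun_eq_iff y
        intro!: free_concat_carrier[OF _ y, unfolded free_concat_def])
qed

lemma free_concat_linear_right:
  assumes x: "x \<in> carrier (Fr i)"
  shows "free_concat R i x \<in> linear_maps R (Fr j) (Fr (i + j))"
proof -
  have val: "z w \<in> carrier R" if "z \<in> carrier (Fr k)" for z w k
    using free_module_carrierD(1)[OF that] .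
  show ?thesis
    by (rule linear_mapsI)
      (auto simp: free_concat_def R.r_distr R.m_lcomm val[of _ i] val[of _ j] fun_eq_iff x
        intro!: free_concat_carrier[OF x, unfolded free_concat_def])
qed

text \<open>The two arguments are reduced separately. Appending a basis word \<open>w\<close> turns
  a relator into the relator with \<open>v @ w\<close> in place of \<open>v\<close>. A general
  \<open>y\<close> follows, since the right arguments that send a fixed \<open>x\<close> into the
  relations form a submodule.\<close>

lemma free_concat_relation_left:
  assumes x: "x \<in> rel i" and y: "y \<in> carrier (Fr j)"
  shows "free_concat R i x y \<in> rel (i + j)"
proof -
  interpret q: submodule_quotient R "Fr k" "rel k" for k by (rule tensor_power_quotient)
  note [simp del] = free_module_simps
  have basis: "rel i \<subseteq> {x \<in> carrier (Fr i). free_concat R i x (basis_vector R w) \<in> rel (i + j)}"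
    if w: "set w \<subseteq> carrier M" "length w = j" for w
  proof (rule tensor_relations_subsetI)
    note e = word_basis_carrier[OF w]
    note lin = free_concat_linear_left[OF e, of i]
    show "submodule {x \<in> carrier (Fr i). free_concat R i x (basis_vector R w) \<in> rel (i + j)} R (Fr i)"
      by (rule submodule_vimage[OF Fr_module Fr_module lin q.N])
    {
      fix u v a b assume uv: "set u \<subseteq> carrier M" "set v \<subseteq> carrier M" "length u + 1 + length v = i"
        and ab: "a \<in> carrier M" "b \<in> carrier M"
      have c: "basis_vector R (u @ [a \<oplus>\<^bsub>M\<^esub> b] @ v) \<in> carrier (Fr i)"
        "basis_vector R (u @ [a] @ v) \<in> carrier (Fr i)" "basis_vector R (u @ [b] @ v) \<in> carrier (Fr i)"
        using uv ab by (auto intro!: word_basis_carrier)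
      show "basis_vector R (u @ [a \<oplus>\<^bsub>M\<^esub> b] @ v) \<ominus>\<^bsub>Fr i\<^esub>
         (basis_vector R (u @ [a] @ v) \<oplus>\<^bsub>Fr i\<^esub> basis_vector R (u @ [b] @ v))
         \<in> {x \<in> carrier (Fr i). free_concat R i x (basis_vector R w) \<in> rel (i + j)}"
        using c uv ab w tensor_relations_add[of u "v @ w" "i + j" a b]
        by (auto simp: linear_maps_diff[OF Fr_module Fr_module lin] linear_mapsD[OF lin]
          R.free_concat_basis)
    }
    {
      fix u v c a assume uv: "set u \<subseteq> carrier M" "set v \<subseteq> carrier M" "length u + 1 + length v = i"
        and ca: "c \<in> carrier R" "a \<in> carrier M"
      have c: "basis_vector R (u @ [c \<odot>\<^bsub>M\<^esub> a] @ v) \<in> carrier (Fr i)"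
        "basis_vector R (u @ [a] @ v) \<in> carrier (Fr i)"
        using uv ca by (auto intro!: word_basis_carrier)
      show "basis_vector R (u @ [c \<odot>\<^bsub>M\<^esub> a] @ v) \<ominus>\<^bsub>Fr i\<^esub> (c \<odot>\<^bsub>Fr i\<^esub> basis_vector R (u @ [a] @ v))
         \<in> {x \<in> carrier (Fr i). free_concat R i x (basis_vector R w) \<in> rel (i + j)}"
        using c uv ca w tensor_relations_smult[of u "v @ w" "i + j" c a]
        by (auto simp: linear_maps_diff[OF Fr_module Fr_module lin] linear_mapsD[OF lin]
          R.free_concat_basis)
    }
  qed
  have x': "x \<in> carrier (Fr i)" using x q.submoduleE(1)[OF q.N] by blast
  have "y \<in> {y \<in> carrier (Fr j). free_concat R i x y \<in> rel (i + j)}"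
  proof (rule free_module_submodule_eqI[OF R.cring_axioms _ _ y])
    show "submodule {y \<in> carrier (Fr j). free_concat R i x y \<in> rel (i + j)} R (Fr j)"
      by (rule submodule_vimage[OF Fr_module Fr_module free_concat_linear_right[OF x'] q.N])
    show "basis_vector R w \<in> {y \<in> carrier (Fr j). free_concat R i x y \<in> rel (i + j)}"
      if "w \<in> words M j" for w
      using that basis[of w] x word_basis_carrier[of w j] by (auto simp: words_def)
  qed
  then show ?thesis by simp
qed

text \<open>The mirror image of the preceding argument: a basis word as left factor lengthens the
  prefix of a relator from \<open>u\<close> to \<open>w @ u\<close>.\<close>

lemma free_concat_relation_right:
  assumes x: "x \<in> carrier (Fr i)" and y: "y \<in> rel j"
  shows "free_concat R i x y \<in> rel (i + j)"
proof -
  interpret q: submodule_quotient R "Fr k" "rel k" for k by (rule tensor_power_quotient)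
  note [simp del] = free_module_simps
  have basis: "rel j \<subseteq> {y \<in> carrier (Fr j). free_concat R i (basis_vector R w) y \<in> rel (i + j)}"
    if w: "set w \<subseteq> carrier M" "length w = i" for w
  proof (rule tensor_relations_subsetI)
    note e = word_basis_carrier[OF w]
    note lin = free_concat_linear_right[OF e, of j]
    show "submodule {y \<in> carrier (Fr j). free_concat R i (basis_vector R w) y \<in> rel (i + j)} R (Fr j)"
      by (rule submodule_vimage[OF Fr_module Fr_module lin q.N])
    {
      fix u v a b assume uv: "set u \<subseteq> carrier M" "set v \<subseteq> carrier M" "length u + 1 + length v = j"
        and ab: "a \<in> carrier M" "b \<in> carrier M"
      have c: "basis_vector R (u @ [a \<oplus>\<^bsub>M\<^esub> b] @ v) \<in> carrier (Fr j)"
        "basis_vector R (u @ [a] @ v) \<in> carrier (Fr j)" "basis_vector R (u @ [b] @ v) \<in> carrier (Fr j)"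
        using uv ab by (auto intro!: word_basis_carrier)
      show "basis_vector R (u @ [a \<oplus>\<^bsub>M\<^esub> b] @ v) \<ominus>\<^bsub>Fr j\<^esub>
         (basis_vector R (u @ [a] @ v) \<oplus>\<^bsub>Fr j\<^esub> basis_vector R (u @ [b] @ v))
         \<in> {y \<in> carrier (Fr j). free_concat R i (basis_vector R w) y \<in> rel (i + j)}"
        using c uv ab w tensor_relations_add[of "w @ u" v "i + j" a b]
        by (auto simp: linear_maps_diff[OF Fr_module Fr_module lin] linear_mapsD[OF lin]
          R.free_concat_basis)
    }
    {
      fix u v c a assume uv: "set u \<subseteq> carrier M" "set v \<subseteq> carrier M" "length u + 1 + length v = j"
        and ca: "c \<in> carrier R" "a \<in> carrier M"
      have c: "basis_vector R (u @ [c \<odot>\<^bsub>M\<^esub> a] @ v) \<in> carrier (Fr j)"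
        "basis_vector R (u @ [a] @ v) \<in> carrier (Fr j)"
        using uv ca by (auto intro!: word_basis_carrier)
      show "basis_vector R (u @ [c \<odot>\<^bsub>M\<^esub> a] @ v) \<ominus>\<^bsub>Fr j\<^esub> (c \<odot>\<^bsub>Fr j\<^esub> basis_vector R (u @ [a] @ v))
         \<in> {y \<in> carrier (Fr j). free_concat R i (basis_vector R w) y \<in> rel (i + j)}"
        using c uv ca w tensor_relations_smult[of "w @ u" v "i + j" c a]
        by (auto simp: linear_maps_diff[OF Fr_module Fr_module lin] linear_mapsD[OF lin]
          R.free_concat_basis)
    }
  qed
  have y': "y \<in> carrier (Fr j)" using y q.submoduleE(1)[OF q.N] by blast
  have "x \<in> {x \<in> carrier (Fr i). free_concat R i x y \<in> rel (i + j)}"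
  proof (rule free_module_submodule_eqI[OF R.cring_axioms _ _ x])
    show "submodule {x \<in> carrier (Fr i). free_concat R i x y \<in> rel (i + j)} R (Fr i)"
      by (rule submodule_vimage[OF Fr_module Fr_module free_concat_linear_left[OF y'] q.N])
    show "basis_vector R w \<in> {x \<in> carrier (Fr i). free_concat R i x y \<in> rel (i + j)}"
      if "w \<in> words M i" for w
      using that basis[of w] y word_basis_carrier[of w i] by (auto simp: words_def)
  qed
  then show ?thesis by simp
qed

text \<open>The definition is a union over all pairs of representatives. It collapses to one coset
  because replacing one representative at a time changes the concatenation by a relation.\<close>

lemma tensor_concat_class:
  assumes x: "x \<in> carrier (Fr i)" and y: "y \<in> carrier (Fr j)"
  shows "tensor_concat R M i j (rel i +>\<^bsub>Fr i\<^esub> x) (rel j +>\<^bsub>Fr j\<^esub> y) =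
    rel (i + j) +>\<^bsub>Fr (i + j)\<^esub> free_concat R i x y"
proof -
  interpret q: submodule_quotient R "Fr k" "rel k" for k by (rule tensor_power_quotient)
  let ?c = "\<lambda>x y. rel (i + j) +>\<^bsub>Fr (i + j)\<^esub> free_concat R i x y"
  have eq: "?c x' y' = ?c x y" if "x' \<in> rel i +>\<^bsub>Fr i\<^esub> x" "y' \<in> rel j +>\<^bsub>Fr j\<^esub> y" for x' y'
  proof -
    note x' = q.mem_quotient_class[OF x that(1)] and y' = q.mem_quotient_class[OF y that(2)]
    have "free_concat R i (x' \<ominus>\<^bsub>Fr i\<^esub> x) y' \<in> rel (i + j)"
      "free_concat R i x (y' \<ominus>\<^bsub>Fr j\<^esub> y) \<in> rel (i + j)"
      using x y x' y' q.quotient_eq_iff[of x' i x] q.quotient_eq_iff[of y' j y]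
      by (simp_all add: free_concat_relation_left free_concat_relation_right)
    then have "?c x' y' = ?c x y'" "?c x y' = ?c x y"
      using x y x' y'
      by (auto simp: q.quotient_eq_iff free_concat_carrier
          linear_maps_diff[OF Fr_module Fr_module free_concat_linear_left[OF y'(1)]]
          linear_maps_diff[OF Fr_module Fr_module free_concat_linear_right[OF x]])
    then show ?thesis by simp
  qed
  have "(\<Union>x'\<in>rel i +>\<^bsub>Fr i\<^esub> x. \<Union>y'\<in>rel j +>\<^bsub>Fr j\<^esub> y. ?c x' y') = ?c x y"
    by (intro UN_constant_eq[OF q.N.a_rcos_self[OF x]] UN_constant_eq[OF q.N.a_rcos_self[OF y]]
        ballI eq)
  then show ?thesis by (simp add: tensor_concat_def free_concat_def)
qed

lemma tensor_power_carrier: "carrier (TP k) = (\<lambda>x. rel k +>\<^bsub>Fr k\<^esub> x) ` carrier (Fr k)"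
proof -
  interpret q: submodule_quotient R "Fr k" "rel k" by (rule tensor_power_quotient)
  show ?thesis by (simp add: tensor_power_def q.quotient_carrier)
qed

lemma tensor_class_linear: "(\<lambda>x. rel k +>\<^bsub>Fr k\<^esub> x) \<in> linear_maps R (Fr k) (TP k)"
proof -
  interpret q: submodule_quotient R "Fr k" "rel k" by (rule tensor_power_quotient)
  show ?thesis using q.quotient_map_linear by (simp add: tensor_power_def)
qed

lemma tensor_concat_linear_left:
  assumes "V \<in> carrier (TP j)"
  shows "(\<lambda>U. tensor_concat R M i j U V) \<in> linear_maps R (TP i) (TP (i + j))"
proof -
  interpret F: module R "Fr k" for k by (rule Fr_module)
  note [simp del] = free_module_simps
  note cl = linear_mapsD(2,3)[OF tensor_class_linear, symmetric]
  obtain y where y: "y \<in> carrier (Fr j)" "V = rel j +>\<^bsub>Fr j\<^esub> y"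
    using assms by (auto simp: tensor_power_carrier)
  note lin = linear_mapsD[OF free_concat_linear_left[OF y(1)]]
  show ?thesis
    by (rule linear_mapsI)
      (auto simp: tensor_power_carrier y cl tensor_concat_class lin)
qed

lemma tensor_concat_linear_right:
  assumes "U \<in> carrier (TP i)"
  shows "tensor_concat R M i j U \<in> linear_maps R (TP j) (TP (i + j))"
proof -
  interpret F: module R "Fr k" for k by (rule Fr_module)
  note [simp del] = free_module_simps
  note cl = linear_mapsD(2,3)[OF tensor_class_linear, symmetric]
  obtain x where x: "x \<in> carrier (Fr i)" "U = rel i +>\<^bsub>Fr i\<^esub> x"
    using assms by (auto simp: tensor_power_carrier)
  note lin = linear_mapsD[OF free_concat_linear_right[OF x(1)]]
  show ?thesis
    by (rule linear_mapsI)
      (auto simp: tensor_power_carrier x cl tensor_concat_class lin)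
qed

lemma tensor_concat_pure:
  assumes "set u \<subseteq> carrier M" "set v \<subseteq> carrier M"
  shows "tensor_concat R M (length u) (length v) (pt u) (pt v) = pt (u @ v)"
  using assms
  by (simp add: pure_tensor_def tensor_concat_class word_basis_carrier R.free_concat_basis)

end


section \<open>Direct sums\<close>

locale direct_sum =
  fixes K :: "('k, 'x) ring_scheme" and J :: "'i set" and V :: "'i \<Rightarrow> ('k, 'a, 'y) module_scheme"
  assumes K: "cring K" and V: "\<And>j. j \<in> J \<Longrightarrow> module K (V j)"
begin

abbreviation "D \<equiv> direct_sum_module J V"

lemma direct_sum_carrierI:
  assumes "t \<in> extensional J" "\<And>j. j \<in> J \<Longrightarrow> t j \<in> carrier (V j)"
    and "finite B" "\<And>j. j \<in> J \<Longrightarrow> j \<notin> B \<Longrightarrow> t j = \<zero>\<^bsub>V j\<^esub>"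
  shows "t \<in> carrier D"
proof -
  have "{j \<in> J. t j \<noteq> \<zero>\<^bsub>V j\<^esub>} \<subseteq> B" using assms by blast
  then show ?thesis
    using assms by (auto simp: direct_sum_module_def PiE_def intro: finite_subset)
qed

lemma direct_sum_carrierD:
  assumes "t \<in> carrier D"
  shows "t \<in> extensional J" "\<And>j. j \<in> J \<Longrightarrow> t j \<in> carrier (V j)" "finite {j \<in> J. t j \<noteq> \<zero>\<^bsub>V j\<^esub>}"
  using assms by (auto simp: direct_sum_module_def PiE_def)

lemma direct_sum_ops:
  "\<zero>\<^bsub>D\<^esub> = (\<lambda>j\<in>J. \<zero>\<^bsub>V j\<^esub>)" "s \<oplus>\<^bsub>D\<^esub> t = (\<lambda>j\<in>J. s j \<oplus>\<^bsub>V j\<^esub> t j)"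
  "c \<odot>\<^bsub>D\<^esub> t = (\<lambda>j\<in>J. c \<odot>\<^bsub>V j\<^esub> t j)"
  by (simp_all add: direct_sum_module_def)

text \<open>The summands are known to be modules only for indices in \<open>J\<close>, so the laws
  are extracted here under \<open>j \<in> J\<close>, in a form that the simplifier can apply to
  components.\<close>

lemma module_ops:
  assumes "j \<in> J"
  shows "\<zero>\<^bsub>V j\<^esub> \<in> carrier (V j)"
    "\<And>x y. x \<in> carrier (V j) \<Longrightarrow> y \<in> carrier (V j) \<Longrightarrow> x \<oplus>\<^bsub>V j\<^esub> y \<in> carrier (V j)"
    "\<And>c x. c \<in> carrier K \<Longrightarrow> x \<in> carrier (V j) \<Longrightarrow> c \<odot>\<^bsub>V j\<^esub> x \<in> carrier (V j)"
    "\<And>x. x \<in> carrier (V j) \<Longrightarrow> x \<oplus>\<^bsub>V j\<^esub> \<zero>\<^bsub>V j\<^esub> = x"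
    "\<And>x. x \<in> carrier (V j) \<Longrightarrow> \<zero>\<^bsub>V j\<^esub> \<oplus>\<^bsub>V j\<^esub> x = x"
    "\<And>c. c \<in> carrier K \<Longrightarrow> c \<odot>\<^bsub>V j\<^esub> \<zero>\<^bsub>V j\<^esub> = \<zero>\<^bsub>V j\<^esub>"
proof -
  interpret module K "V j" using V assms .
  show "\<zero>\<^bsub>V j\<^esub> \<in> carrier (V j)"
    "\<And>x y. x \<in> carrier (V j) \<Longrightarrow> y \<in> carrier (V j) \<Longrightarrow> x \<oplus>\<^bsub>V j\<^esub> y \<in> carrier (V j)"
    "\<And>c x. c \<in> carrier K \<Longrightarrow> x \<in> carrier (V j) \<Longrightarrow> c \<odot>\<^bsub>V j\<^esub> x \<in> carrier (V j)"
    "\<And>x. x \<in> carrier (V j) \<Longrightarrow> x \<oplus>\<^bsub>V j\<^esub> \<zero>\<^bsub>V j\<^esub> = x"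
    "\<And>x. x \<in> carrier (V j) \<Longrightarrow> \<zero>\<^bsub>V j\<^esub> \<oplus>\<^bsub>V j\<^esub> x = x"
    "\<And>c. c \<in> carrier K \<Longrightarrow> c \<odot>\<^bsub>V j\<^esub> \<zero>\<^bsub>V j\<^esub> = \<zero>\<^bsub>V j\<^esub>"
    by auto
qed

lemma direct_sum_add_carrier:
  assumes "s \<in> carrier D" "t \<in> carrier D"
  shows "s \<oplus>\<^bsub>D\<^esub> t \<in> carrier D"
  using direct_sum_carrierD[OF assms(1)] direct_sum_carrierD[OF assms(2)]
  by (intro direct_sum_carrierI[where B = "{j \<in> J. s j \<noteq> \<zero>\<^bsub>V j\<^esub>} \<union> {j \<in> J. t j \<noteq> \<zero>\<^bsub>V j\<^esub>}"])
    (auto simp: direct_sum_ops module_ops)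

lemma direct_sum_smult_carrier:
  assumes "c \<in> carrier K" "t \<in> carrier D"
  shows "c \<odot>\<^bsub>D\<^esub> t \<in> carrier D"
  using direct_sum_carrierD[OF assms(2)] assms(1)
  by (intro direct_sum_carrierI[where B = "{j \<in> J. t j \<noteq> \<zero>\<^bsub>V j\<^esub>}"])
    (auto simp: direct_sum_ops module_ops)

lemma direct_sum_is_module: "module K D"
proof -
  interpret K: cring K by (rule K)
  note [simp] = direct_sum_carrierD(2) module_ops
  have eqI: "s = t" if "s \<in> extensional J" "t \<in> extensional J" "\<And>j. j \<in> J \<Longrightarrow> s j = t j" for s t :: "'i \<Rightarrow> 'a"
    using that by (intro extensionalityI[of s J t])
  show ?thesis
  proof (rule moduleI)
    show "abelian_group D"
    proof (rule abelian_groupI)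
      show "\<zero>\<^bsub>D\<^esub> \<in> carrier D"
        by (rule direct_sum_carrierI[where B = "{}"]) (auto simp: direct_sum_ops)
    next
      fix x y z assume x: "x \<in> carrier D" "y \<in> carrier D" "z \<in> carrier D"
      show "x \<oplus>\<^bsub>D\<^esub> y \<oplus>\<^bsub>D\<^esub> z = x \<oplus>\<^bsub>D\<^esub> (y \<oplus>\<^bsub>D\<^esub> z)"
      proof (rule eqI)
        fix j assume j: "j \<in> J"
        interpret module K "V j" using V[OF j] .
        show "(x \<oplus>\<^bsub>D\<^esub> y \<oplus>\<^bsub>D\<^esub> z) j = (x \<oplus>\<^bsub>D\<^esub> (y \<oplus>\<^bsub>D\<^esub> z)) j"
          using x j by (simp add: direct_sum_ops M.a_assoc)
      qed (auto simp: direct_sum_ops)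
      show "x \<oplus>\<^bsub>D\<^esub> y = y \<oplus>\<^bsub>D\<^esub> x"
      proof (rule eqI)
        fix j assume j: "j \<in> J"
        interpret module K "V j" using V[OF j] .
        show "(x \<oplus>\<^bsub>D\<^esub> y) j = (y \<oplus>\<^bsub>D\<^esub> x) j"
          using x j by (simp add: direct_sum_ops M.a_comm)
      qed (auto simp: direct_sum_ops)
    next
      fix x assume x: "x \<in> carrier D"
      show "\<zero>\<^bsub>D\<^esub> \<oplus>\<^bsub>D\<^esub> x = x"
        using x direct_sum_carrierD(1)[OF x] by (intro eqI) (auto simp: direct_sum_ops)
      show "\<exists>y\<in>carrier D. y \<oplus>\<^bsub>D\<^esub> x = \<zero>\<^bsub>D\<^esub>"
      proof (intro bexI[of _ "(\<ominus>\<^bsub>K\<^esub> \<one>\<^bsub>K\<^esub>) \<odot>\<^bsub>D\<^esub> x"] eqI)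
        fix j assume j: "j \<in> J"
        interpret module K "V j" using V[OF j] .
        have "x j \<in> carrier (V j)" using x j by simp
        then show "((\<ominus>\<^bsub>K\<^esub> \<one>\<^bsub>K\<^esub>) \<odot>\<^bsub>D\<^esub> x \<oplus>\<^bsub>D\<^esub> x) j = \<zero>\<^bsub>D\<^esub> j"
          using j by (simp add: direct_sum_ops smult_l_minus M.l_neg)
      qed (use x in \<open>auto simp: direct_sum_ops intro!: direct_sum_smult_carrier[unfolded direct_sum_ops]\<close>)
    qed (rule direct_sum_add_carrier)
  next
    fix a b x y assume a: "a \<in> carrier K" "b \<in> carrier K" and x: "x \<in> carrier D" "y \<in> carrier D"
    show "(a \<oplus>\<^bsub>K\<^esub> b) \<odot>\<^bsub>D\<^esub> x = a \<odot>\<^bsub>D\<^esub> x \<oplus>\<^bsub>D\<^esub> b \<odot>\<^bsub>D\<^esub> x"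
      using a x module.smult_l_distr[OF V] by (intro eqI) (auto simp: direct_sum_ops)
    show "a \<odot>\<^bsub>D\<^esub> (x \<oplus>\<^bsub>D\<^esub> y) = a \<odot>\<^bsub>D\<^esub> x \<oplus>\<^bsub>D\<^esub> a \<odot>\<^bsub>D\<^esub> y"
      using a x module.smult_r_distr[OF V] by (intro eqI) (auto simp: direct_sum_ops)
    show "(a \<otimes>\<^bsub>K\<^esub> b) \<odot>\<^bsub>D\<^esub> x = a \<odot>\<^bsub>D\<^esub> (b \<odot>\<^bsub>D\<^esub> x)"
      using a x module.smult_assoc1[OF V] by (intro eqI) (auto simp: direct_sum_ops)
  next
    fix x assume x: "x \<in> carrier D"
    show "\<one>\<^bsub>K\<^esub> \<odot>\<^bsub>D\<^esub> x = x"
      using x direct_sum_carrierD(1)[OF x] module.smult_one[OF V]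
      by (intro eqI) (auto simp: direct_sum_ops)
  qed (auto simp: K intro: direct_sum_smult_carrier)
qed

definition direct_sum_lift :: "('k, 'b, 'z) module_scheme \<Rightarrow> ('i \<Rightarrow> 'a \<Rightarrow> 'b) \<Rightarrow> ('i \<Rightarrow> 'a) \<Rightarrow> 'b" where
  "direct_sum_lift W L t = (\<Oplus>\<^bsub>W\<^esub>j\<in>{j \<in> J. t j \<noteq> \<zero>\<^bsub>V j\<^esub>}. L j (t j))"

lemma direct_sum_lift_superset:
  assumes W: "module K W" and L: "\<And>j. j \<in> J \<Longrightarrow> L j \<in> linear_maps K (V j) W"
    and "t \<in> carrier D" "finite B" "B \<subseteq> J" "{j \<in> J. t j \<noteq> \<zero>\<^bsub>V j\<^esub>} \<subseteq> B"
  shows "direct_sum_lift W L t = (\<Oplus>\<^bsub>W\<^esub>j\<in>B. L j (t j))"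
proof -
  interpret W: module K W by fact
  have carr: "L j (t j) \<in> carrier W" if "j \<in> B" for j
    using that assms linear_mapsD(1)[OF L] direct_sum_carrierD(2)[OF assms(3)] by blast
  show ?thesis unfolding direct_sum_lift_def
  proof (rule W.add.finprod_mono_neutral_cong_left)
    fix i assume "i \<in> B - {j \<in> J. t j \<noteq> \<zero>\<^bsub>V j\<^esub>}"
    then show "L i (t i) = \<zero>\<^bsub>W\<^esub>" using assms(5) linear_maps_zero[OF V W L] by auto
  qed (use assms carr in auto)
qed

lemma direct_sum_lift_linear:
  assumes W: "module K W" and L: "\<And>j. j \<in> J \<Longrightarrow> L j \<in> linear_maps K (V j) W"
  shows "direct_sum_lift W L \<in> linear_maps K D W"
proof -
  interpret W: module K W by fact
  interpret D: module K D by (rule direct_sum_is_module)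
  have carr: "L j (t j) \<in> carrier W" if "t \<in> carrier D" "j \<in> J" for t j
    using that linear_mapsD(1)[OF L] direct_sum_carrierD(2) by blast
  note lift = direct_sum_lift_superset[OF W L]
  show ?thesis
  proof (rule linear_mapsI)
    fix t assume t: "t \<in> carrier D"
    show "direct_sum_lift W L t \<in> carrier W"
      unfolding direct_sum_lift_def by (intro W.M.finsum_closed) (use carr t in auto)
  next
    fix s t assume s: "s \<in> carrier D" and t: "t \<in> carrier D"
    let ?B = "{j \<in> J. s j \<noteq> \<zero>\<^bsub>V j\<^esub>} \<union> {j \<in> J. t j \<noteq> \<zero>\<^bsub>V j\<^esub>}"
    have B: "finite ?B" "?B \<subseteq> J"
      using direct_sum_carrierD(3)[OF s] direct_sum_carrierD(3)[OF t] by auto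
    have "direct_sum_lift W L (s \<oplus>\<^bsub>D\<^esub> t) = (\<Oplus>\<^bsub>W\<^esub>j\<in>?B. L j ((s \<oplus>\<^bsub>D\<^esub> t) j))"
      by (rule lift[OF _ D.a_closed[OF s t]]) (use B in \<open>auto simp: direct_sum_ops(2) module_ops\<close>)
    also have "\<dots> = (\<Oplus>\<^bsub>W\<^esub>j\<in>?B. L j (s j) \<oplus>\<^bsub>W\<^esub> L j (t j))"
      by (rule W.M.finsum_cong')
        (use s t carr direct_sum_carrierD(2) in
          \<open>auto simp: direct_sum_ops(2) linear_mapsD(2)[OF L] Pi_iff\<close>)
    also have "\<dots> = (\<Oplus>\<^bsub>W\<^esub>j\<in>?B. L j (s j)) \<oplus>\<^bsub>W\<^esub> (\<Oplus>\<^bsub>W\<^esub>j\<in>?B. L j (t j))"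
      by (rule W.M.finsum_addf) (use carr s t in auto)
    also have "(\<Oplus>\<^bsub>W\<^esub>j\<in>?B. L j (s j)) = direct_sum_lift W L s"
      by (rule lift[symmetric]) (use B s in auto)
    also have "(\<Oplus>\<^bsub>W\<^esub>j\<in>?B. L j (t j)) = direct_sum_lift W L t"
      by (rule lift[symmetric]) (use B t in auto)
    finally show "direct_sum_lift W L (s \<oplus>\<^bsub>D\<^esub> t) = direct_sum_lift W L s \<oplus>\<^bsub>W\<^esub> direct_sum_lift W L t" .
  next
    fix c t assume c: "c \<in> carrier K" and t: "t \<in> carrier D"
    let ?B = "{j \<in> J. t j \<noteq> \<zero>\<^bsub>V j\<^esub>}"
    have "direct_sum_lift W L (c \<odot>\<^bsub>D\<^esub> t) = (\<Oplus>\<^bsub>W\<^esub>j\<in>?B. L j ((c \<odot>\<^bsub>D\<^esub> t) j))"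
      by (rule lift[OF _ D.smult_closed[OF c t]])
        (use c direct_sum_carrierD(3)[OF t] in \<open>auto simp: direct_sum_ops(3) module_ops\<close>)
    also have "\<dots> = (\<Oplus>\<^bsub>W\<^esub>j\<in>?B. c \<odot>\<^bsub>W\<^esub> L j (t j))"
      by (rule W.M.finsum_cong')
        (use c t carr direct_sum_carrierD(2) in
          \<open>auto simp: direct_sum_ops(3) linear_mapsD(3)[OF L] Pi_iff\<close>)
    also have "\<dots> = c \<odot>\<^bsub>W\<^esub> direct_sum_lift W L t" unfolding direct_sum_lift_def
      by (rule W.finsum_smult_ldistr[symmetric]) (use carr c t direct_sum_carrierD(3)[OF t] in auto)
    finally show "direct_sum_lift W L (c \<odot>\<^bsub>D\<^esub> t) = c \<odot>\<^bsub>W\<^esub> direct_sum_lift W L t" .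
  qed
qed

lemma direct_sum_single_carrier:
  assumes "k \<in> J" "x \<in> carrier (V k)"
  shows "(\<lambda>j\<in>J. if j = k then x else \<zero>\<^bsub>V j\<^esub>) \<in> carrier D"
  by (rule direct_sum_carrierI[where B = "{k}"]) (use assms module_ops(1) in auto)

lemma direct_sum_single_linear:
  assumes "k \<in> J"
  shows "(\<lambda>x. \<lambda>j\<in>J. if j = k then x else \<zero>\<^bsub>V j\<^esub>) \<in> linear_maps K (V k) D"
  by (rule linear_mapsI)
    (use direct_sum_single_carrier[OF assms] in \<open>auto simp: direct_sum_ops module_ops intro!: restrict_ext\<close>)

lemma direct_sum_lift_single:
  assumes W: "module K W" and L: "\<And>j. j \<in> J \<Longrightarrow> L j \<in> linear_maps K (V j) W"
    and "k \<in> J" "x \<in> carrier (V k)"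
  shows "direct_sum_lift W L (\<lambda>j\<in>J. if j = k then x else \<zero>\<^bsub>V j\<^esub>) = L k x"
proof -
  interpret W: module K W by fact
  have "L k x \<in> carrier W" using linear_mapsD(1)[OF L] assms by blast
  moreover have "direct_sum_lift W L (\<lambda>j\<in>J. if j = k then x else \<zero>\<^bsub>V j\<^esub>) =
    (\<Oplus>\<^bsub>W\<^esub>i\<in>{k}. L i ((\<lambda>j\<in>J. if j = k then x else \<zero>\<^bsub>V j\<^esub>) i))"
    by (rule direct_sum_lift_superset[OF W L direct_sum_single_carrier[OF assms(3,4)]])
      (use assms(3) in auto)
  ultimately show ?thesis using assms by simp
qed

text \<open>As for free modules, a finite set containing the support shrinks by one index
  \<open>k\<close>, whose entry is split off as a single summand.\<close>

lemma direct_sum_induct [consumes 1, case_names zero single add]: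
  assumes "t \<in> carrier D" and zero: "P \<zero>\<^bsub>D\<^esub>"
    and single: "\<And>k x. k \<in> J \<Longrightarrow> x \<in> carrier (V k) \<Longrightarrow> P (\<lambda>j\<in>J. if j = k then x else \<zero>\<^bsub>V j\<^esub>)"
    and add: "\<And>s t. s \<in> carrier D \<Longrightarrow> t \<in> carrier D \<Longrightarrow> P s \<Longrightarrow> P t \<Longrightarrow> P (s \<oplus>\<^bsub>D\<^esub> t)"
  shows "P t"
proof -
  have "P t" if "finite B" "t \<in> carrier D" "B \<subseteq> J" "\<And>j. j \<in> J \<Longrightarrow> j \<notin> B \<Longrightarrow> t j = \<zero>\<^bsub>V j\<^esub>" for B t
    using that
  proof (induction B arbitrary: t rule: finite_induct)
    case empty
    then have "t = \<zero>\<^bsub>D\<^esub>"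
      using direct_sum_carrierD(1)[of t] by (auto simp: direct_sum_ops extensional_def fun_eq_iff)
    then show ?case using zero by simp
  next
    case (insert k B)
    note t = direct_sum_carrierD[OF insert.prems(1)]
    have k: "k \<in> J" using insert.prems by auto
    let ?s = "t(k := \<zero>\<^bsub>V k\<^esub>)" and ?u = "\<lambda>j\<in>J. if j = k then t k else \<zero>\<^bsub>V j\<^esub>"
    have s: "?s \<in> carrier D"
      using t k insert.hyps insert.prems module_ops(1)
      by (intro direct_sum_carrierI[where B = B]) (auto simp: extensional_def)
    moreover have "B \<subseteq> J" "\<And>j. j \<in> J \<Longrightarrow> j \<notin> B \<Longrightarrow> ?s j = \<zero>\<^bsub>V j\<^esub>" using insert.prems by auto
    ultimately have "P ?s" by (intro insert.IH)
    moreover have "?u \<in> carrier D" "P ?u" using t(2)[OF k] k direct_sum_single_carrier single by auto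
    ultimately have "P (?s \<oplus>\<^bsub>D\<^esub> ?u)" using s by (intro add)
    also have "?s \<oplus>\<^bsub>D\<^esub> ?u = t"
      using t k module_ops by (auto simp: direct_sum_ops extensional_def fun_eq_iff)
    finally show ?case .
  qed
  from this[OF direct_sum_carrierD(3)[OF assms(1)] assms(1)] show ?thesis by auto
qed

end


section \<open>The tensor algebra\<close>

declare One_nat_def [simp del] \<comment> \<open>so that the index set \<open>{1..}\<close> stays as it is\<close>

lemma length_ge_1: "w \<noteq> [] \<Longrightarrow> 1 \<le> length w"
  by (simp add: Suc_le_eq One_nat_def)

context tensor_module
begin

abbreviation "TA \<equiv> tensor_algebra R M"
abbreviation "inc k \<equiv> tensor_inclusion R M k"
text \<open>The monomial of the word \<open>w\<close>. Degree and product become length and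
  concatenation, so most later computations take place on words. Degrees start at 1, so the words of
  interest are nonempty.\<close>

abbreviation "tau w \<equiv> inc (length w) (pt w)"

lemma tensor_direct_sum: "direct_sum R {1..} TP"
  by (intro direct_sum.intro R.cring_axioms tensor_power_module)

lemma tensor_algebra_simps:
  "carrier TA = carrier (direct_sum_module {1..} TP)"
  "\<zero>\<^bsub>TA\<^esub> = \<zero>\<^bsub>direct_sum_module {1..} TP\<^esub>"
  "s \<oplus>\<^bsub>TA\<^esub> t = s \<oplus>\<^bsub>direct_sum_module {1..} TP\<^esub> t"
  "c \<odot>\<^bsub>TA\<^esub> t = c \<odot>\<^bsub>direct_sum_module {1..} TP\<^esub> t"
  "s \<otimes>\<^bsub>TA\<^esub> t = (\<lambda>k\<in>{1..}. \<Oplus>\<^bsub>TP k\<^esub>i\<in>{1..<k}. tensor_concat R M i (k - i) (s i) (t (k - i)))"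
  by (simp_all add: tensor_algebra_def)

lemma linear_maps_tensor_algebra:
  "linear_maps R TA W = linear_maps R (direct_sum_module {1..} TP) W"
  "linear_maps R W TA = linear_maps R W (direct_sum_module {1..} TP)"
  by (simp_all add: linear_maps_def tensor_algebra_simps)

lemma tensor_algebra_module: "module R TA"
  using direct_sum.direct_sum_is_module[OF tensor_direct_sum]
  by (rule module_image[where f = "\<lambda>x. x"]) (simp_all add: tensor_algebra_simps)

lemma tensor_inclusion_linear: "k \<ge> 1 \<Longrightarrow> inc k \<in> linear_maps R (TP k) TA"
  unfolding linear_maps_tensor_algebra tensor_inclusion_def
  by (rule direct_sum.direct_sum_single_linear[OF tensor_direct_sum]) auto

lemma tau_carrier: "set w \<subseteq> carrier M \<Longrightarrow> w \<noteq> [] \<Longrightarrow> tau w \<in> carrier TA"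
  using linear_mapsD(1)[OF tensor_inclusion_linear] pure_tensor_carrier
  by (metis length_ge_1)

text \<open>No case for zero or for scalars arises, as both are absorbed into words of positive
  length. An additive identity on the tensor algebra need therefore only be checked on
  \<open>tau w\<close>.\<close>

lemma tensor_algebra_induct [consumes 1, case_names tau add]:
  assumes "t \<in> carrier TA"
    and tau: "\<And>w. set w \<subseteq> carrier M \<Longrightarrow> w \<noteq> [] \<Longrightarrow> P (tau w)"
    and add: "\<And>s t. s \<in> carrier TA \<Longrightarrow> t \<in> carrier TA \<Longrightarrow> P s \<Longrightarrow> P t \<Longrightarrow> P (s \<oplus>\<^bsub>TA\<^esub> t)"
  shows "P t"
proof -
  interpret D: direct_sum R "{1..}" TP by (rule tensor_direct_sum)
  have inc: "P (inc k U)" if k: "k \<ge> 1" and U: "U \<in> carrier (TP k)" for k U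
    using U k
  proof (induction rule: tensor_power_additive_induct)
    case (pure w)
    then have "P (tau w)" using k by (intro tau) (auto simp: One_nat_def)
    then show ?case using pure by simp
  next
    case (add U V)
    then show ?case
      using assms(3)[of "inc k U" "inc k V"] linear_mapsD(1,2)[OF tensor_inclusion_linear[OF k]] by simp
  qed
  show ?thesis using assms(1)[unfolded tensor_algebra_simps]
  proof (induction rule: D.direct_sum_induct)
    case zero
    \<comment> \<open>The zero of the sum is the inclusion of the zero of degree 1, which the fact
      \<open>inc\<close> already covers.\<close>
    have "inc 1 \<zero>\<^bsub>TP 1\<^esub> = \<zero>\<^bsub>D.D\<^esub>"
      by (rule ext) (simp add: tensor_inclusion_def D.direct_sum_ops restrict_def)
    then show ?case using inc[of 1 "\<zero>\<^bsub>TP 1\<^esub>"] D.module_ops(1)[of 1] by simp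
  next
    case (single k x)
    then have "P (inc k x)" by (intro inc) auto
    then show ?case unfolding tensor_inclusion_def .
  next
    case (add s t)
    then show ?case using assms(3)[of s t] by (simp add: tensor_algebra_simps)
  qed
qed

text \<open>One function \<open>\<mu>\<close> serves all degrees, as the length of a word tells
  which tensor power it belongs to.\<close>

lemma tensor_algebra_lift:
  assumes W: "module R W" and \<mu>: "\<And>k. k \<ge> 1 \<Longrightarrow> multilinear_words R M k W \<mu>"
  obtains \<phi> where "\<phi> \<in> linear_maps R TA W"
    "\<And>w. set w \<subseteq> carrier M \<Longrightarrow> w \<noteq> [] \<Longrightarrow> \<phi> (tau w) = \<mu> w"
proof -
  interpret D: direct_sum R "{1..}" TP by (rule tensor_direct_sum)
  let ?\<phi> = "D.direct_sum_lift W (\<lambda>k. tensor_lift R W \<mu>)"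
  have L: "tensor_lift R W \<mu> \<in> linear_maps R (TP j) W" if "j \<in> {1..}" for j
    using tensor_lift_linear(1)[OF W \<mu>] that by simp
  have "?\<phi> (tau w) = \<mu> w" if w: "set w \<subseteq> carrier M" "w \<noteq> []" for w
  proof -
    have k: "length w \<ge> 1" using w by (cases w) auto
    have "?\<phi> (tau w) = tensor_lift R W \<mu> (pt w)"
      unfolding tensor_inclusion_def
      by (rule D.direct_sum_lift_single[OF W L]) (use k w pure_tensor_carrier in auto)
    also have "\<dots> = \<mu> w" by (rule tensor_lift_linear(2)[OF W \<mu>[OF k] w(1) refl])
    finally show ?thesis .
  qed
  moreover have "?\<phi> \<in> linear_maps R TA W"
    unfolding linear_maps_tensor_algebra by (rule D.direct_sum_lift_linear[OF W L])
  ultimately show thesis using that by blast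
qed

section \<open>The product of the tensor algebra\<close>

lemma concat_component_carrier:
  assumes "s \<in> carrier TA" "t \<in> carrier TA" "i \<in> {1..<k}"
  shows "tensor_concat R M i (k - i) (s i) (t (k - i)) \<in> carrier (TP k)"
proof -
  interpret D: direct_sum R "{1..}" TP by (rule tensor_direct_sum)
  have "s i \<in> carrier (TP i)" "t (k - i) \<in> carrier (TP (k - i))"
    using assms D.direct_sum_carrierD(2) by (auto simp: tensor_algebra_simps)
  then show ?thesis
    using linear_mapsD(1)[OF tensor_concat_linear_left, of "t (k - i)" "k - i" "s i" i] assms by simp
qed

lemma concat_zero:
  "U \<in> carrier (TP i) \<Longrightarrow> tensor_concat R M i j U \<zero>\<^bsub>TP j\<^esub> = \<zero>\<^bsub>TP (i + j)\<^esub>"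
  "V \<in> carrier (TP j) \<Longrightarrow> tensor_concat R M i j \<zero>\<^bsub>TP i\<^esub> V = \<zero>\<^bsub>TP (i + j)\<^esub>"
  using linear_maps_zero[OF tensor_power_module tensor_power_module tensor_concat_linear_right]
    linear_maps_zero[OF tensor_power_module tensor_power_module tensor_concat_linear_left] by auto

lemma tensor_algebra_mult_closed:
  assumes s: "s \<in> carrier TA" and t: "t \<in> carrier TA"
  shows "s \<otimes>\<^bsub>TA\<^esub> t \<in> carrier TA"
proof -
  interpret D: direct_sum R "{1..}" TP by (rule tensor_direct_sum)
  interpret T: module R "TP k" for k by (rule tensor_power_module)
  note sD = D.direct_sum_carrierD[OF s[unfolded tensor_algebra_simps]]
    and tD = D.direct_sum_carrierD[OF t[unfolded tensor_algebra_simps]]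
  let ?S = "{j \<in> {1..}. s j \<noteq> \<zero>\<^bsub>TP j\<^esub>}" and ?T = "{j \<in> {1..}. t j \<noteq> \<zero>\<^bsub>TP j\<^esub>}"
  \<comment> \<open>A nonzero component of the product needs nonzero components of both factors, so
    its degree is a sum of two degrees taken from the finite supports.\<close>
  let ?B = "(\<lambda>(i, j). i + j) ` (?S \<times> ?T)"
  have "s \<otimes>\<^bsub>TA\<^esub> t \<in> carrier (direct_sum_module {1..} TP)"
  proof (rule D.direct_sum_carrierI)
    show "finite ?B" using sD(3) tD(3) by auto
    fix k assume k: "k \<in> {1::nat..}"
    show "(s \<otimes>\<^bsub>TA\<^esub> t) k \<in> carrier (TP k)"
      using k concat_component_carrier[OF s t] by (auto simp: tensor_algebra_simps intro!: T.finsum_closed)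
    assume nB: "k \<notin> ?B"
    have "tensor_concat R M i (k - i) (s i) (t (k - i)) = \<zero>\<^bsub>TP k\<^esub>" if i: "i \<in> {1..<k}" for i
    proof -
      have c: "s i \<in> carrier (TP i)" "t (k - i) \<in> carrier (TP (k - i))" using sD(2) tD(2) i by auto
      have "i \<notin> ?S \<or> k - i \<notin> ?T"
      proof (rule ccontr)
        assume "\<not> ?thesis"
        then have "(\<lambda>(i, j). i + j) (i, k - i) \<in> ?B" by (intro imageI SigmaI) auto
        then show False using nB i by simp
      qed
      then show ?thesis
        using c i concat_zero[of "s i" i "k - i"] concat_zero(2)[of "t (k - i)" "k - i" i] by auto
    qed
    then show "(s \<otimes>\<^bsub>TA\<^esub> t) k = \<zero>\<^bsub>TP k\<^esub>"
      using k by (auto simp: tensor_algebra_simps(5) intro!: T.add.finprod_one_eqI)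
  qed (simp add: tensor_algebra_simps)
  then show ?thesis by (simp add: tensor_algebra_simps)
qed

lemma tensor_algebra_mult_linear_left:
  assumes t: "t \<in> carrier TA"
  shows "(\<lambda>s. s \<otimes>\<^bsub>TA\<^esub> t) \<in> linear_maps R TA TA"
proof (rule linear_mapsI)
  interpret D: direct_sum R "{1..}" TP by (rule tensor_direct_sum)
  interpret T: module R "TP k" for k by (rule tensor_power_module)
  have comp: "x i \<in> carrier (TP i)" if "x \<in> carrier TA" "1 \<le> i" for x i
    using that D.direct_sum_carrierD(2) by (auto simp: tensor_algebra_simps)
  show "s \<otimes>\<^bsub>TA\<^esub> t \<in> carrier TA" if s: "s \<in> carrier TA" for s
    using tensor_algebra_mult_closed[OF s t] .
  fix s assume s: "s \<in> carrier TA"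
  show "(s \<oplus>\<^bsub>TA\<^esub> s') \<otimes>\<^bsub>TA\<^esub> t = s \<otimes>\<^bsub>TA\<^esub> t \<oplus>\<^bsub>TA\<^esub> s' \<otimes>\<^bsub>TA\<^esub> t" if s': "s' \<in> carrier TA" for s'
  proof -
    have eq: "tensor_concat R M i (k - i) ((s \<oplus>\<^bsub>TA\<^esub> s') i) (t (k - i)) = tensor_concat R M i (k - i) (s i) (t (k - i)) \<oplus>\<^bsub>TP k\<^esub>
        tensor_concat R M i (k - i) (s' i) (t (k - i))" if i: "i \<in> {1..<k}" for i k
      using i linear_mapsD(2)[OF tensor_concat_linear_left[OF comp[OF t, of "k - i"]] comp[OF s, of i] comp[OF s', of i]]
      by (simp add: tensor_algebra_simps(3) D.direct_sum_ops(2) le_diff_conv2)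
    have "(\<Oplus>\<^bsub>TP k\<^esub>i\<in>{1..<k}. tensor_concat R M i (k - i) ((s \<oplus>\<^bsub>TA\<^esub> s') i) (t (k - i))) =
      (\<Oplus>\<^bsub>TP k\<^esub>i\<in>{1..<k}. tensor_concat R M i (k - i) (s i) (t (k - i))) \<oplus>\<^bsub>TP k\<^esub>
      (\<Oplus>\<^bsub>TP k\<^esub>i\<in>{1..<k}. tensor_concat R M i (k - i) (s' i) (t (k - i)))" for k
      by (rule trans[OF T.finsum_cong' T.finsum_addf], rule refl)
        (use concat_component_carrier[OF s t] concat_component_carrier[OF s' t] in
          \<open>simp_all add: eq Pi_iff del: atLeastLessThan_iff\<close>)
    then show ?thesis
      by (simp add: tensor_algebra_simps(3,5) D.direct_sum_ops(2) cong: restrict_cong)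
  qed
  show "(c \<odot>\<^bsub>TA\<^esub> s) \<otimes>\<^bsub>TA\<^esub> t = c \<odot>\<^bsub>TA\<^esub> (s \<otimes>\<^bsub>TA\<^esub> t)" if c: "c \<in> carrier R" for c
  proof -
    have eq: "tensor_concat R M i (k - i) ((c \<odot>\<^bsub>TA\<^esub> s) i) (t (k - i)) = c \<odot>\<^bsub>TP k\<^esub> tensor_concat R M i (k - i) (s i) (t (k - i))"
      if i: "i \<in> {1..<k}" for i k
      using i linear_mapsD(3)[OF tensor_concat_linear_left[OF comp[OF t, of "k - i"]] c comp[OF s, of i]]
      by (simp add: tensor_algebra_simps(4) D.direct_sum_ops(3) le_diff_conv2)
    have "(\<Oplus>\<^bsub>TP k\<^esub>i\<in>{1..<k}. tensor_concat R M i (k - i) ((c \<odot>\<^bsub>TA\<^esub> s) i) (t (k - i))) =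
      c \<odot>\<^bsub>TP k\<^esub> (\<Oplus>\<^bsub>TP k\<^esub>i\<in>{1..<k}. tensor_concat R M i (k - i) (s i) (t (k - i)))" for k
      by (rule trans[OF T.finsum_cong' T.finsum_smult_ldistr[symmetric]], rule refl)
        (use concat_component_carrier[OF s t] c in
          \<open>simp_all add: eq Pi_iff del: atLeastLessThan_iff\<close>)
    then show ?thesis
      by (simp add: tensor_algebra_simps(4,5) D.direct_sum_ops(3) cong: restrict_cong)
  qed
qed

lemma tensor_algebra_mult_linear_right:
  assumes s: "s \<in> carrier TA"
  shows "(\<lambda>t. s \<otimes>\<^bsub>TA\<^esub> t) \<in> linear_maps R TA TA"
proof (rule linear_mapsI)
  interpret D: direct_sum R "{1..}" TP by (rule tensor_direct_sum)
  interpret T: module R "TP k" for k by (rule tensor_power_module)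
  have comp: "x i \<in> carrier (TP i)" if "x \<in> carrier TA" "1 \<le> i" for x i
    using that D.direct_sum_carrierD(2) by (auto simp: tensor_algebra_simps)
  show "s \<otimes>\<^bsub>TA\<^esub> t \<in> carrier TA" if t: "t \<in> carrier TA" for t
    using tensor_algebra_mult_closed[OF s t] .
  fix t assume t: "t \<in> carrier TA"
  show "s \<otimes>\<^bsub>TA\<^esub> (t \<oplus>\<^bsub>TA\<^esub> t') = s \<otimes>\<^bsub>TA\<^esub> t \<oplus>\<^bsub>TA\<^esub> s \<otimes>\<^bsub>TA\<^esub> t'" if t': "t' \<in> carrier TA" for t'
  proof -
    have eq: "tensor_concat R M i (k - i) (s i) ((t \<oplus>\<^bsub>TA\<^esub> t') (k - i)) = tensor_concat R M i (k - i) (s i) (t (k - i)) \<oplus>\<^bsub>TP k\<^esub>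
        tensor_concat R M i (k - i) (s i) (t' (k - i))" if i: "i \<in> {1..<k}" for i k
      using i linear_mapsD(2)[OF tensor_concat_linear_right[OF comp[OF s, of i]] comp[OF t, of "k - i"] comp[OF t', of "k - i"]]
      by (simp add: tensor_algebra_simps(3) D.direct_sum_ops(2) le_diff_conv2)
    have "(\<Oplus>\<^bsub>TP k\<^esub>i\<in>{1..<k}. tensor_concat R M i (k - i) (s i) ((t \<oplus>\<^bsub>TA\<^esub> t') (k - i))) =
      (\<Oplus>\<^bsub>TP k\<^esub>i\<in>{1..<k}. tensor_concat R M i (k - i) (s i) (t (k - i))) \<oplus>\<^bsub>TP k\<^esub>
      (\<Oplus>\<^bsub>TP k\<^esub>i\<in>{1..<k}. tensor_concat R M i (k - i) (s i) (t' (k - i)))" for k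
      by (rule trans[OF T.finsum_cong' T.finsum_addf], rule refl)
        (use concat_component_carrier[OF s t] concat_component_carrier[OF s t'] in
          \<open>simp_all add: eq Pi_iff del: atLeastLessThan_iff\<close>)
    then show ?thesis
      by (simp add: tensor_algebra_simps(3,5) D.direct_sum_ops(2) cong: restrict_cong)
  qed
  show "s \<otimes>\<^bsub>TA\<^esub> (c \<odot>\<^bsub>TA\<^esub> t) = c \<odot>\<^bsub>TA\<^esub> (s \<otimes>\<^bsub>TA\<^esub> t)" if c: "c \<in> carrier R" for c
  proof -
    have eq: "tensor_concat R M i (k - i) (s i) ((c \<odot>\<^bsub>TA\<^esub> t) (k - i)) = c \<odot>\<^bsub>TP k\<^esub> tensor_concat R M i (k - i) (s i) (t (k - i))"
      if i: "i \<in> {1..<k}" for i k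
      using i linear_mapsD(3)[OF tensor_concat_linear_right[OF comp[OF s, of i]] c comp[OF t, of "k - i"]]
      by (simp add: tensor_algebra_simps(4) D.direct_sum_ops(3) le_diff_conv2)
    have "(\<Oplus>\<^bsub>TP k\<^esub>i\<in>{1..<k}. tensor_concat R M i (k - i) (s i) ((c \<odot>\<^bsub>TA\<^esub> t) (k - i))) =
      c \<odot>\<^bsub>TP k\<^esub> (\<Oplus>\<^bsub>TP k\<^esub>i\<in>{1..<k}. tensor_concat R M i (k - i) (s i) (t (k - i)))" for k
      by (rule trans[OF T.finsum_cong' T.finsum_smult_ldistr[symmetric]], rule refl)
        (use concat_component_carrier[OF s t] c in
          \<open>simp_all add: eq Pi_iff del: atLeastLessThan_iff\<close>)
    then show ?thesis
      by (simp add: tensor_algebra_simps(4,5) D.direct_sum_ops(3) cong: restrict_cong)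
  qed
qed

text \<open>In the convolution sum at degree \<open>k\<close> both factors can be nonzero only at
  the index \<open>i = length u\<close>, and only if \<open>k - i = length v\<close>. That one
  summand is a concatenation of pure tensors.\<close>

lemma tau_mult:
  assumes u: "set u \<subseteq> carrier M" "u \<noteq> []" and v: "set v \<subseteq> carrier M" "v \<noteq> []"
  shows "tau u \<otimes>\<^bsub>TA\<^esub> tau v = tau (u @ v)"
proof -
  interpret D: direct_sum R "{1..}" TP by (rule tensor_direct_sum)
  interpret T: module R "TP k" for k by (rule tensor_power_module)
  note cu = pure_tensor_carrier[OF u(1) refl] and cv = pure_tensor_carrier[OF v(1) refl]
  have "(\<Oplus>\<^bsub>TP k\<^esub>i\<in>{1..<k}. tensor_concat R M i (k - i) (tau u i) (tau v (k - i))) =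
    (if k = length u + length v then pt (u @ v) else \<zero>\<^bsub>TP k\<^esub>)" if "k \<ge> 1" for k
  proof -
    have zero: "tensor_concat R M i (k - i) (tau u i) (tau v (k - i)) = \<zero>\<^bsub>TP k\<^esub>"
      if i: "i \<in> {1..<k}" "\<not> (i = length u \<and> k - i = length v)" for i
    proof -
      have c: "tau u i \<in> carrier (TP i)" "tau v (k - i) \<in> carrier (TP (k - i))"
        using D.direct_sum_carrierD(2) tau_carrier[OF u] tau_carrier[OF v] i
        by (auto simp: tensor_algebra_simps)
      have "tau u i = \<zero>\<^bsub>TP i\<^esub> \<or> tau v (k - i) = \<zero>\<^bsub>TP (k - i)\<^esub>"
        using i by (auto simp: tensor_inclusion_def le_diff_conv2)
      then show ?thesis
        using i concat_zero(1)[OF c(1), of "k - i"] concat_zero(2)[OF c(2), of i] by (elim disjE) simp_all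
    qed
    show ?thesis
    proof (cases "k = length u + length v")
      case True
      have "(\<Oplus>\<^bsub>TP k\<^esub>i\<in>{1..<k}. tensor_concat R M i (k - i) (tau u i) (tau v (k - i))) =
        (\<Oplus>\<^bsub>TP k\<^esub>i\<in>{length u}. tensor_concat R M i (k - i) (tau u i) (tau v (k - i)))"
      proof (rule T.add.finprod_mono_neutral_cong_left[symmetric])
        show "{length u} \<subseteq> {1..<k}" using True u v by (simp add: length_ge_1)
        show "tensor_concat R M i (k - i) (tau u i) (tau v (k - i)) = \<zero>\<^bsub>TP k\<^esub>"
          if "i \<in> {1..<k} - {length u}" for i
          using that by (intro zero) auto
        show "(\<lambda>i. tensor_concat R M i (k - i) (tau u i) (tau v (k - i))) \<in> {1..<k} \<rightarrow> carrier (TP k)"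
          using concat_component_carrier[OF tau_carrier[OF u] tau_carrier[OF v]] by blast
      qed auto
      also have "\<dots> = pt (u @ v)"
        using True u v pure_tensor_carrier[of "u @ v" k] tensor_concat_pure[of u v]
        by (simp add: tensor_inclusion_def length_ge_1)
      finally show ?thesis using True by simp
    next
      case False
      then show ?thesis by (auto intro!: T.add.finprod_one_eqI zero)
    qed
  qed
  then show ?thesis
    by (simp add: tensor_algebra_simps(5) tensor_inclusion_def[of R M "length u + length v"] cong: restrict_cong)
qed

text \<open>Associativity holds on three words because concatenation is associative. Both sides are
  additive in each argument, and successive inductions free \<open>z\<close>, \<open>y\<close> and
  \<open>x\<close> in this order.\<close>

lemma tensor_algebra_nonunital_algebra: "nonunital_algebra R TA"
proof -
  interpret TA: module R TA by (rule tensor_algebra_module)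
  note L = linear_mapsD[OF tensor_algebra_mult_linear_left]
    and Ri = linear_mapsD[OF tensor_algebra_mult_linear_right]
  note cl = tensor_algebra_mult_closed
  have assoc1: "tau u \<otimes>\<^bsub>TA\<^esub> tau v \<otimes>\<^bsub>TA\<^esub> z = tau u \<otimes>\<^bsub>TA\<^esub> (tau v \<otimes>\<^bsub>TA\<^esub> z)"
    if u: "set u \<subseteq> carrier M" "u \<noteq> []" and v: "set v \<subseteq> carrier M" "v \<noteq> []" and "z \<in> carrier TA" for u v z
    using that(5)
  proof (induction rule: tensor_algebra_induct)
    case (tau w)
    then show ?case using u v tau_mult[of u v] tau_mult[of v w] tau_mult[of "u @ v" w] tau_mult[of u "v @ w"]
      by simp
  next
    case (add s t)
    then show ?case using u v by (simp add: Ri cl tau_carrier)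
  qed
  have assoc2: "tau u \<otimes>\<^bsub>TA\<^esub> y \<otimes>\<^bsub>TA\<^esub> z = tau u \<otimes>\<^bsub>TA\<^esub> (y \<otimes>\<^bsub>TA\<^esub> z)"
    if u: "set u \<subseteq> carrier M" "u \<noteq> []" and "y \<in> carrier TA" and z: "z \<in> carrier TA" for u y z
    using that(3)
    by (induction rule: tensor_algebra_induct) (use u z in \<open>auto simp: assoc1 L Ri cl tau_carrier\<close>)
  have assoc: "x \<otimes>\<^bsub>TA\<^esub> y \<otimes>\<^bsub>TA\<^esub> z = x \<otimes>\<^bsub>TA\<^esub> (y \<otimes>\<^bsub>TA\<^esub> z)"
    if "x \<in> carrier TA" and y: "y \<in> carrier TA" and z: "z \<in> carrier TA" for x y z
    using that(1)
    by (induction rule: tensor_algebra_induct) (use y z in \<open>auto simp: assoc2 L cl tau_carrier\<close>)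
  show ?thesis
    by (intro nonunital_algebra.intro nonunital_algebra_axioms.intro tensor_algebra_module)
      (auto simp: cl assoc L Ri)
qed

text \<open>A general predicate on degrees keeps residue arithmetic out of the linearity proof; it
  is instantiated below with a residue class modulo \<open>n - 1\<close>.\<close>

definition degree_part :: "(nat \<Rightarrow> bool) \<Rightarrow> (nat \<Rightarrow> ('c list \<Rightarrow> 'a) set) \<Rightarrow> nat \<Rightarrow> ('c list \<Rightarrow> 'a) set" where
  "degree_part P t = (\<lambda>k\<in>{1..}. if P k then t k else \<zero>\<^bsub>TP k\<^esub>)"

lemma degree_part_linear: "degree_part P \<in> linear_maps R TA TA"
proof -
  interpret D: direct_sum R "{1..}" TP by (rule tensor_direct_sum)
  note D = D.direct_sum_carrierD
  show ?thesis unfolding linear_maps_tensor_algebra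
  proof (rule linear_mapsI)
    fix t assume t: "t \<in> carrier D.D"
    show "degree_part P t \<in> carrier D.D"
      using D[OF t] D.module_ops
      by (intro D.direct_sum_carrierI[where B = "{j \<in> {1..}. t j \<noteq> \<zero>\<^bsub>TP j\<^esub>}"])
        (auto simp: degree_part_def)
  qed (auto simp: fun_eq_iff degree_part_def D.direct_sum_ops D.module_ops restrict_def)
qed

lemma degree_part_tau:
  "degree_part P (tau w) = (if P (length w) then tau w else \<zero>\<^bsub>TA\<^esub>)"
proof -
  interpret D: direct_sum R "{1..}" TP by (rule tensor_direct_sum)
  show ?thesis
    by (rule ext) (simp add: degree_part_def tensor_inclusion_def tensor_algebra_simps(2)
        D.direct_sum_ops restrict_def)
qed

end


section \<open>Products and gradings in non-unital algebras\<close>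

context nonunital_algebra
begin

text \<open>The fold starts at the first letter, there being no unit to start from, so the value at
  the empty word is unspecified. This is the function that \<open>nfold_product\<close>
  lifts.\<close>

abbreviation "wprod w \<equiv> foldl (monoid.mult M) (hd w) (tl w)"

lemma wprod_snoc: "w \<noteq> [] \<Longrightarrow> wprod (w @ [x]) = wprod w \<otimes>\<^bsub>M\<^esub> x"
  by simp

lemma wprod_closed: "set w \<subseteq> carrier M \<Longrightarrow> w \<noteq> [] \<Longrightarrow> wprod w \<in> carrier M"
proof (induction w rule: rev_induct)
  case (snoc x xs)
  then show ?case using wprod_snoc[of xs x] by (cases "xs = []") (simp_all add: mult_closed)
qed simp

lemma wprod_append:
  assumes "set u \<subseteq> carrier M" "u \<noteq> []"
  shows "set v \<subseteq> carrier M \<Longrightarrow> v \<noteq> [] \<Longrightarrow> wprod (u @ v) = wprod u \<otimes>\<^bsub>M\<^esub> wprod v"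
proof (induction v rule: rev_induct)
  case (snoc x xs)
  show ?case
  proof (cases "xs = []")
    case True
    then show ?thesis using assms wprod_snoc[of u x] by simp
  next
    case False
    have "wprod (u @ xs @ [x]) = wprod (u @ xs) \<otimes>\<^bsub>M\<^esub> x"
      using wprod_snoc[of "u @ xs" x] assms by simp
    then show ?thesis
      using assms snoc False wprod_snoc[of xs x] wprod_closed[OF assms] wprod_closed[of xs]
      by (simp add: mult_assoc)
  qed
qed simp

lemma wprod_multilinear:
  assumes "k \<ge> 1"
  shows "multilinear_words R M k M wprod"
proof (rule multilinear_wordsI)
  \<comment> \<open>The letter \<open>x\<close> is multiplied from the left by
    \<open>wprod u\<close> and from the right by \<open>wprod v\<close>, each only when that word is
    nonempty. In this form linearity in \<open>x\<close> is the distributive laws.\<close>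
  have eq: "wprod (u @ [x] @ v) =
    (let y = (if u = [] then x else wprod u \<otimes>\<^bsub>M\<^esub> x) in if v = [] then y else y \<otimes>\<^bsub>M\<^esub> wprod v)"
    if "set u \<subseteq> carrier M" "set v \<subseteq> carrier M" "x \<in> carrier M" for u v x
    using that wprod_append[of "u @ [x]" v] wprod_snoc[of u x] by (auto simp: Let_def)
  show "wprod w \<in> carrier M" if "set w \<subseteq> carrier M" "length w = k" for w
    using that assms by (intro wprod_closed) auto
  show "wprod (u @ [a \<oplus>\<^bsub>M\<^esub> b] @ v) = wprod (u @ [a] @ v) \<oplus>\<^bsub>M\<^esub> wprod (u @ [b] @ v)"
    if "set u \<subseteq> carrier M" "set v \<subseteq> carrier M" "a \<in> carrier M" "b \<in> carrier M" for u v a b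
    using that wprod_closed[of u] wprod_closed[of v]
    by (simp add: eq Let_def mult_l_distr mult_r_distr mult_closed del: append_Cons append_Nil)
  show "wprod (u @ [c \<odot>\<^bsub>M\<^esub> a] @ v) = c \<odot>\<^bsub>M\<^esub> wprod (u @ [a] @ v)"
    if "set u \<subseteq> carrier M" "set v \<subseteq> carrier M" "c \<in> carrier R" "a \<in> carrier M" for u v a c
    using that wprod_closed[of u] wprod_closed[of v]
    by (simp add: eq Let_def smult_mult_l smult_mult_r mult_closed del: append_Cons append_Nil)
qed

lemma algebra_ideal_generated_ideal:
  assumes "S \<subseteq> carrier M"
  shows "algebra_ideal R M (algebra_ideal_generated R M S)"
proof -
  \<comment> \<open>The whole algebra belongs to the family that is intersected, so the intersection
    lies in the carrier.\<close>
  have carrier: "algebra_ideal R M (carrier M)"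
    by (simp add: algebra_ideal_def carrier_is_submodule mult_closed)
  have "submodule (algebra_ideal_generated R M S) R M"
  proof (rule submoduleI')
    show "algebra_ideal_generated R M S \<subseteq> carrier M"
      using assms carrier by (auto simp: algebra_ideal_generated_def)
    show "\<zero>\<^bsub>M\<^esub> \<in> algebra_ideal_generated R M S"
      using submodule_zero_mem by (auto simp: algebra_ideal_generated_def algebra_ideal_def)
  qed (auto simp: algebra_ideal_generated_def algebra_ideal_def dest: submoduleE)
  then show ?thesis
    unfolding algebra_ideal_def by (auto simp: algebra_ideal_generated_def algebra_ideal_def)
qed

text \<open>A complete family of orthogonal projections splits the algebra, the component of
  \<open>x\<close> in \<open>D g\<close> being \<open>P g x\<close>. As the group is finite, all
  sums may run over the whole group instead of a support.\<close>

lemma graded_algebraI: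
  assumes fin: "finite (carrier G)"
    and P: "\<And>g. g \<in> carrier G \<Longrightarrow> P g \<in> linear_maps R M M"
    and orth: "\<And>g h x. g \<in> carrier G \<Longrightarrow> h \<in> carrier G \<Longrightarrow> x \<in> carrier M \<Longrightarrow>
      P g (P h x) = (if g = h then P g x else \<zero>\<^bsub>M\<^esub>)"
    and total: "\<And>x. x \<in> carrier M \<Longrightarrow> x = (\<Oplus>\<^bsub>M\<^esub>g\<in>carrier G. P g x)"
    and D: "\<And>g. g \<in> carrier G \<Longrightarrow> D g = {x \<in> carrier M. P g x = x}"
    and mult: "\<And>g h x y. g \<in> carrier G \<Longrightarrow> h \<in> carrier G \<Longrightarrow> x \<in> D g \<Longrightarrow> y \<in> D h \<Longrightarrow>
      x \<otimes>\<^bsub>M\<^esub> y \<in> D (g \<otimes>\<^bsub>G\<^esub> h)"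
  shows "graded_algebra G R M D"
proof -
  note PD = linear_mapsD[OF P] and P0 = linear_maps_zero[OF module_axioms module_axioms P]
  have sub: "submodule (D g) R M" if g: "g \<in> carrier G" for g
    unfolding D[OF g] by (rule submoduleI') (auto simp: PD[OF g] P0[OF g])
  have Psum: "P g (\<Oplus>\<^bsub>M\<^esub>h\<in>B. y h) = (\<Oplus>\<^bsub>M\<^esub>h\<in>B. P g (y h))"
    if g: "g \<in> carrier G" and "finite B" "\<And>h. h \<in> B \<Longrightarrow> y h \<in> carrier M" for g y B
    using that(2,3)
    by (induction B rule: finite_induct) (auto simp: P0[OF g] PD[OF g] Pi_iff)
  have full: "(\<Oplus>\<^bsub>M\<^esub>g\<in>{g \<in> carrier G. y g \<noteq> \<zero>\<^bsub>M\<^esub>}. y g) = (\<Oplus>\<^bsub>M\<^esub>g\<in>carrier G. y g)"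
    if "\<And>g. g \<in> carrier G \<Longrightarrow> y g \<in> carrier M" for y
    by (rule add.finprod_mono_neutral_cong_left) (use fin that in auto)
  have "\<exists>!x. x \<in> (\<Pi>\<^sub>E g\<in>carrier G. D g) \<and> finite {g \<in> carrier G. x g \<noteq> \<zero>\<^bsub>M\<^esub>} \<and>
      b = (\<Oplus>\<^bsub>M\<^esub>g\<in>{g \<in> carrier G. x g \<noteq> \<zero>\<^bsub>M\<^esub>}. x g)" if b: "b \<in> carrier M" for b
  proof (rule ex1I[of _ "\<lambda>g\<in>carrier G. P g b"])
    let ?x = "\<lambda>g\<in>carrier G. P g b"
    have "(\<Oplus>\<^bsub>M\<^esub>g\<in>carrier G. ?x g) = (\<Oplus>\<^bsub>M\<^esub>g\<in>carrier G. P g b)"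
      by (rule M.finsum_cong') (use PD b in auto)
    then show "?x \<in> (\<Pi>\<^sub>E g\<in>carrier G. D g) \<and> finite {g \<in> carrier G. ?x g \<noteq> \<zero>\<^bsub>M\<^esub>} \<and>
      b = (\<Oplus>\<^bsub>M\<^esub>g\<in>{g \<in> carrier G. ?x g \<noteq> \<zero>\<^bsub>M\<^esub>}. ?x g)"
      using b fin total[OF b] full[of ?x] PD(1) orth by (simp add: D)
  next
    fix y assume y: "y \<in> (\<Pi>\<^sub>E g\<in>carrier G. D g) \<and> finite {g \<in> carrier G. y g \<noteq> \<zero>\<^bsub>M\<^esub>} \<and>
      b = (\<Oplus>\<^bsub>M\<^esub>g\<in>{g \<in> carrier G. y g \<noteq> \<zero>\<^bsub>M\<^esub>}. y g)"
    then have yD: "y g \<in> carrier M" "P g (y g) = y g" if "g \<in> carrier G" for g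
      using that D by (auto simp: PiE_iff)
    \<comment> \<open>Uniqueness: applying \<open>P h\<close> to any decomposition leaves only its
      entry at \<open>h\<close>, because \<open>y g\<close> is fixed by \<open>P g\<close> and the
      projections are orthogonal.\<close>
    have "P h b = y h" if h: "h \<in> carrier G" for h
    proof -
      have "P h b = P h (\<Oplus>\<^bsub>M\<^esub>g\<in>carrier G. y g)" using y full[of y] yD(1) by simp
      also have "\<dots> = (\<Oplus>\<^bsub>M\<^esub>g\<in>carrier G. P h (y g))" by (rule Psum[OF h fin yD(1)])
      also have "\<dots> = (\<Oplus>\<^bsub>M\<^esub>g\<in>{h}. y g)"
      proof (rule add.finprod_mono_neutral_cong_right)
        fix g assume g: "g \<in> carrier G - {h}"
        then have "P h (P g (y g)) = \<zero>\<^bsub>M\<^esub>" using orth[of h g "y g"] h yD by auto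
        then show "P h (y g) = \<zero>\<^bsub>M\<^esub>" using g yD by simp
      qed (use fin h yD PD in auto)
      also have "\<dots> = y h" using h yD by simp
      finally show ?thesis .
    qed
    then show "y = (\<lambda>g\<in>carrier G. P g b)" using y by (auto simp: PiE_iff extensional_def fun_eq_iff)
  qed
  then show ?thesis
    unfolding graded_algebra_def using nonunital_algebra_axioms sub mult by blast
qed

end


section \<open>Associative n-ary algebras\<close>

context tensor_module
begin

text \<open>The word behind the pure tensor that \<open>nary_insert\<close> produces from the pure
  tensor of \<open>w\<close>; \<open>i\<close> counts the letters in front of the block that is
  multiplied.\<close>

definition insert_word :: "nat \<Rightarrow> (('c list \<Rightarrow> 'a) set \<Rightarrow> 'c) \<Rightarrow> nat \<Rightarrow> 'c list \<Rightarrow> 'c list" where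
  "insert_word n m i w = take i w @ [m (pt (take n (drop i w)))] @ drop (i + n) w"

lemma insert_word_append: "length u = i \<Longrightarrow> length v = n \<Longrightarrow> insert_word n m i (u @ v @ w) = u @ [m (pt v)] @ w"
  by (simp add: insert_word_def)

lemma nary_product_multilinear:
  assumes m: "m \<in> linear_maps R (TP n) M"
  shows "multilinear_words R M n M (\<lambda>w. m (pt w))"
  by (rule multilinear_wordsI)
    (auto simp: multilinear_wordsD(2,3)[OF pure_tensor_multilinear, simplified] linear_mapsD[OF m] pure_tensor_carrier)

text \<open>The varying letter stands before, inside or after the block being multiplied. Outside
  the block it remains a letter of the result, and multilinearity of pure tensors applies; inside,
  linearity of the product in that letter is used as well.\<close>

lemma insert_word_multilinear:
  assumes m: "m \<in> linear_maps R (TP n) M" and i: "i < n"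
  shows "multilinear_words R M (2 * n - 1) (TP n) (\<lambda>w. pt (insert_word n m i w))"
proof (rule multilinear_wordsI)
  note mul = multilinear_wordsD[OF nary_product_multilinear[OF m]]
    and ptD = multilinear_wordsD[OF pure_tensor_multilinear]
  have mem: "m (pt (take n (drop i w))) \<in> carrier M"
    if "set w \<subseteq> carrier M" "length w = 2 * n - 1" for w
  proof -
    have "set (take n (drop i w)) \<subseteq> carrier M"
      using that(1) by (meson order_trans set_drop_subset set_take_subset)
    then show ?thesis using mul(1) that i by simp
  qed
  show "pt (insert_word n m i w) \<in> carrier (TP n)"
    if "set w \<subseteq> carrier M" "length w = 2 * n - 1" for w
    using mem[OF that] that i
    by (intro pure_tensor_carrier) (auto simp: insert_word_def dest: in_set_takeD in_set_dropD)
  \<comment> \<open>The words \<open>p\<close>, \<open>q\<close>, \<open>p'\<close>,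
    \<open>q'\<close> are chosen before \<open>x\<close>, so one shape serves \<open>a\<close>,
    \<open>b\<close> and their sum or multiple at once.\<close>
  have shape: "(\<exists>p q. set p \<subseteq> carrier M \<and> set q \<subseteq> carrier M \<and> length p + 1 + length q = n \<and>
        (\<forall>x\<in>carrier M. insert_word n m i (u @ [x] @ v) = p @ [x] @ q)) \<or>
      (\<exists>p q p' q'. set p \<subseteq> carrier M \<and> set q \<subseteq> carrier M \<and> length p + 1 + length q = n \<and>
        set p' \<subseteq> carrier M \<and> set q' \<subseteq> carrier M \<and> length p' + 1 + length q' = n \<and>
        (\<forall>x\<in>carrier M. insert_word n m i (u @ [x] @ v) = p @ [m (pt (p' @ [x] @ q'))] @ q))"
    if u: "set u \<subseteq> carrier M" and v: "set v \<subseteq> carrier M" and len: "length u + 1 + length v = 2 * n - 1" for u v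
  proof -
    consider "length u < i" | "i \<le> length u" "length u < i + n" | "i + n \<le> length u" by linarith
    then show ?thesis
    proof cases
      case 1
      \<comment> \<open>Offsets into \<open>v\<close> are diminished by \<open>length u + 1\<close>,
        which accounts for \<open>u\<close> and the letter \<open>x\<close>.\<close>
      let ?q = "take (i - length u - 1) v @ [m (pt (take n (drop (i - length u - 1) v)))] @ drop (i + n - length u - 1) v"
      have d: "drop k (x # v) = drop (k - 1) v" "take k (x # v) = x # take (k - 1) v" if "k > 0" for k x
        using that by (cases k; simp)+
      have eq: "insert_word n m i (u @ [x] @ v) = u @ [x] @ ?q" for x
        using 1 d[of "i - length u"] d[of "i + n - length u"] by (simp add: insert_word_def)
      have "set (take n (drop (i - length u - 1) v)) \<subseteq> carrier M"
        using v by (meson order_trans set_drop_subset set_take_subset)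
      then have "m (pt (take n (drop (i - length u - 1) v))) \<in> carrier M"
        using mul(1) 1 len i by simp
      then have "set ?q \<subseteq> carrier M"
        using v by (auto dest: in_set_takeD in_set_dropD)
      moreover have "length u + 1 + length ?q = n" using 1 len i by simp
      ultimately show ?thesis using u
        by (intro disjI1 exI[of _ u] exI[of _ ?q] conjI ballI eq) assumption+
    next
      case 2
      let ?q = "drop (i + n - length u - 1) v" and ?q' = "take (i + n - length u - 1) v"
      have eq: "insert_word n m i (u @ [x] @ v) = take i u @ [m (pt (drop i u @ [x] @ ?q'))] @ ?q" for x
      proof -
        have split: "u @ [x] @ v = take i u @ (drop i u @ [x] @ ?q') @ ?q" by simp
        show ?thesis
          by (subst split, rule insert_word_append) (use 2 len i in auto)
      qed
      have "set (take i u) \<subseteq> carrier M" "set (drop i u) \<subseteq> carrier M"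
        "set ?q \<subseteq> carrier M" "set ?q' \<subseteq> carrier M"
        using u v by (auto dest: in_set_takeD in_set_dropD)
      moreover have "length (take i u) + 1 + length ?q = n" "length (drop i u) + 1 + length ?q' = n"
        using 2 len i by auto
      ultimately show ?thesis
        by (intro disjI2 exI[of _ "take i u"] exI[of _ ?q] exI[of _ "drop i u"] exI[of _ ?q']
            conjI ballI eq) assumption+
    next
      case 3
      let ?p = "take i u @ [m (pt (take n (drop i u)))] @ drop (i + n) u"
      have eq: "insert_word n m i (u @ [x] @ v) = ?p @ [x] @ v" for x
        using 3 by (simp add: insert_word_def)
      have "set (take n (drop i u)) \<subseteq> carrier M"
        using u by (meson order_trans set_drop_subset set_take_subset)
      then have "m (pt (take n (drop i u))) \<in> carrier M"
        using mul(1) 3 len i by simp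
      then have "set ?p \<subseteq> carrier M"
        using u by (auto dest: in_set_takeD in_set_dropD)
      moreover have "length ?p + 1 + length v = n" using 3 len i by simp
      ultimately show ?thesis using v
        by (intro disjI1 exI[of _ ?p] exI[of _ v] conjI ballI eq) assumption+
    qed
  qed
  {
    fix u v a b assume uv: "set u \<subseteq> carrier M" "set v \<subseteq> carrier M" "length u + 1 + length v = 2 * n - 1"
      and ab: "a \<in> carrier M" "b \<in> carrier M"
    show "pt (insert_word n m i (u @ [a \<oplus>\<^bsub>M\<^esub> b] @ v)) =
      pt (insert_word n m i (u @ [a] @ v)) \<oplus>\<^bsub>TP n\<^esub> pt (insert_word n m i (u @ [b] @ v))"
      using shape[OF uv]
    proof (elim disjE exE conjE)
      fix p q assume *: "set p \<subseteq> carrier M" "set q \<subseteq> carrier M" "length p + 1 + length q = n"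
        "\<forall>x\<in>carrier M. insert_word n m i (u @ [x] @ v) = p @ [x] @ q"
      show ?thesis using ab ptD(2)[OF *(1-3) ab] *(4) by (simp del: append_Cons append_Nil)
    next
      fix p q p' q' assume *: "set p \<subseteq> carrier M" "set q \<subseteq> carrier M" "length p + 1 + length q = n"
        and **: "set p' \<subseteq> carrier M" "set q' \<subseteq> carrier M" "length p' + 1 + length q' = n"
        and ***: "\<forall>x\<in>carrier M. insert_word n m i (u @ [x] @ v) = p @ [m (pt (p' @ [x] @ q'))] @ q"
      have "m (pt (p' @ [a] @ q')) \<in> carrier M" "m (pt (p' @ [b] @ q')) \<in> carrier M"
        using ** ab by (auto intro!: mul(1))
      from ptD(2)[OF * this] show ?thesis
        using ab mul(2)[OF ** ab] *** by (simp del: append_Cons append_Nil)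
    qed
  }
  {
    fix u v c a assume uv: "set u \<subseteq> carrier M" "set v \<subseteq> carrier M" "length u + 1 + length v = 2 * n - 1"
      and ca: "c \<in> carrier R" "a \<in> carrier M"
    show "pt (insert_word n m i (u @ [c \<odot>\<^bsub>M\<^esub> a] @ v)) = c \<odot>\<^bsub>TP n\<^esub> pt (insert_word n m i (u @ [a] @ v))"
      using shape[OF uv]
    proof (elim disjE exE conjE)
      fix p q assume *: "set p \<subseteq> carrier M" "set q \<subseteq> carrier M" "length p + 1 + length q = n"
        "\<forall>x\<in>carrier M. insert_word n m i (u @ [x] @ v) = p @ [x] @ q"
      show ?thesis using ca ptD(3)[OF *(1-3) ca] *(4) by (simp del: append_Cons append_Nil)
    next
      fix p q p' q' assume *: "set p \<subseteq> carrier M" "set q \<subseteq> carrier M" "length p + 1 + length q = n"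
        and **: "set p' \<subseteq> carrier M" "set q' \<subseteq> carrier M" "length p' + 1 + length q' = n"
        and ***: "\<forall>x\<in>carrier M. insert_word n m i (u @ [x] @ v) = p @ [m (pt (p' @ [x] @ q'))] @ q"
      have "m (pt (p' @ [a] @ q')) \<in> carrier M"
        using ** ca by (auto intro!: mul(1))
      from ptD(3)[OF * ca(1) this] show ?thesis
        using ca mul(3)[OF ** ca] *** by (simp del: append_Cons append_Nil)
    qed
  }
qed

text \<open>Both sides of the associativity condition are linear in the tensor \<open>U\<close>, so
  agreement on pure tensors suffices. One direction unpacks the hypothesis on \<open>A\<close>, the
  other establishes the condition for the part of degree one.\<close>

lemma assoc_nary_algebra_iff:
  "assoc_nary_algebra R M n m \<longleftrightarrow> m \<in> linear_maps R (TP n) M \<and>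
    (\<forall>i<n. \<forall>j<n. \<forall>w. set w \<subseteq> carrier M \<longrightarrow> length w = 2 * n - 1 \<longrightarrow>
      m (pt (insert_word n m i w)) = m (pt (insert_word n m j w)))"
proof -
  have ins: "nary_insert R M n m i = tensor_lift R (TP n) (\<lambda>w. pt (insert_word n m i w))" for i
    by (simp add: nary_insert_def insert_word_def)
  {
    assume m: "m \<in> linear_maps R (TP n) M"
    note lift = tensor_lift_linear[OF tensor_power_module insert_word_multilinear[OF m], folded ins]
    note lin = linear_maps_comp[OF lift(1) m]
    have "(\<forall>i<n. \<forall>j<n. \<forall>U\<in>carrier (TP (2 * n - 1)).
        m (nary_insert R M n m i U) = m (nary_insert R M n m j U)) \<longleftrightarrow>
      (\<forall>i<n. \<forall>j<n. \<forall>w. set w \<subseteq> carrier M \<longrightarrow> length w = 2 * n - 1 \<longrightarrow>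
        m (pt (insert_word n m i w)) = m (pt (insert_word n m j w)))" (is "?l \<longleftrightarrow> ?r")
    proof
      assume ?l
      show ?r
      proof (intro allI impI)
        fix i j w assume i: "i < n" and j: "j < n" and w: "set w \<subseteq> carrier M" "length w = 2 * n - 1"
        have "m (nary_insert R M n m i (pt w)) = m (nary_insert R M n m j (pt w))"
          using \<open>?l\<close> i j pure_tensor_carrier[OF w] by blast
        then show "m (pt (insert_word n m i w)) = m (pt (insert_word n m j w))"
          using lift(2)[OF i w] lift(2)[OF j w] by simp
      qed
    next
      assume r: ?r
      show ?l
      proof (intro allI impI ballI)
        fix i j U assume i: "i < n" and j: "j < n" and U: "U \<in> carrier (TP (2 * n - 1))"
        show "m (nary_insert R M n m i U) = m (nary_insert R M n m j U)"
        proof (rule tensor_power_linear_eqI[OF module_axioms lin[OF i] lin[OF j] _ U])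
          fix w assume w: "set w \<subseteq> carrier M" "length w = 2 * n - 1"
          have "m (pt (insert_word n m i w)) = m (pt (insert_word n m j w))" using r i j w by blast
          then show "m (nary_insert R M n m i (pt w)) = m (nary_insert R M n m j (pt w))"
            using lift(2)[OF i w] lift(2)[OF j w] by simp
        qed
      qed
    qed
  }
  then show ?thesis unfolding assoc_nary_algebra_def using module_axioms by blast
qed

end

text \<open>Each call shortens the word by \<open>n - 1\<close> letters, and the guard
  \<open>2 \<le> n\<close> makes this a strict decrease. The value \<open>z\<close> is the answer
  for lengths that cannot be brought down to 1, the empty word included; it will be zero.\<close>

function nary_iterate :: "nat \<Rightarrow> ('a list \<Rightarrow> 'a) \<Rightarrow> 'a \<Rightarrow> 'a list \<Rightarrow> 'a" where
  "nary_iterate n \<mu> z w = (if length w = 1 then hd w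
     else if 2 \<le> n \<and> n \<le> length w then nary_iterate n \<mu> z (\<mu> (take n w) # drop n w) else z)"
  by auto
termination
  by (relation "measure (\<lambda>(n, \<mu>, z, w). length w)") auto

declare nary_iterate.simps [simp del]

section \<open>Iterated products in an associative n-ary algebra\<close>

locale nary_algebra = tensor_module +
  fixes n :: nat and m :: "('c list \<Rightarrow> 'a) set \<Rightarrow> 'c"
  assumes n: "n \<ge> 2" and assoc_nary: "assoc_nary_algebra R M n m"
begin

abbreviation "mul w \<equiv> m (pt w)"
abbreviation "iter \<equiv> nary_iterate n mul \<zero>\<^bsub>M\<^esub>"

lemma m_linear: "m \<in> linear_maps R (TP n) M"
  using assoc_nary by (simp add: assoc_nary_algebra_iff)

lemmas mul_multilinear = multilinear_wordsD[OF nary_product_multilinear[OF m_linear]]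

text \<open>The block positions \<open>length u\<close> and \<open>length u'\<close> are both below
  \<open>n\<close> and the common word has \<open>2 n - 1\<close> letters, which is the situation of
  \<open>assoc_nary_algebra_iff\<close>.\<close>

lemma mul_assoc:
  assumes "set (u @ v @ w) \<subseteq> carrier M" "length v = n" "length u + 1 + length w = n"
    and "set (u' @ v' @ w') \<subseteq> carrier M" "length v' = n" "length u' + 1 + length w' = n"
    and "u @ v @ w = u' @ v' @ w'"
  shows "mul (u @ [mul v] @ w) = mul (u' @ [mul v'] @ w')"
proof -
  have len: "length (u @ v @ w) = 2 * n - 1" "length u < n" "length u' < n" using assms by auto
  then have "mul (insert_word n m (length u) (u @ v @ w)) = mul (insert_word n m (length u') (u @ v @ w))"
    using assoc_nary[unfolded assoc_nary_algebra_iff] assms(1) by blast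
  then show ?thesis
    unfolding insert_word_append[OF refl assms(2)] unfolding assms(7) insert_word_append[OF refl assms(5)] .
qed

lemma iter_single: "iter [a] = a"
  by (simp add: nary_iterate.simps)

lemma iter_short: "length w \<noteq> 1 \<Longrightarrow> length w < n \<Longrightarrow> iter w = \<zero>\<^bsub>M\<^esub>"
  by (simp add: nary_iterate.simps)

lemma iter_append: "length v = n \<Longrightarrow> iter (v @ w) = iter (mul v # w)"
  using n by (subst nary_iterate.simps) auto

lemma nary_splitting:
  assumes "n \<le> length w" "set w \<subseteq> carrier M"
  obtains v z where "w = v @ z" "length v = n" "set v \<subseteq> carrier M" "set z \<subseteq> carrier M"
  using assms by (intro that[of "take n w" "drop n w"]) (auto dest: in_set_takeD in_set_dropD)

lemma iter_closed: "set w \<subseteq> carrier M \<Longrightarrow> iter w \<in> carrier M"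
proof (induction "length w" arbitrary: w rule: less_induct)
  case less
  consider a where "w = [a]" | "length w \<noteq> 1" "length w < n" | "length w \<ge> n"
    by (metis One_nat_def length_0_conv length_Suc_conv not_le)
  then show ?case
  proof cases
    case 3
    then obtain v z where w: "w = v @ z" "length v = n" "set v \<subseteq> carrier M" "set z \<subseteq> carrier M"
      using less.prems nary_splitting by blast
    then show ?thesis using less.hyps[of "mul v # z"] n mul_multilinear(1) by (simp add: iter_append)
  qed (use less.prems in \<open>auto simp: iter_single iter_short\<close>)
qed

text \<open>Associativity of the product enters here. If \<open>u\<close> is empty, one unfolding of
  \<open>iter\<close> suffices; if the leftmost block lies inside \<open>u\<close>, one step
  shortens \<open>u\<close>. The real case is a block that starts in a nonempty \<open>u\<close> and
  reaches beyond it.\<close>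

lemma iter_insert:
  assumes "set u \<subseteq> carrier M" "set v \<subseteq> carrier M" "set w \<subseteq> carrier M" "length v = n"
  shows "iter (u @ [mul v] @ w) = iter (u @ v @ w)"
  using assms(1)
proof (induction "length u" arbitrary: u rule: less_induct)
  case less
  note mulv = mul_multilinear(1)[OF assms(2,4)]
  consider "u = []" | "length u \<ge> n" | "u \<noteq> []" "length u < n" "length u + 1 + length w < n"
    | "u \<noteq> []" "length u < n" "length u + 1 + length w \<ge> n" by linarith
  then show ?case
  proof cases
    case 1
    then show ?thesis using assms by (simp add: iter_append)
  next
    case 2
    then obtain x y where u: "u = x @ y" "length x = n" "set x \<subseteq> carrier M" "set y \<subseteq> carrier M"
      using less.prems nary_splitting by blast
    then show ?thesis
      using less.hyps[of "mul x # y"] n mul_multilinear(1)[of x]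
        iter_append[of x "y @ [mul v] @ w"] iter_append[of x "y @ v @ w"] by simp
  next
    \<comment> \<open>Here \<open>u @ [mul v] @ w\<close> has between 2 and \<open>n - 1\<close>
      letters. One step brings \<open>u @ v @ w\<close> to the same length, so both sides are the
      default value zero.\<close>
    case 3
    have "set (u @ v @ w) \<subseteq> carrier M" using assms less.prems by auto
    moreover have "n \<le> length (u @ v @ w)" using assms(4) by simp
    ultimately obtain x y where x: "u @ v @ w = x @ y" "length x = n"
      using nary_splitting by metis
    have "length (u @ v @ w) = length (x @ y)" using x by simp
    then have "length u + 1 + length w = length (mul x # y)" using x(2) assms(4) by simp
    then have "iter (mul x # y) = \<zero>\<^bsub>M\<^esub>" using 3 by (intro iter_short) auto
    moreover have "iter (u @ [mul v] @ w) = \<zero>\<^bsub>M\<^esub>" using 3 by (intro iter_short) auto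
    ultimately show ?thesis using x by (simp add: iter_append)
  next
    case 4
    \<comment> \<open>\<open>?v1\<close> completes \<open>u\<close> to a block of \<open>n\<close>
      letters, and \<open>?w1\<close> completes \<open>u @ [mul v]\<close> to one. Hence
      \<open>u @ v @ ?w1\<close> has \<open>2 n - 1\<close> letters.\<close>
    let ?v1 = "take (n - length u) v" and ?v2 = "drop (n - length u) v"
      and ?w1 = "take (n - 1 - length u) w" and ?w2 = "drop (n - 1 - length u) w"
    have len: "length ?v1 = n - length u" "length ?v2 = length u" "length ?w1 = n - 1 - length u"
      using 4 assms(4) by auto
    have sets: "set ?v1 \<subseteq> carrier M" "set ?v2 \<subseteq> carrier M" "set ?w1 \<subseteq> carrier M" "set ?w2 \<subseteq> carrier M"
      using assms by (auto dest: in_set_takeD in_set_dropD)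
    have "iter (u @ [mul v] @ w) = iter ((u @ [mul v] @ ?w1) @ ?w2)" by simp
    also have "\<dots> = iter (mul (u @ [mul v] @ ?w1) # ?w2)"
      by (rule iter_append) (use 4 len in simp)
    \<comment> \<open>Associativity trades the inner product at position \<open>length u\<close> for
      the one of the first \<open>n\<close> letters, which is the product that \<open>iter\<close>
      forms on \<open>u @ v @ w\<close>.\<close>
    also have "mul (u @ [mul v] @ ?w1) = mul ([] @ [mul (u @ ?v1)] @ (?v2 @ ?w1))"
      by (rule mul_assoc) (use 4 len sets assms less.prems in \<open>auto simp: append_take_drop_id\<close>)
    also have "iter (mul ([] @ [mul (u @ ?v1)] @ (?v2 @ ?w1)) # ?w2) =
        iter (([mul (u @ ?v1)] @ ?v2 @ ?w1) @ ?w2)"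
      by (subst iter_append) (use 4 len in simp_all)
    also have "\<dots> = iter (mul (u @ ?v1) # ?v2 @ w)" by simp
    also have "\<dots> = iter ((u @ ?v1) @ ?v2 @ w)"
      by (rule iter_append[symmetric]) (use 4 len in simp)
    also have "(u @ ?v1) @ ?v2 @ w = u @ v @ w" by (metis append_assoc append_take_drop_id)
    finally show ?thesis .
  qed
qed

text \<open>The first step either leaves the varying letter in place, when \<open>u\<close> has at
  least \<open>n\<close> letters, or absorbs it into a product that is linear in it. Either way the
  induction hypothesis for length \<open>k - n + 1\<close> applies. Words shorter than
  \<open>n\<close> and of length other than 1 have value zero.\<close>

lemma iter_multilinear: "multilinear_words R M k M iter"
proof (induction k rule: less_induct)
  case (less k)
  show ?case
  proof (rule multilinear_wordsI)
    fix u v assume u: "set u \<subseteq> carrier M" and v: "set v \<subseteq> carrier M" and k: "length u + 1 + length v = k"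
    consider "u = []" "v = []" | "k \<noteq> 1" "k < n" | "length u \<ge> n" | "length u < n" "k \<ge> n"
      using k by fastforce
    then have "(\<forall>a\<in>carrier M. \<forall>b\<in>carrier M. iter (u @ [a \<oplus>\<^bsub>M\<^esub> b] @ v) = iter (u @ [a] @ v) \<oplus>\<^bsub>M\<^esub> iter (u @ [b] @ v)) \<and>
      (\<forall>c\<in>carrier R. \<forall>a\<in>carrier M. iter (u @ [c \<odot>\<^bsub>M\<^esub> a] @ v) = c \<odot>\<^bsub>M\<^esub> iter (u @ [a] @ v))"
    proof cases
      case 1
      then show ?thesis by (simp add: iter_single)
    next
      case 2
      have "iter (u @ [x] @ v) = \<zero>\<^bsub>M\<^esub>" for x using 2 k by (intro iter_short) auto
      then show ?thesis by simp
    next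
      case 3
      then obtain x y where x: "u = x @ y" "length x = n" "set x \<subseteq> carrier M" "set y \<subseteq> carrier M"
        using u nary_splitting by blast
      have eq: "iter (u @ [a] @ v) = iter ((mul x # y) @ [a] @ v)" for a
        using x by (simp add: iter_append)
      have "k - n + 1 < k" using 3 k n by simp
      note IH = multilinear_wordsD(2,3)[OF less[OF this], of "mul x # y" v]
      have "set (mul x # y) \<subseteq> carrier M" "length (mul x # y) + 1 + length v = k - n + 1"
        using x k mul_multilinear(1) by auto
      then show ?thesis unfolding eq using IH v by blast
    next
      case 4
      let ?v1 = "take (n - 1 - length u) v" and ?v2 = "drop (n - 1 - length u) v"
      have len: "length u + 1 + length ?v1 = n" using 4 k by auto
      have sets: "set ?v1 \<subseteq> carrier M" "set ?v2 \<subseteq> carrier M"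
        using v by (auto dest: in_set_takeD in_set_dropD)
      have eq: "iter (u @ [a] @ v) = iter ([] @ [mul (u @ [a] @ ?v1)] @ ?v2)" for a
        using iter_append[of "u @ [a] @ ?v1" ?v2] len by simp
      have "k - n + 1 < k" using 4 n by simp
      note IH = multilinear_wordsD(2,3)[OF less[OF this], of "[]" ?v2]
      have len2: "length ([] :: 'c list) + 1 + length ?v2 = k - n + 1" using 4 k by simp
      have mulc: "mul (u @ [a] @ ?v1) \<in> carrier M" if "a \<in> carrier M" for a
        using u sets len that by (intro mul_multilinear(1)) auto
      show ?thesis
        unfolding eq
        using IH[OF _ sets(2) len2] mul_multilinear(2,3)[OF u sets(1) len] mulc
        by (simp del: append_Cons append_Nil)
    qed
    then show "a \<in> carrier M \<Longrightarrow> b \<in> carrier M \<Longrightarrow>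
        iter (u @ [a \<oplus>\<^bsub>M\<^esub> b] @ v) = iter (u @ [a] @ v) \<oplus>\<^bsub>M\<^esub> iter (u @ [b] @ v)"
      "c \<in> carrier R \<Longrightarrow> a \<in> carrier M \<Longrightarrow>
        iter (u @ [c \<odot>\<^bsub>M\<^esub> a] @ v) = c \<odot>\<^bsub>M\<^esub> iter (u @ [a] @ v)" for a b c by blast+
  qed (rule iter_closed)
qed

end


section \<open>The enveloping algebra\<close>

context nary_algebra
begin

abbreviation "I \<equiv> env_ideal R M n m"
text \<open>An integer, because the elements of \<open>integer_mod_group (n - 1)\<close> are
  integers. For \<open>n = 2\<close> it equals 1, which is why the residue of degree one is written
  \<open>1 mod modulus\<close>.\<close>

definition "modulus = int (n - 1)"
abbreviation "part r \<equiv> degree_part (\<lambda>k. int k mod modulus = r)"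

lemma mul_closed: "set v \<subseteq> carrier M \<Longrightarrow> length v = n \<Longrightarrow> mul v \<in> carrier M"
  by (rule mul_multilinear(1))

lemma modulus_pos: "0 < modulus"
  using n by (simp add: modulus_def)

lemma int_n: "int n = 1 + modulus"
  using n by (simp add: modulus_def)

lemma n_mod: "int n mod modulus = 1 mod modulus"
  by (simp add: int_n)

interpretation TA: nonunital_algebra R TA
  by (rule tensor_algebra_nonunital_algebra)

lemma tau_nary_carrier: "set v \<subseteq> carrier M \<Longrightarrow> length v = n \<Longrightarrow> tau v \<in> carrier TA"
  using n by (intro tau_carrier) auto

lemma tau_single_carrier: "a \<in> carrier M \<Longrightarrow> tau [a] \<in> carrier TA"
  by (rule tau_carrier) auto

section \<open>The defining ideal and the reduction of words modulo it\<close>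

lemma env_ideal_eq:
  "I = algebra_ideal_generated R TA {tau v \<ominus>\<^bsub>TA\<^esub> tau [mul v] | v. set v \<subseteq> carrier M \<and> length v = n}"
proof -
  have "{inc n (pt w) \<ominus>\<^bsub>TA\<^esub> inc 1 (pt [mul w]) | w. w \<in> words M n} =
    {tau v \<ominus>\<^bsub>TA\<^esub> tau [mul v] | v. set v \<subseteq> carrier M \<and> length v = n}"
    by (auto simp: words_def One_nat_def)
  then show ?thesis by (simp only: env_ideal_def)
qed

lemma env_ideal: "algebra_ideal R TA I"
  unfolding env_ideal_eq
  by (rule TA.algebra_ideal_generated_ideal)
    (auto intro!: TA.minus_closed tau_nary_carrier tau_single_carrier mul_closed simp del: list.size(4))

lemma env_ideal_gen:
  "set v \<subseteq> carrier M \<Longrightarrow> length v = n \<Longrightarrow> tau v \<ominus>\<^bsub>TA\<^esub> tau [mul v] \<in> I"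
  unfolding env_ideal_eq algebra_ideal_generated_def by blast

lemma env_ideal_minimal:
  assumes "algebra_ideal R TA H"
    and "\<And>v. set v \<subseteq> carrier M \<Longrightarrow> length v = n \<Longrightarrow> tau v \<ominus>\<^bsub>TA\<^esub> tau [mul v] \<in> H"
  shows "I \<subseteq> H"
  unfolding env_ideal_eq algebra_ideal_generated_def using assms by blast

interpretation env: ideal_quotient R TA I
  by (intro ideal_quotient.intro ideal_quotient_axioms.intro TA.nonunital_algebra_axioms env_ideal)

lemma env_algebra_quotient: "env_algebra R M n m = env.Q"
  by (simp add: env_algebra_def)

interpretation O: nonunital_algebra R env.Q
  by (rule env.quotient_algebra)

text \<open>The relation between \<open>v\<close> and \<open>mul v\<close> is multiplied by
  \<open>w\<close> on the right. An empty \<open>w\<close> is treated apart, as there is no unit to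
  stand for it.\<close>

lemma env_gen_eq:
  assumes "set v \<subseteq> carrier M" "length v = n" "set w \<subseteq> carrier M"
  shows "env.q (tau (v @ w)) = env.q (tau (mul v # w))"
proof -
  note [simp del] = list.size(4)
  have v: "v \<noteq> []" "tau v \<in> carrier TA" "tau [mul v] \<in> carrier TA" "mul v \<in> carrier M"
    using assms n by (auto intro!: tau_nary_carrier tau_single_carrier mul_closed)
  have eq: "env.q (tau v) = env.q (tau [mul v])"
    using env_ideal_gen[OF assms(1,2)] v env.quotient_eq_iff by blast
  show ?thesis
  proof (cases "w = []")
    case True
    then show ?thesis using eq by simp
  next
    case False
    note w = tau_carrier[OF assms(3) False]
    have "env.q (tau (v @ w)) = env.q (tau v) \<otimes>\<^bsub>env.Q\<^esub> env.q (tau w)"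
      using tau_mult[OF assms(1) v(1) assms(3) False] env.quotient_mult[OF v(2) w] by simp
    also have "\<dots> = env.q (tau ([mul v] @ w))"
      using tau_mult[of "[mul v]" w] env.quotient_mult[OF v(3) w] v(4) assms(3) False eq by simp
    finally show ?thesis by simp
  qed
qed

lemma env_iter:
  assumes "set w \<subseteq> carrier M" "w \<noteq> []" "int (length w) mod modulus = 1 mod modulus"
  shows "env.q (tau w) = env.q (tau [iter w])"
  using assms
proof (induction "length w" arbitrary: w rule: less_induct)
  case less
  consider "length w = 1" | "length w > 1" "length w < n" | "length w \<ge> n"
    using length_ge_1[OF less.prems(2)] by linarith
  then show ?case
  proof cases
    case 1
    then obtain a where "w = [a]" by (auto simp: length_Suc_conv One_nat_def)
    then show ?thesis by (simp add: iter_single)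
  next
    \<comment> \<open>This case is impossible: \<open>length w - 1\<close> would be a multiple of
      \<open>n - 1\<close> strictly between 0 and \<open>n - 1\<close>.\<close>
    case 2
    then have "int (length w) - 1 \<noteq> 0" "0 \<le> int (length w) - 1" "int (length w) - 1 < modulus"
      using int_n by auto
    moreover have "(int (length w) - 1) mod modulus = 0"
      using less.prems(3) by (metis mod_eq_dvd_iff dvd_imp_mod_0)
    ultimately show ?thesis by simp
  next
    case 3
    then obtain v z where w: "w = v @ z" "length v = n" "set v \<subseteq> carrier M" "set z \<subseteq> carrier M"
      using less.prems nary_splitting by blast
    have len: "int (length w) = int (length (mul v # z)) + modulus" using w int_n by simp
    have "env.q (tau (mul v # z)) = env.q (tau [iter (mul v # z)])"
    proof (rule less.hyps)
      show "length (mul v # z) < length w" using w n by simp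
      show "int (length (mul v # z)) mod modulus = 1 mod modulus"
        using less.prems(3) unfolding len by simp
    qed (use w mul_closed in auto)
    then show ?thesis using w env_gen_eq[of v z] by (simp only: iter_append)
  qed
qed

text \<open>
  The iterated product is well defined on the quotient because every \<open>b \<otimes> g \<otimes> c\<close> with \<open>g\<close> a generator
  of the ideal is killed; the set below is the largest ideal contained in the kernel.
\<close>

lemma env_retraction:
  obtains f where "f \<in> linear_maps R env.Q M"
    "\<And>w. set w \<subseteq> carrier M \<Longrightarrow> w \<noteq> [] \<Longrightarrow> f (env.q (tau w)) = iter w"
proof -
  obtain \<phi> where lin: "\<phi> \<in> linear_maps R TA M"
    and tau: "\<And>w. set w \<subseteq> carrier M \<Longrightarrow> w \<noteq> [] \<Longrightarrow> \<phi> (tau w) = iter w"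
    using tensor_algebra_lift[OF module_axioms iter_multilinear] by blast
  note \<phi> = linear_mapsD[OF lin] linear_maps_diff[OF TA.module_axioms module_axioms lin]
    linear_maps_zero[OF TA.module_axioms module_axioms lin]
  note [simp del] = list.size(4)
  let ?J = "{t \<in> carrier TA. \<phi> t = \<zero>\<^bsub>M\<^esub> \<and> (\<forall>b\<in>carrier TA. \<phi> (b \<otimes>\<^bsub>TA\<^esub> t) = \<zero>\<^bsub>M\<^esub> \<and> \<phi> (t \<otimes>\<^bsub>TA\<^esub> b) = \<zero>\<^bsub>M\<^esub> \<and>
    (\<forall>c\<in>carrier TA. \<phi> (b \<otimes>\<^bsub>TA\<^esub> t \<otimes>\<^bsub>TA\<^esub> c) = \<zero>\<^bsub>M\<^esub>))}"
  have "submodule ?J R TA"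
    by (rule TA.submoduleI')
      (auto simp: \<phi> TA.mult_l_distr TA.mult_r_distr TA.smult_mult_l TA.smult_mult_r TA.mult_closed)
  moreover have "b \<otimes>\<^bsub>TA\<^esub> x \<in> ?J" if "x \<in> ?J" "b \<in> carrier TA" for x b
    using that by (simp add: TA.mult_closed flip: TA.mult_assoc)
  moreover have "x \<otimes>\<^bsub>TA\<^esub> b \<in> ?J" if "x \<in> ?J" "b \<in> carrier TA" for x b
  proof -
    have x: "x \<in> carrier TA" and 1: "\<And>c. c \<in> carrier TA \<Longrightarrow> \<phi> (x \<otimes>\<^bsub>TA\<^esub> c) = \<zero>\<^bsub>M\<^esub>"
      and 2: "\<And>b c. b \<in> carrier TA \<Longrightarrow> c \<in> carrier TA \<Longrightarrow> \<phi> (b \<otimes>\<^bsub>TA\<^esub> x \<otimes>\<^bsub>TA\<^esub> c) = \<zero>\<^bsub>M\<^esub>"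
      using that by blast+
    have "\<phi> (x \<otimes>\<^bsub>TA\<^esub> b \<otimes>\<^bsub>TA\<^esub> c) = \<zero>\<^bsub>M\<^esub>" if "c \<in> carrier TA" for c
      using 1[of "b \<otimes>\<^bsub>TA\<^esub> c"] x \<open>b \<in> carrier TA\<close> that by (simp add: TA.mult_closed TA.mult_assoc)
    moreover have "\<phi> (a \<otimes>\<^bsub>TA\<^esub> (x \<otimes>\<^bsub>TA\<^esub> b)) = \<zero>\<^bsub>M\<^esub>" if "a \<in> carrier TA" for a
      using 2[of a b] x \<open>b \<in> carrier TA\<close> that by (simp add: TA.mult_closed TA.mult_assoc)
    moreover have "\<phi> (a \<otimes>\<^bsub>TA\<^esub> (x \<otimes>\<^bsub>TA\<^esub> b) \<otimes>\<^bsub>TA\<^esub> c) = \<zero>\<^bsub>M\<^esub>"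
      if "a \<in> carrier TA" "c \<in> carrier TA" for a c
      using 2[of a "b \<otimes>\<^bsub>TA\<^esub> c"] x \<open>b \<in> carrier TA\<close> that by (simp add: TA.mult_closed TA.mult_assoc)
    moreover have "x \<otimes>\<^bsub>TA\<^esub> b \<in> carrier TA" "\<phi> (x \<otimes>\<^bsub>TA\<^esub> b) = \<zero>\<^bsub>M\<^esub>"
      using x 1 \<open>b \<in> carrier TA\<close> TA.mult_closed by auto
    ultimately show ?thesis by blast
  qed
  ultimately have ideal: "algebra_ideal R TA ?J"
    unfolding algebra_ideal_def by (intro conjI ballI)
  have "I \<subseteq> ?J"
  proof (rule env_ideal_minimal[OF ideal])
    fix v assume v: "set v \<subseteq> carrier M" "length v = n"
    let ?g = "tau v \<ominus>\<^bsub>TA\<^esub> tau [mul v]"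
    have v': "v \<noteq> []" "tau v \<in> carrier TA" "tau [mul v] \<in> carrier TA" "mul v \<in> carrier M"
      using v n by (auto intro!: tau_nary_carrier tau_single_carrier mul_closed)
    then have g: "?g \<in> carrier TA" by simp
    \<comment> \<open>Here \<open>u\<close> and \<open>w\<close> may be empty, so this single
      equation is the source of all four conditions on a generator.\<close>
    have tau': "\<phi> (tau (u @ v @ w)) = \<phi> (tau (u @ [mul v] @ w))"
      if "set u \<subseteq> carrier M" "set w \<subseteq> carrier M" for u w
    proof -
      have "\<phi> (tau (u @ v @ w)) = iter (u @ v @ w)" "\<phi> (tau (u @ [mul v] @ w)) = iter (u @ [mul v] @ w)"
        using that v v' by (intro tau; auto)+
      then show ?thesis using iter_insert[OF that(1) v(1) that(2) v(2)] by (simp only:)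
    qed
    have diff: "\<phi> (tau (u @ v @ w) \<ominus>\<^bsub>TA\<^esub> tau (u @ [mul v] @ w)) = \<zero>\<^bsub>M\<^esub>"
      if "set u \<subseteq> carrier M" "set w \<subseteq> carrier M" for u w
    proof -
      have "tau (u @ v @ w) \<in> carrier TA" "tau (u @ [mul v] @ w) \<in> carrier TA"
        using that v v' by (intro tau_carrier; auto)+
      then show ?thesis using tau'[OF that] \<phi> M.diff_eq_zero_iff by simp
    qed
    have gr: "?g \<otimes>\<^bsub>TA\<^esub> tau w = tau (v @ w) \<ominus>\<^bsub>TA\<^esub> tau ([mul v] @ w)"
      if "set w \<subseteq> carrier M" "w \<noteq> []" for w
      using that v v' tau_carrier[OF that] tau_mult[of v w] tau_mult[of "[mul v]" w]
      by (simp add: TA.mult_diff)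
    have gl: "tau u \<otimes>\<^bsub>TA\<^esub> ?g = tau (u @ v) \<ominus>\<^bsub>TA\<^esub> tau (u @ [mul v])"
      if "set u \<subseteq> carrier M" "u \<noteq> []" for u
      using that v v' tau_carrier[OF that] tau_mult[of u v] tau_mult[of u "[mul v]"]
      by (simp add: TA.mult_diff)
    have glr: "tau u \<otimes>\<^bsub>TA\<^esub> ?g \<otimes>\<^bsub>TA\<^esub> tau w = tau (u @ v @ w) \<ominus>\<^bsub>TA\<^esub> tau (u @ [mul v] @ w)"
      if u: "set u \<subseteq> carrier M" "u \<noteq> []" and w: "set w \<subseteq> carrier M" "w \<noteq> []" for u w
    proof -
      have "tau (u @ v) \<in> carrier TA" "tau (u @ [mul v]) \<in> carrier TA"
        using u v v' by (intro tau_carrier; auto)+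
      then show ?thesis
        using u w v v' tau_carrier[OF w] gl[OF u] tau_mult[of "u @ v" w] tau_mult[of "u @ [mul v]" w]
        by (simp add: TA.mult_diff)
    qed
    have l: "\<phi> (b \<otimes>\<^bsub>TA\<^esub> ?g) = \<zero>\<^bsub>M\<^esub>" if "b \<in> carrier TA" for b
      using that
    proof (induction rule: tensor_algebra_induct)
      case (tau w)
      then show ?case using gl[of w] diff[of w "[]"] by simp
    qed (use g in \<open>simp add: TA.mult_l_distr \<phi> TA.mult_closed\<close>)
    have r: "\<phi> (?g \<otimes>\<^bsub>TA\<^esub> b) = \<zero>\<^bsub>M\<^esub>" if "b \<in> carrier TA" for b
      using that
    proof (induction rule: tensor_algebra_induct)
      case (tau w)
      then show ?case using gr[of w] diff[of "[]" w] by simp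
    qed (use g in \<open>simp add: TA.mult_r_distr \<phi> TA.mult_closed\<close>)
    have lr: "\<phi> (tau u \<otimes>\<^bsub>TA\<^esub> ?g \<otimes>\<^bsub>TA\<^esub> c) = \<zero>\<^bsub>M\<^esub>"
      if u: "set u \<subseteq> carrier M" "u \<noteq> []" and "c \<in> carrier TA" for u c
      using that(3)
    proof (induction rule: tensor_algebra_induct)
      case (tau w)
      then show ?case using glr[OF u, of w] diff[of u w] u by simp
    qed (use g tau_carrier[OF u] in \<open>simp add: TA.mult_r_distr \<phi> TA.mult_closed\<close>)
    have "\<phi> (b \<otimes>\<^bsub>TA\<^esub> ?g \<otimes>\<^bsub>TA\<^esub> c) = \<zero>\<^bsub>M\<^esub>" if "b \<in> carrier TA" and c: "c \<in> carrier TA" for b c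
      using that(1)
      by (induction rule: tensor_algebra_induct)
        (use g c lr in \<open>simp_all add: TA.mult_l_distr \<phi> TA.mult_closed\<close>)
    moreover have "\<phi> ?g = \<zero>\<^bsub>M\<^esub>" using diff[of "[]" "[]"] by simp
    ultimately show "?g \<in> ?J" using g l r by blast
  qed
  then have ker: "\<phi> x = \<zero>\<^bsub>M\<^esub>" if "x \<in> I" for x using that by blast
  let ?f = "\<lambda>U. \<phi> (SOME t. t \<in> U)"
  have ex: "\<exists>y\<in>env.q x. ?f (env.q x) = \<phi> y" if "x \<in> carrier TA" for x
    by (rule bexI[OF refl someI[of "\<lambda>t. t \<in> env.q x"]]) (rule env.N.a_rcos_self[OF that])
  have f: "?f \<in> linear_maps R env.Q M" "\<And>x. x \<in> carrier TA \<Longrightarrow> ?f (env.q x) = \<phi> x"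
    by (rule env.quotient_lift_linear[OF module_axioms lin]; use ker ex in blast)+
  show thesis
  proof (rule that[of ?f])
    fix w assume "set w \<subseteq> carrier M" "w \<noteq> []"
    then show "?f (env.q (tau w)) = iter w" using f(2) tau tau_carrier by metis
  qed (rule f(1))
qed

subsection \<open>The grading\<close>

lemmas partD = linear_mapsD[OF degree_part_linear]

lemma part_zero: "part r \<zero>\<^bsub>TA\<^esub> = \<zero>\<^bsub>TA\<^esub>"
  by (rule linear_maps_zero[OF TA.module_axioms TA.module_axioms degree_part_linear])

lemma part_eq_iff:
  assumes "t \<in> carrier TA"
  shows "(\<forall>k\<ge>1. t k \<noteq> \<zero>\<^bsub>TP k\<^esub> \<longrightarrow> int k mod modulus = r) \<longleftrightarrow> part r t = t"
proof -
  interpret D: direct_sum R "{1..}" TP by (rule tensor_direct_sum)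
  have "t \<in> extensional {1..}"
    using assms D.direct_sum_carrierD(1) by (simp add: tensor_algebra_simps)
  then show ?thesis
    unfolding degree_part_def by (auto simp: fun_eq_iff restrict_def extensional_def)
qed

lemma env_component_eq: "env_component R M n m r = env.q ` {t \<in> carrier TA. part r t = t}"
proof -
  have "env_component R M n m r = env.q ` {t \<in> carrier TA. \<forall>k\<ge>1. t k \<noteq> \<zero>\<^bsub>TP k\<^esub> \<longrightarrow> int k mod modulus = r}"
    unfolding env_component_def modulus_def by blast
  also have "{t \<in> carrier TA. \<forall>k\<ge>1. t k \<noteq> \<zero>\<^bsub>TP k\<^esub> \<longrightarrow> int k mod modulus = r} =
      {t \<in> carrier TA. part r t = t}"
    using part_eq_iff by blast
  finally show ?thesis .
qed

lemma part_part:
  assumes "t \<in> carrier TA"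
  shows "part r (part s t) = (if r = s then part r t else \<zero>\<^bsub>TA\<^esub>)"
  using assms
  by (induction rule: tensor_algebra_induct) (auto simp: degree_part_tau part_zero partD)

text \<open>Multiplication by a word of length \<open>l\<close> shifts residues by \<open>l\<close>,
  so residue \<open>r\<close> of the product comes from residue \<open>r - l\<close> of
  \<open>t\<close>. The bounds say that \<open>r\<close> is a reduced residue.\<close>

lemma part_tau_mult:
  assumes u: "set u \<subseteq> carrier M" "u \<noteq> []" and r: "0 \<le> r" "r < modulus" and "t \<in> carrier TA"
  shows "part r (tau u \<otimes>\<^bsub>TA\<^esub> t) = tau u \<otimes>\<^bsub>TA\<^esub> part ((r - int (length u)) mod modulus) t"
    and "part r (t \<otimes>\<^bsub>TA\<^esub> tau u) = part ((r - int (length u)) mod modulus) t \<otimes>\<^bsub>TA\<^esub> tau u"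
proof -
  note u' = tau_carrier[OF u]
  have eq: "int (length u + k) mod modulus = r \<longleftrightarrow>
      int k mod modulus = (r - int (length u)) mod modulus" for k
  proof -
    have "int (length u + k) mod modulus = r \<longleftrightarrow> (int (length u) + int k) mod modulus = r mod modulus"
      using r by simp
    also have "\<dots> \<longleftrightarrow> int k mod modulus = (r - int (length u)) mod modulus"
      by (simp add: mod_eq_dvd_iff algebra_simps)
    finally show ?thesis .
  qed
  show "part r (tau u \<otimes>\<^bsub>TA\<^esub> t) = tau u \<otimes>\<^bsub>TA\<^esub> part ((r - int (length u)) mod modulus) t"
    using assms(5)
  proof (induction rule: tensor_algebra_induct)
    case (tau w)
    then show ?case
      using u u' tau_mult[OF u tau] degree_part_tau[of "\<lambda>k. int k mod modulus = r" "u @ w"] eq[of "length w"]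
      by (simp add: degree_part_tau)
  qed (use u' in \<open>simp add: TA.mult_r_distr partD TA.mult_closed\<close>)
  show "part r (t \<otimes>\<^bsub>TA\<^esub> tau u) = part ((r - int (length u)) mod modulus) t \<otimes>\<^bsub>TA\<^esub> tau u"
    using assms(5)
  proof (induction rule: tensor_algebra_induct)
    case (tau w)
    then show ?case
      using u u' tau_mult[OF tau u] degree_part_tau[of "\<lambda>k. int k mod modulus = r" "w @ u"] eq[of "length w"]
      by (simp add: degree_part_tau add.commute)
  qed (use u' in \<open>simp add: TA.mult_l_distr partD TA.mult_closed\<close>)
qed

text \<open>The tensors all of whose parts lie in \<open>I\<close> form an ideal that contains the
  generators, hence contains \<open>I\<close>. All residues are quantified together, since
  multiplication by a word permutes them.\<close>

lemma env_ideal_homogeneous: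
  assumes "x \<in> I" "0 \<le> r" "r < modulus"
  shows "part r x \<in> I"
proof -
  note [simp del] = list.size(4)
  note IE = TA.submoduleE[OF env.N] TA.submodule_zero_mem[OF env.N]
  let ?H = "{t \<in> carrier TA. \<forall>r. 0 \<le> r \<longrightarrow> r < modulus \<longrightarrow> part r t \<in> I}"
  have sub: "submodule ?H R TA"
    by (rule TA.submoduleI') (use IE in \<open>auto simp: partD part_zero\<close>)
  note HE = TA.submoduleE[OF sub]
  have ideal: "b \<otimes>\<^bsub>TA\<^esub> t \<in> I \<and> t \<otimes>\<^bsub>TA\<^esub> b \<in> I" if "t \<in> I" "b \<in> carrier TA" for t b
    using env_ideal that by (simp add: algebra_ideal_def)
  have "b \<otimes>\<^bsub>TA\<^esub> t \<in> ?H \<and> t \<otimes>\<^bsub>TA\<^esub> b \<in> ?H" if t: "t \<in> ?H" and "b \<in> carrier TA" for b t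
    using that(2)
  proof (induction rule: tensor_algebra_induct)
    case (tau u)
    have res: "0 \<le> (r - int (length u)) mod modulus" "(r - int (length u)) mod modulus < modulus" for r
      using modulus_pos by auto
    have "part ((r - int (length u)) mod modulus) t \<in> I" for r using t res by blast
    then show ?case
      using t part_tau_mult[OF tau] tau_carrier[OF tau] ideal TA.mult_closed by auto
  next
    case (add b c)
    have t': "t \<in> carrier TA" using t by blast
    show ?case
      unfolding TA.mult_l_distr[OF add(1,2) t'] TA.mult_r_distr[OF t' add(1,2)]
      using add(3,4) HE(5) by blast
  qed
  then have H: "algebra_ideal R TA ?H" using sub unfolding algebra_ideal_def by blast
  have "I \<subseteq> ?H"
  proof (rule env_ideal_minimal[OF H])
    fix v assume v: "set v \<subseteq> carrier M" "length v = n"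
    have v': "tau v \<in> carrier TA" "tau [mul v] \<in> carrier TA"
      using v by (auto intro!: tau_nary_carrier tau_single_carrier mul_closed)
    have "part r (tau v \<ominus>\<^bsub>TA\<^esub> tau [mul v]) \<in> I" for r
    proof -
      have "part r (tau v \<ominus>\<^bsub>TA\<^esub> tau [mul v]) = part r (tau v) \<ominus>\<^bsub>TA\<^esub> part r (tau [mul v])"
        by (rule linear_maps_diff[OF TA.module_axioms TA.module_axioms degree_part_linear v'])
      \<comment> \<open>The two terms of a generator have degrees \<open>n\<close> and 1, which are
        congruent, so a part of the generator is either all of it or zero.\<close>
      also have "\<dots> = (if 1 mod modulus = r then tau v \<ominus>\<^bsub>TA\<^esub> tau [mul v] else \<zero>\<^bsub>TA\<^esub>)"
      proof -
        have "length [mul v] = 1" by (simp add: list.size One_nat_def)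
        then show ?thesis
          using degree_part_tau[of "\<lambda>k. int k mod modulus = r" v]
            degree_part_tau[of "\<lambda>k. int k mod modulus = r" "[mul v]"]
          by (simp add: v(2) n_mod TA.diff_zero)
      qed
      finally show ?thesis using env_ideal_gen[OF v] IE by simp
    qed
    then show "tau v \<ominus>\<^bsub>TA\<^esub> tau [mul v] \<in> ?H" using v' by simp
  qed
  then show ?thesis using assms by blast
qed

definition "env_part r U = env.q (part r (SOME t. t \<in> U))"

lemma env_part:
  assumes r: "0 \<le> r" "r < modulus"
  shows "env_part r \<in> linear_maps R env.Q env.Q"
    and "\<And>t. t \<in> carrier TA \<Longrightarrow> env_part r (env.q t) = env.q (part r t)"
proof -
  let ?f = "\<lambda>t. env.q (part r t)"
  have lin: "?f \<in> linear_maps R TA env.Q"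
    by (rule linear_maps_comp[OF degree_part_linear env.quotient_map_linear])
  have ker: "?f x = \<zero>\<^bsub>env.Q\<^esub>" if "x \<in> I" for x
  proof -
    have "part r x \<in> I" by (rule env_ideal_homogeneous[OF that r])
    then show ?thesis using env.quotient_eq_zero_iff TA.submoduleE(1)[OF env.N] by blast
  qed
  have ex: "\<exists>y\<in>env.q x. env_part r (env.q x) = ?f y" if "x \<in> carrier TA" for x
    unfolding env_part_def
    by (rule bexI[OF refl someI[of "\<lambda>t. t \<in> env.q x"]]) (rule env.N.a_rcos_self[OF that])
  show "env_part r \<in> linear_maps R env.Q env.Q"
    "\<And>t. t \<in> carrier TA \<Longrightarrow> env_part r (env.q t) = env.q (part r t)"
    by (rule env.quotient_lift_linear[OF O.module_axioms lin]; use ker ex in blast)+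
qed

text \<open>A class fixed by \<open>env_part r\<close> may be given by a tensor \<open>t\<close>
  that \<open>part r\<close> does not fix; \<open>part r t\<close> represents the same class and is
  fixed.\<close>

lemma env_component_fixed:
  assumes r: "0 \<le> r" "r < modulus"
  shows "env_component R M n m r = {U \<in> carrier env.Q. env_part r U = U}"
proof
  show "env_component R M n m r \<subseteq> {U \<in> carrier env.Q. env_part r U = U}"
    by (auto simp: env_component_eq env.quotient_carrier env_part(2)[OF r])
  show "{U \<in> carrier env.Q. env_part r U = U} \<subseteq> env_component R M n m r"
  proof
    fix U assume "U \<in> {U \<in> carrier env.Q. env_part r U = U}"
    then obtain t where t: "t \<in> carrier TA" "U = env.q t" "env_part r U = U"
      by (auto simp: env.quotient_carrier)
    then have "U = env.q (part r t)" using env_part(2)[OF r] by simp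
    then show "U \<in> env_component R M n m r"
      unfolding env_component_eq using t part_part[of t r r] partD(1) by auto
  qed
qed

text \<open>Induction on \<open>s\<close> alone suffices, as \<open>part_tau_mult\<close> allows an
  arbitrary second factor. A word of residue \<open>g\<close> turns \<open>g + h\<close> back into
  \<open>h\<close>; \<open>part g\<close> kills all other words.\<close>

lemma part_mult:
  assumes "s \<in> carrier TA" "t \<in> carrier TA" "0 \<le> g" "g < modulus" "0 \<le> h" "h < modulus"
  shows "part ((g + h) mod modulus) (part g s \<otimes>\<^bsub>TA\<^esub> part h t) = part g s \<otimes>\<^bsub>TA\<^esub> part h t"
  using assms(1)
proof (induction rule: tensor_algebra_induct)
  case (tau u)
  note u' = tau_carrier[OF tau]
  have "part ((g + h) mod modulus) (tau u \<otimes>\<^bsub>TA\<^esub> part h t) = tau u \<otimes>\<^bsub>TA\<^esub> part h t"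
    if u: "int (length u) mod modulus = g"
  proof -
    have "((g + h) mod modulus - int (length u)) mod modulus = (g + h - g) mod modulus"
      unfolding u[symmetric] by (simp add: mod_simps)
    also have "\<dots> = h" using assms by simp
    finally show ?thesis
      using part_tau_mult(1)[OF tau, of "(g + h) mod modulus" "part h t"] modulus_pos assms partD(1) part_part
      by simp
  qed
  then show ?case
    using assms u' partD(1) by (simp add: degree_part_tau part_zero)
next
  case (add a b)
  have c: "part g a \<in> carrier TA" "part g b \<in> carrier TA" "part h t \<in> carrier TA"
    using add assms partD(1) by auto
  then show ?case
    using add by (simp add: partD(2) TA.mult_l_distr TA.mult_closed)
qed

text \<open>By additivity it is enough to take the class of a word, to which a single residue
  contributes.\<close>

lemma sum_parts:
  assumes "U \<in> carrier env.Q"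
  shows "U = (\<Oplus>\<^bsub>env.Q\<^esub>r\<in>{0..<modulus}. env_part r U)"
proof -
  obtain t where t: "t \<in> carrier TA" "U = env.q t" using assms by (auto simp: env.quotient_carrier)
  have carr: "env_part r (env.q t) \<in> carrier env.Q" if "r \<in> {0..<modulus}" "t \<in> carrier TA" for r t
    using that linear_mapsD(1)[OF env_part(1)] env.quotient_carrier by auto
  have "env.q t = (\<Oplus>\<^bsub>env.Q\<^esub>r\<in>{0..<modulus}. env_part r (env.q t))"
    using t(1)
  proof (induction rule: tensor_algebra_induct)
    case (tau w)
    let ?r = "int (length w) mod modulus"
    have r: "?r \<in> {0..<modulus}" using modulus_pos by auto
    note w = tau_carrier[OF tau]
    have qw: "env.q (tau w) \<in> carrier env.Q" by (rule linear_mapsD(1)[OF env.quotient_map_linear w])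
    have val: "env_part r (env.q (tau w)) = (if r = ?r then env.q (tau w) else \<zero>\<^bsub>env.Q\<^esub>)"
      if "r \<in> {0..<modulus}" for r
      using that env_part(2)[of r, OF _ _ w] by (auto simp: degree_part_tau env.quotient_zero)
    have "(\<Oplus>\<^bsub>env.Q\<^esub>r\<in>{0..<modulus}. env_part r (env.q (tau w))) =
        (\<Oplus>\<^bsub>env.Q\<^esub>r\<in>{?r}. env_part r (env.q (tau w)))"
      by (rule O.add.finprod_mono_neutral_cong_right) (use r carr w val qw in auto)
    also have "\<dots> = env.q (tau w)" using val[OF r] qw by simp
    finally show ?case by simp
  next
    case (add s t)
    have q: "env.q s \<in> carrier env.Q" "env.q t \<in> carrier env.Q" using add by (auto simp: env.quotient_carrier)
    have "(\<Oplus>\<^bsub>env.Q\<^esub>r\<in>{0..<modulus}. env_part r (env.q (s \<oplus>\<^bsub>TA\<^esub> t))) =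
      (\<Oplus>\<^bsub>env.Q\<^esub>r\<in>{0..<modulus}. env_part r (env.q s) \<oplus>\<^bsub>env.Q\<^esub> env_part r (env.q t))"
    proof (rule O.finsum_cong'[OF refl])
      fix r assume "r \<in> {0..<modulus}"
      then show "env_part r (env.q (s \<oplus>\<^bsub>TA\<^esub> t)) = env_part r (env.q s) \<oplus>\<^bsub>env.Q\<^esub> env_part r (env.q t)"
        using linear_mapsD(2)[OF env_part(1) q, of r] env.quotient_add[OF add(1,2)] by simp
    qed (use carr add in auto)
    also have "\<dots> = (\<Oplus>\<^bsub>env.Q\<^esub>r\<in>{0..<modulus}. env_part r (env.q s)) \<oplus>\<^bsub>env.Q\<^esub>
        (\<Oplus>\<^bsub>env.Q\<^esub>r\<in>{0..<modulus}. env_part r (env.q t))"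
      by (rule O.finsum_addf) (use carr add in auto)
    also have "\<dots> = env.q (s \<oplus>\<^bsub>TA\<^esub> t)"
      using add(3,4) env.quotient_add[OF add(1,2)] by simp
    finally show ?case by simp
  qed
  then show ?thesis using t by simp
qed

text \<open>The projections are the maps \<open>env_part g\<close>, with \<open>g\<close> running
  over the reduced residues from 0 to \<open>n - 2\<close>.\<close>

lemma env_graded:
  "graded_algebra (integer_mod_group (n - 1)) R (env_algebra R M n m) (env_component R M n m)"
  unfolding env_algebra_quotient
proof (rule O.graded_algebraI)
  have G: "carrier (integer_mod_group (n - 1)) = {0..<modulus}"
    using n by (simp add: carrier_integer_mod_group modulus_def)
  show "finite (carrier (integer_mod_group (n - 1)))" by (simp add: G)
  fix g assume "g \<in> carrier (integer_mod_group (n - 1))"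
  then have g: "0 \<le> g" "g < modulus" by (auto simp: G)
  show "env_part g \<in> linear_maps R env.Q env.Q" by (rule env_part(1)[OF g])
  show "env_component R M n m g = {x \<in> carrier env.Q. env_part g x = x}"
    by (rule env_component_fixed[OF g])
  fix h assume "h \<in> carrier (integer_mod_group (n - 1))"
  then have h: "0 \<le> h" "h < modulus" by (auto simp: G)
  show "env_part g (env_part h x) = (if g = h then env_part g x else \<zero>\<^bsub>env.Q\<^esub>)"
    if "x \<in> carrier env.Q" for x
    using that env_part(2)[OF g] env_part(2)[OF h] part_part partD(1)
    by (auto simp: env.quotient_carrier env.quotient_zero)
  fix x y assume "x \<in> env_component R M n m g" "y \<in> env_component R M n m h"
  then obtain s t where s: "s \<in> carrier TA" "part g s = s" "x = env.q s"
    and t: "t \<in> carrier TA" "part h t = t" "y = env.q t"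
    by (auto simp: env_component_eq)
  have "x \<otimes>\<^bsub>env.Q\<^esub> y = env.q (s \<otimes>\<^bsub>TA\<^esub> t)" using s t env.quotient_mult by simp
  moreover have "part ((g + h) mod modulus) (s \<otimes>\<^bsub>TA\<^esub> t) = s \<otimes>\<^bsub>TA\<^esub> t"
    using part_mult[OF s(1) t(1) g h] s t by simp
  ultimately have "x \<otimes>\<^bsub>env.Q\<^esub> y \<in> env_component R M n m ((g + h) mod modulus)"
    using s t TA.mult_closed by (auto simp: env_component_eq)
  then show "x \<otimes>\<^bsub>env.Q\<^esub> y \<in> env_component R M n m (g \<otimes>\<^bsub>integer_mod_group (n - 1)\<^esub> h)"
    by (simp add: modulus_def)
next
  fix x assume "x \<in> carrier env.Q"
  then show "x = (\<Oplus>\<^bsub>env.Q\<^esub>g\<in>carrier (integer_mod_group (n - 1)). env_part g x)"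
    using sum_parts n by (simp add: carrier_integer_mod_group modulus_def)
qed

subsection \<open>The component of degree one\<close>

abbreviation "S \<equiv> env_degree_one R M n m"
abbreviation "B \<equiv> subspace_module (env_algebra R M n m) S"

lemma env_degree_one_eq: "S = env_component R M n m (1 mod modulus)"
  by (simp add: env_degree_one_def modulus_def)

lemma degree_one_submodule: "submodule S R env.Q"
proof -
  have "1 mod modulus \<in> carrier (integer_mod_group (n - 1))"
    using n modulus_pos by (simp add: carrier_integer_mod_group modulus_def)
  then show ?thesis
    using env_graded by (simp add: graded_algebra_def env_degree_one_eq env_algebra_quotient)
qed

lemma degree_one_module: "module R B"
  unfolding subspace_module_def env_algebra_quotient
  by (rule submodule.submodule_is_module[OF degree_one_submodule O.module_axioms])

lemma subspace_simps:
  "carrier B = S" "\<zero>\<^bsub>B\<^esub> = \<zero>\<^bsub>env.Q\<^esub>" "x \<oplus>\<^bsub>B\<^esub> y = x \<oplus>\<^bsub>env.Q\<^esub> y" "c \<odot>\<^bsub>B\<^esub> x = c \<odot>\<^bsub>env.Q\<^esub> x"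
  by (simp_all add: subspace_module_def env_algebra_quotient)

lemma degree_one_carrier: "S \<subseteq> carrier env.Q"
  by (rule O.submoduleE(1)[OF degree_one_submodule])

text \<open>The canonical map from \<open>A\<close> to \<open>O(A)\<close>; it turns out to be
  inverse to the retraction on the part of degree one.\<close>

abbreviation "eta a \<equiv> env.q (tau [a])"

lemma eta_linear: "eta \<in> linear_maps R M env.Q"
proof -
  have "(\<lambda>a. pt [a]) \<in> linear_maps R M (TP 1)"
    using multilinear_wordsD(2,3)[OF pure_tensor_multilinear[of 1], of "[]" "[]"]
      pure_tensor_carrier[of "[_]" 1]
    by (intro linear_mapsI) (auto simp: One_nat_def)
  from linear_maps_comp[OF linear_maps_comp[OF this tensor_inclusion_linear] env.quotient_map_linear]
  show ?thesis by (simp add: One_nat_def)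
qed

lemma eta_mem:
  assumes "a \<in> carrier M"
  shows "eta a \<in> S"
proof -
  have "part (1 mod modulus) (tau [a]) = tau [a]" by (subst degree_part_tau) simp
  then show ?thesis
    using tau_single_carrier[OF assms] by (auto simp: env_degree_one_eq env_component_eq)
qed

text \<open>Translates products of letters in \<open>O(A)\<close> back into words, to which the
  defining relations apply.\<close>

lemma eta_word:
  assumes "set w \<subseteq> carrier M" "w \<noteq> []"
  shows "O.wprod (map eta w) = env.q (tau w)"
  using assms
proof (induction w rule: rev_induct)
  case (snoc x xs)
  show ?case
  proof (cases "xs = []")
    case False
    have "O.wprod (map eta (xs @ [x])) = O.wprod (map eta xs) \<otimes>\<^bsub>env.Q\<^esub> eta x"
      using O.wprod_snoc[of "map eta xs" "eta x"] False by simp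
    also have "\<dots> = env.q (tau xs \<otimes>\<^bsub>TA\<^esub> tau [x])"
      using snoc False env.quotient_mult[OF tau_carrier[of xs] tau_single_carrier[of x]] by simp
    also have "tau xs \<otimes>\<^bsub>TA\<^esub> tau [x] = tau (xs @ [x])"
      using snoc.prems False by (intro tau_mult) auto
    finally show ?thesis .
  qed simp
qed simp

text \<open>By \<open>env_iter\<close> a word of degree congruent to 1 has the class of the single
  letter \<open>iter w\<close>, and \<open>f\<close> returns exactly that letter.\<close>

lemma degree_one_eta:
  assumes f: "f \<in> linear_maps R env.Q M"
    and tau: "\<And>w. set w \<subseteq> carrier M \<Longrightarrow> w \<noteq> [] \<Longrightarrow> f (env.q (tau w)) = iter w"
    and "U \<in> S"
  shows "eta (f U) = U"
proof -
  note eta0 = linear_maps_zero[OF module_axioms O.module_axioms eta_linear]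
    and f0 = linear_maps_zero[OF O.module_axioms module_axioms f]
  note linear = linear_mapsD[OF linear_maps_comp[OF f eta_linear]]
  obtain t where t: "t \<in> carrier TA" "part (1 mod modulus) t = t" "U = env.q t"
    using assms(3) by (auto simp: env_degree_one_eq env_component_eq)
  \<comment> \<open>Stated for the part of an arbitrary tensor, because the condition
    \<open>part (1 mod modulus) t = t\<close> would not pass to the summands in the
    induction.\<close>
  have "eta (f (env.q (part (1 mod modulus) t))) = env.q (part (1 mod modulus) t)"
    using t(1)
  proof (induction rule: tensor_algebra_induct)
    case (tau w)
    show ?case
    proof (cases "int (length w) mod modulus = 1 mod modulus")
      case True
      then show ?thesis using env_iter[OF tau True] assms(2)[OF tau] unfolding degree_part_tau by simp
    next
      case False
      then show ?thesis
        using eta0 f0 unfolding degree_part_tau by (simp add: env.quotient_zero)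
    qed
  next
    case (add s t)
    have c: "part (1 mod modulus) s \<in> carrier TA" "part (1 mod modulus) t \<in> carrier TA"
      using add partD(1) by auto
    then have q: "env.q (part (1 mod modulus) s) \<in> carrier env.Q" "env.q (part (1 mod modulus) t) \<in> carrier env.Q"
      by (auto simp: env.quotient_carrier)
    show ?case
      unfolding partD(2)[OF add(1,2)] env.quotient_add[OF c, symmetric] linear(2)[OF q] add(3,4) ..
  qed
  then show ?thesis using t by simp
qed

text \<open>Every factor is \<open>eta\<close> of an element of \<open>A\<close>, so the product is
  the class of a word of \<open>n\<close> letters over \<open>A\<close>, which the defining relation
  turns into one letter.\<close>

lemma wprod_degree_one:
  assumes "set w \<subseteq> S" "length w = n"
  shows "O.wprod w \<in> S"
proof -
  obtain f where f: "f \<in> linear_maps R env.Q M"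
    "\<And>w. set w \<subseteq> carrier M \<Longrightarrow> w \<noteq> [] \<Longrightarrow> f (env.q (tau w)) = iter w"
    by (rule env_retraction) blast
  let ?v = "map f w"
  have v: "set ?v \<subseteq> carrier M" "length ?v = n" "?v \<noteq> []"
    using assms degree_one_carrier linear_mapsD(1)[OF f(1)] n by auto
  have "map eta ?v = w"
    using assms(1) degree_one_eta[OF f] by (auto intro!: map_idI)
  then have "O.wprod w = env.q (tau ?v)" using eta_word[OF v(1,3)] by simp
  also have "\<dots> = eta (mul ?v)" using env_gen_eq[OF v(1,2), of "[]"] by simp
  finally show ?thesis using eta_mem[OF mul_closed[OF v(1,2)]] by simp
qed

text \<open>The tensor power here is that of the subspace, built from words over \<open>S\<close>.
  Multilinearity is inherited from \<open>O(A)\<close>; that the values stay in \<open>S\<close> is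
  \<open>wprod_degree_one\<close>.\<close>

lemma nfold_product_linear:
  "nfold_product R (env_algebra R M n m) S \<in> linear_maps R (tensor_power R B n) B"
  "\<And>w. set w \<subseteq> S \<Longrightarrow> length w = n \<Longrightarrow> nfold_product R (env_algebra R M n m) S (pure_tensor R B w) = O.wprod w"
proof -
  interpret B: tensor_module R B by (intro tensor_module.intro degree_one_module)
  note W = multilinear_wordsD(2,3)[OF O.wprod_multilinear[of n]]
  have ml: "multilinear_words R B n B (\<lambda>w. O.wprod w)"
  proof (rule multilinear_wordsI)
    fix w assume "set w \<subseteq> carrier B" "length w = n"
    then show "O.wprod w \<in> carrier B" using wprod_degree_one by (simp add: subspace_simps)
  next
    fix u v a b assume "set u \<subseteq> carrier B" "set v \<subseteq> carrier B" "length u + 1 + length v = n"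
      "a \<in> carrier B" "b \<in> carrier B"
    then show "O.wprod (u @ [a \<oplus>\<^bsub>B\<^esub> b] @ v) = O.wprod (u @ [a] @ v) \<oplus>\<^bsub>B\<^esub> O.wprod (u @ [b] @ v)"
      unfolding subspace_simps using degree_one_carrier n by (intro W(1)) auto
  next
    fix u v c a assume "set u \<subseteq> carrier B" "set v \<subseteq> carrier B" "length u + 1 + length v = n"
      "c \<in> carrier R" "a \<in> carrier B"
    then show "O.wprod (u @ [c \<odot>\<^bsub>B\<^esub> a] @ v) = c \<odot>\<^bsub>B\<^esub> O.wprod (u @ [a] @ v)"
      unfolding subspace_simps using degree_one_carrier n by (intro W(2)) auto
  qed
  show "nfold_product R (env_algebra R M n m) S \<in> linear_maps R (tensor_power R B n) B"
    using B.tensor_lift_linear(1)[OF degree_one_module ml]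
    by (simp add: nfold_product_def env_algebra_quotient)
  show "nfold_product R (env_algebra R M n m) S (pure_tensor R B w) = O.wprod w"
    if "set w \<subseteq> S" "length w = n" for w
  proof -
    have "set w \<subseteq> carrier B" using that by (simp add: subspace_simps)
    from B.tensor_lift_linear(2)[OF degree_one_module ml this that(2)] show ?thesis
      by (simp add: nfold_product_def env_algebra_quotient)
  qed
qed

text \<open>Wherever the inner product is placed, the result is the product of all
  \<open>2 n - 1\<close> letters in the associative algebra \<open>O(A)\<close>.\<close>

lemma degree_one_assoc_nary: "assoc_nary_algebra R B n (nfold_product R (env_algebra R M n m) S)"
proof -
  interpret B: tensor_module R B by (intro tensor_module.intro degree_one_module)
  let ?m = "nfold_product R (env_algebra R M n m) S"
  have prod: "?m (pure_tensor R B (B.insert_word n ?m i w)) = O.wprod w"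
    if i: "i < n" and w: "set w \<subseteq> S" "length w = 2 * n - 1" for i w
  proof -
    let ?u = "take i w" and ?v = "take n (drop i w)" and ?z = "drop (i + n) w"
    have split: "w = ?u @ ?v @ ?z" by (metis add.commute append_take_drop_id drop_drop)
    have sets: "set ?u \<subseteq> S" "set ?v \<subseteq> S" "set ?z \<subseteq> S"
      using w(1) by (auto dest: in_set_takeD in_set_dropD)
    note sets' = sets[THEN order_trans[OF _ degree_one_carrier]]
    have len: "length ?v = n" "length (?u @ [x] @ ?z) = n" for x :: "(nat \<Rightarrow> ('c list \<Rightarrow> 'a) set) set"
      using i w by auto
    have v: "?v \<noteq> []" "O.wprod ?v \<in> S" "O.wprod ?v \<in> carrier env.Q"
      using len n wprod_degree_one[OF sets(2) len(1)] degree_one_carrier by auto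
    have "O.wprod (?u @ [O.wprod ?v] @ ?z) = O.wprod (?u @ ?v @ ?z)"
    proof -
      \<comment> \<open>Bracketing the block first is harmless by associativity. Empty words on
        either side need their own case, since an empty product is not a unit.\<close>
      have r: "O.wprod ([O.wprod ?v] @ ?z) = O.wprod (?v @ ?z)"
        using O.wprod_append[OF sets'(2) v(1) sets'(3)] O.wprod_append[of "[O.wprod ?v]" ?z] v(3) sets'(3)
        by (cases "?z = []") auto
      show ?thesis
      proof (cases "?u = []")
        case False
        have "O.wprod (?u @ [O.wprod ?v] @ ?z) = O.wprod ?u \<otimes>\<^bsub>env.Q\<^esub> O.wprod ([O.wprod ?v] @ ?z)"
          using sets' v False by (intro O.wprod_append) auto
        also have "\<dots> = O.wprod (?u @ ?v @ ?z)"
          unfolding r using sets' v False by (intro O.wprod_append[symmetric]) auto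
        finally show ?thesis .
      qed (simp only: r append_Nil)
    qed
    moreover have "?m (pure_tensor R B (?u @ [O.wprod ?v] @ ?z)) = O.wprod (?u @ [O.wprod ?v] @ ?z)"
      using sets v len by (intro nfold_product_linear(2)) auto
    ultimately show ?thesis
      unfolding B.insert_word_def nfold_product_linear(2)[OF sets(2) len(1)] split[symmetric] by simp
  qed
  then show ?thesis
    unfolding B.assoc_nary_algebra_iff using nfold_product_linear(1) by (simp add: subspace_simps)
qed

text \<open>The isomorphism is the retraction restricted to degree one, with inverse
  \<open>eta\<close>. It respects the products because on a word of \<open>n\<close> letters
  \<open>iter\<close> is just \<open>mul\<close>.\<close>

lemma degree_one_iso:
  "nary_algebra_iso R n B (nfold_product R (env_algebra R M n m) S) M m \<noteq> {}"
proof -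
  obtain f where f: "f \<in> linear_maps R env.Q M"
    and tau: "\<And>w. set w \<subseteq> carrier M \<Longrightarrow> w \<noteq> [] \<Longrightarrow> f (env.q (tau w)) = iter w"
    by (rule env_retraction) blast
  note eta = degree_one_eta[OF f tau]
  note fD = linear_mapsD[OF f]
  have f_eta: "f (eta a) = a" if "a \<in> carrier M" for a
    using tau[of "[a]"] that by (simp add: iter_single)
  have "f \<in> linear_maps R B M"
    by (rule linear_mapsI) (simp_all add: subspace_simps fD subsetD[OF degree_one_carrier])
  moreover have "bij_betw f (carrier B) (carrier M)"
    unfolding subspace_simps
    by (rule bij_betwI[where g = eta]) (use eta f_eta eta_mem degree_one_carrier fD(1) in auto)
  moreover have "f (nfold_product R (env_algebra R M n m) S (pure_tensor R B w)) = m (pt (map f w))"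
    if "w \<in> words B n" for w
  proof -
    have w: "set w \<subseteq> S" "length w = n" using that by (auto simp: words_def subspace_simps)
    let ?v = "map f w"
    have v: "set ?v \<subseteq> carrier M" "length ?v = n" "?v \<noteq> []"
      using w degree_one_carrier fD(1) n by auto
    have "map eta ?v = w" using w(1) eta by (auto intro!: map_idI)
    then have "nfold_product R (env_algebra R M n m) S (pure_tensor R B w) = env.q (tau ?v)"
      using nfold_product_linear(2)[OF w] eta_word[OF v(1,3)] by simp
    then show ?thesis
      using tau[OF v(1,3)] iter_append[OF v(2), of "[]"] by (simp add: iter_single)
  qed
  ultimately show ?thesis unfolding nary_algebra_iso_def by blast
qed

end

text \<open>The middle conjunct is stated because \<open>nary_algebra_iso\<close> compares two
  operations without asking that either defines an associative n-ary algebra.\<close>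

theorem mainTheorem2:
  fixes K :: "('k, 'x) ring_scheme"
    and A :: "('k, 'a, 'y) module_scheme"
    and n :: nat
    and m :: "('a list \<Rightarrow> 'k) set \<Rightarrow> 'a"
  assumes "n \<ge> 2"
    and "field K"
    and "assoc_nary_algebra K A n m"
  shows "graded_algebra (integer_mod_group (n - 1)) K (env_algebra K A n m) (env_component K A n m) \<and>
    assoc_nary_algebra K
      (subspace_module (env_algebra K A n m) (env_degree_one K A n m)) n
      (nfold_product K (env_algebra K A n m) (env_degree_one K A n m)) \<and>
    nary_algebra_iso K n
      (subspace_module (env_algebra K A n m) (env_degree_one K A n m))
      (nfold_product K (env_algebra K A n m) (env_degree_one K A n m))
      A m \<noteq> {}"
proof -
  have "module K A" using assms(3) by (simp add: assoc_nary_algebra_def)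
  then interpret nary_algebra K A n m
    by (intro nary_algebra.intro nary_algebra_axioms.intro tensor_module.intro assms)
  show ?thesis using env_graded degree_one_assoc_nary degree_one_iso by blast
qed

end
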